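(* Let $(X,\mu)$ be a standard $\sigma$-finite measure space and let $\mathcal{U},\mathcal{V}\subseteq \mathcal{B}(L^2(X))$ be weak* closed masa-bimodules. If $\mathcal{U}\cap\mathcal{V}$ is a bimodule of uniqueness then $$\overline{\mathcal{U}+\mathcal{V}}^{w^*}\cap\mathcal{K} = \overline{\mathcal{U}\cap\mathcal{K}+\mathcal{V}\cap\mathcal{K}}^{\|\cdot\|}.$$
   Context: $\mathcal{K}$ is the space of compact operators on $L^2(X)$. For $a\in L^\infty(X)$, $M_a$ is multiplication by $a$ on $L^2(X)$, and $\mathcal{D}=\{M_a : a\in L^\infty(X)\}$. A masa-bimodule is a subspace $\mathcal{U}\subseteq\mathcal{B}(L^2(X))$ such that $ATB\in\mathcal{U}$ whenever $T\in\mathcal{U}$ and $A,B\in\mathcal{D}$. A weak* closed masa-bimodule $\mathcal{U}$ is a bimodule of multiplicity if $\mathcal{U}\cap\mathcal{K}\neq\{0\}$, and a bimodule of uniqueness if $\mathcal{U}\cap\mathcal{K}=\{0\}$. $\overline{\,\cdot\,}^{w^*}$ denotes weak* closure in $\mathcal{B}(L^2(X))$ and $\overline{\,\cdot\,}^{\|\cdot\|}$ denotes operator norm closure. *)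

theory Defs
  imports "HOL-Analysis.Analysis"
begin

section \<open>Standard measure spaces\<close>

definition standard_borel_space :: "'a measure \<Rightarrow> bool" where
  "standard_borel_space M \<longleftrightarrow>
     (\<exists>S. topspace S = space M \<and> completely_metrizable_space S \<and> second_countable S \<and>
          sets M = sigma_sets (space M) {G. openin S G})"


section \<open>The Hilbert space of square integrable functions\<close>

definition sq_integrable :: "'a measure \<Rightarrow> ('a \<Rightarrow> complex) set" where
  "sq_integrable M = {f \<in> borel_measurable M. integrable M (\<lambda>x. (cmod (f x))\<^sup>2)}"

definition ae_class :: "'a measure \<Rightarrow> ('a \<Rightarrow> complex) \<Rightarrow> ('a \<Rightarrow> complex) set" where
  "ae_class M f = {g \<in> sq_integrable M. AE x in M. g x = f x}"

definition L2 :: "'a measure \<Rightarrow> ('a \<Rightarrow> complex) set set" where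
  "L2 M = ae_class M ` sq_integrable M"

definition l2_rep :: "('a \<Rightarrow> complex) set \<Rightarrow> 'a \<Rightarrow> complex" where
  "l2_rep u = (SOME f. f \<in> u)"

definition l2_zero :: "'a measure \<Rightarrow> ('a \<Rightarrow> complex) set" where
  "l2_zero M = ae_class M (\<lambda>x. 0)"

definition l2_add ::
    "'a measure \<Rightarrow> ('a \<Rightarrow> complex) set \<Rightarrow> ('a \<Rightarrow> complex) set \<Rightarrow> ('a \<Rightarrow> complex) set" where
  "l2_add M u v = ae_class M (\<lambda>x. l2_rep u x + l2_rep v x)"

definition l2_scale ::
    "'a measure \<Rightarrow> complex \<Rightarrow> ('a \<Rightarrow> complex) set \<Rightarrow> ('a \<Rightarrow> complex) set" where
  "l2_scale M c u = ae_class M (\<lambda>x. c * l2_rep u x)"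

definition l2_inner ::
    "'a measure \<Rightarrow> ('a \<Rightarrow> complex) set \<Rightarrow> ('a \<Rightarrow> complex) set \<Rightarrow> complex" where
  "l2_inner M u v = (LINT x|M. l2_rep u x * cnj (l2_rep v x))"

definition l2_norm :: "'a measure \<Rightarrow> ('a \<Rightarrow> complex) set \<Rightarrow> real" where
  "l2_norm M u = sqrt (LINT x|M. (cmod (l2_rep u x))\<^sup>2)"

definition l2_dist ::
    "'a measure \<Rightarrow> ('a \<Rightarrow> complex) set \<Rightarrow> ('a \<Rightarrow> complex) set \<Rightarrow> real" where
  "l2_dist M u v = sqrt (LINT x|M. (cmod (l2_rep u x - l2_rep v x))\<^sup>2)"

definition l2_topology :: "'a measure \<Rightarrow> ('a \<Rightarrow> complex) set topology" where
  "l2_topology M = Metric_space.mtopology (L2 M) (l2_dist M)"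


section \<open>Bounded operators\<close>

text \<open>Operators are maps on \<^term>\<open>L2 M\<close>, extensional outside it, so that equality of operators
  is equality in HOL.\<close>

type_synonym 'a l2op = "('a \<Rightarrow> complex) set \<Rightarrow> ('a \<Rightarrow> complex) set"

definition bounded_ops :: "'a measure \<Rightarrow> 'a l2op set" where
  "bounded_ops M =
     {T \<in> L2 M \<rightarrow>\<^sub>E L2 M.
        (\<forall>u\<in>L2 M. \<forall>v\<in>L2 M. T (l2_add M u v) = l2_add M (T u) (T v)) \<and>
        (\<forall>c. \<forall>u\<in>L2 M. T (l2_scale M c u) = l2_scale M c (T u)) \<and>
        (\<exists>C. \<forall>u\<in>L2 M. l2_norm M (T u) \<le> C * l2_norm M u)}"

definition op_zero :: "'a measure \<Rightarrow> 'a l2op" where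
  "op_zero M = (\<lambda>u\<in>L2 M. l2_zero M)"

definition op_add :: "'a measure \<Rightarrow> 'a l2op \<Rightarrow> 'a l2op \<Rightarrow> 'a l2op" where
  "op_add M S T = (\<lambda>u\<in>L2 M. l2_add M (S u) (T u))"

definition op_scale :: "'a measure \<Rightarrow> complex \<Rightarrow> 'a l2op \<Rightarrow> 'a l2op" where
  "op_scale M c T = (\<lambda>u\<in>L2 M. l2_scale M c (T u))"

definition op_comp :: "'a measure \<Rightarrow> 'a l2op \<Rightarrow> 'a l2op \<Rightarrow> 'a l2op" where
  "op_comp M S T = compose (L2 M) S T"

definition op_set_plus :: "'a measure \<Rightarrow> 'a l2op set \<Rightarrow> 'a l2op set \<Rightarrow> 'a l2op set" where
  "op_set_plus M U V = {op_add M S T | S T. S \<in> U \<and> T \<in> V}"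

definition op_norm :: "'a measure \<Rightarrow> 'a l2op \<Rightarrow> real" where
  "op_norm M T = (SUP u\<in>{u \<in> L2 M. l2_norm M u \<le> 1}. l2_norm M (T u))"

text \<open>The locale \<^locale>\<open>Metric_space\<close> wants distances to be nonnegative and symmetric off the
  carrier too, hence the conditional.\<close>

definition op_dist :: "'a measure \<Rightarrow> 'a l2op \<Rightarrow> 'a l2op \<Rightarrow> real" where
  "op_dist M S T =
     (if S \<in> bounded_ops M \<and> T \<in> bounded_ops M
      then op_norm M (op_add M S (op_scale M (-1) T)) else 0)"

definition op_norm_topology :: "'a measure \<Rightarrow> 'a l2op topology" where
  "op_norm_topology M = Metric_space.mtopology (bounded_ops M) (op_dist M)"

definition compact_ops :: "'a measure \<Rightarrow> 'a l2op set" where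
  "compact_ops M =
     {T \<in> bounded_ops M.
        compactin (l2_topology M)
          (l2_topology M closure_of (T ` {u \<in> L2 M. l2_norm M u \<le> 1}))}"


section \<open>The weak* topology\<close>

text \<open>The predual of the bounded operators on \<open>L\<^sup>2\<close> is the projective tensor product of \<open>L\<^sup>2\<close> with
  itself (equivalently, the trace class). Each of its elements is a series of elementary tensors of
  two square summable sequences \<open>f\<close>, \<open>g\<close> and acts on an operator \<open>T\<close> as the sum of
  \<open>\<langle>T f\<^sub>n, g\<^sub>n\<rangle>\<close>.\<close>

definition sq_summable_seq :: "'a measure \<Rightarrow> (nat \<Rightarrow> ('a \<Rightarrow> complex) set) \<Rightarrow> bool" where
  "sq_summable_seq M f \<longleftrightarrow> range f \<subseteq> L2 M \<and> summable (\<lambda>n. (l2_norm M (f n))\<^sup>2)"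

definition predual_functionals :: "'a measure \<Rightarrow> ('a l2op \<Rightarrow> complex) set" where
  "predual_functionals M =
     {\<lambda>T. \<Sum>n. l2_inner M (T (f n)) (g n) | f g. sq_summable_seq M f \<and> sq_summable_seq M g}"

definition weak_star_topology :: "'a measure \<Rightarrow> 'a l2op topology" where
  "weak_star_topology M =
     topology_generated_by
       {{T \<in> bounded_ops M. \<phi> T \<in> G} | \<phi> G. \<phi> \<in> predual_functionals M \<and> open G}"


section \<open>Masa-bimodules\<close>

definition L_inf :: "'a measure \<Rightarrow> ('a \<Rightarrow> complex) set" where
  "L_inf M = {a \<in> borel_measurable M. \<exists>C. AE x in M. cmod (a x) \<le> C}"

definition mult_op :: "'a measure \<Rightarrow> ('a \<Rightarrow> complex) \<Rightarrow> 'a l2op" where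
  "mult_op M a = (\<lambda>u\<in>L2 M. ae_class M (\<lambda>x. a x * l2_rep u x))"

definition mult_masa :: "'a measure \<Rightarrow> 'a l2op set" where
  "mult_masa M = mult_op M ` L_inf M"

definition op_subspace :: "'a measure \<Rightarrow> 'a l2op set \<Rightarrow> bool" where
  "op_subspace M U \<longleftrightarrow>
     U \<subseteq> bounded_ops M \<and> op_zero M \<in> U \<and>
     (\<forall>S\<in>U. \<forall>T\<in>U. op_add M S T \<in> U) \<and> (\<forall>c. \<forall>T\<in>U. op_scale M c T \<in> U)"

definition masa_bimodule :: "'a measure \<Rightarrow> 'a l2op set \<Rightarrow> bool" where
  "masa_bimodule M U \<longleftrightarrow>
     op_subspace M U \<and>
     (\<forall>T\<in>U. \<forall>A\<in>mult_masa M. \<forall>B\<in>mult_masa M. op_comp M A (op_comp M T B) \<in> U)"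

definition weak_star_closed_masa_bimodule :: "'a measure \<Rightarrow> 'a l2op set \<Rightarrow> bool" where
  "weak_star_closed_masa_bimodule M U \<longleftrightarrow>
     masa_bimodule M U \<and> closedin (weak_star_topology M) U"

definition bimodule_of_uniqueness :: "'a measure \<Rightarrow> 'a l2op set \<Rightarrow> bool" where
  "bimodule_of_uniqueness M U \<longleftrightarrow>
     weak_star_closed_masa_bimodule M U \<and> U \<inter> compact_ops M = {op_zero M}"


section \<open>The distances are metrics, and the topologies live on the intended carriers\<close>

lemma sq_integrable_add:
  assumes "f \<in> sq_integrable M" "g \<in> sq_integrable M"
  shows "(\<lambda>x. f x + g x) \<in> sq_integrable M"
proof -
  have [measurable]: "f \<in> borel_measurable M" "g \<in> borel_measurable M"
    using assms by (auto simp: sq_integrable_def)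
  have "integrable M (\<lambda>x. 2 * (cmod (f x))\<^sup>2 + 2 * (cmod (g x))\<^sup>2)"
    using assms by (auto simp: sq_integrable_def)
  moreover have "(cmod (f x + g x))\<^sup>2 \<le> 2 * (cmod (f x))\<^sup>2 + 2 * (cmod (g x))\<^sup>2" for x
  proof -
    have "(cmod (f x + g x))\<^sup>2 \<le> (cmod (f x) + cmod (g x))\<^sup>2"
      by (simp add: norm_triangle_ineq)
    also have "\<dots> \<le> 2 * (cmod (f x))\<^sup>2 + 2 * (cmod (g x))\<^sup>2"
      using sum_squares_bound[of "cmod (f x)" "cmod (g x)"] by (simp add: power2_sum)
    finally show ?thesis .
  qed
  ultimately have "integrable M (\<lambda>x. (cmod (f x + g x))\<^sup>2)"
    by (elim Bochner_Integration.integrable_bound) auto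
  then show ?thesis by (simp add: sq_integrable_def)
qed

lemma sq_integrable_scale:
  "f \<in> sq_integrable M \<Longrightarrow> (\<lambda>x. c * f x) \<in> sq_integrable M"
  by (auto simp: sq_integrable_def norm_mult power_mult_distrib)

lemma sq_integrable_diff:
  assumes "f \<in> sq_integrable M" "g \<in> sq_integrable M"
  shows "(\<lambda>x. f x - g x) \<in> sq_integrable M"
  using sq_integrable_add[OF assms(1) sq_integrable_scale[OF assms(2), of "-1"]] by simp

lemma zero_sq_integrable: "(\<lambda>x. 0) \<in> sq_integrable M"
  by (simp add: sq_integrable_def)

lemma ae_class_mem: "f \<in> sq_integrable M \<Longrightarrow> f \<in> ae_class M f"
  by (simp add: ae_class_def)

lemma ae_class_cong:
  assumes "AE x in M. f x = g x"
  shows "ae_class M f = ae_class M g"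
proof -
  have "(AE x in M. h x = f x) \<longleftrightarrow> (AE x in M. h x = g x)" for h
    using assms by (intro eventually_cong) (auto elim: eventually_mono)
  then show ?thesis by (simp add: ae_class_def)
qed

lemma ae_class_eq_iff:
  assumes "f \<in> sq_integrable M"
  shows "ae_class M f = ae_class M g \<longleftrightarrow> (AE x in M. f x = g x)"
proof
  assume "ae_class M f = ae_class M g"
  then have "f \<in> ae_class M g" using ae_class_mem[OF assms] by simp
  then show "AE x in M. f x = g x" by (simp add: ae_class_def)
qed (rule ae_class_cong)

lemma l2_rep_ae_class:
  assumes "f \<in> sq_integrable M"
  shows "AE x in M. l2_rep (ae_class M f) x = f x"
proof -
  have "l2_rep (ae_class M f) \<in> ae_class M f"
    unfolding l2_rep_def by (rule someI[where P="\<lambda>h. h \<in> ae_class M f"]) (rule ae_class_mem[OF assms])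
  then show ?thesis by (simp add: ae_class_def)
qed

lemma l2_rep_mem: "u \<in> L2 M \<Longrightarrow> l2_rep u \<in> sq_integrable M"
proof -
  assume "u \<in> L2 M"
  then obtain f where f: "f \<in> u" "u \<subseteq> sq_integrable M"
    by (auto simp: L2_def ae_class_def)
  have "l2_rep u \<in> u"
    unfolding l2_rep_def by (rule someI[where P="\<lambda>h. h \<in> u"]) (rule f(1))
  then show ?thesis using f(2) by blast
qed

lemma ae_class_l2_rep: "u \<in> L2 M \<Longrightarrow> ae_class M (l2_rep u) = u"
  by (auto simp: L2_def intro!: ae_class_cong l2_rep_ae_class)

lemma ae_class_in_L2: "f \<in> sq_integrable M \<Longrightarrow> ae_class M f \<in> L2 M"
  by (simp add: L2_def)

lemma l2_zero_in_L2: "l2_zero M \<in> L2 M"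
  by (simp add: l2_zero_def ae_class_in_L2 zero_sq_integrable)

lemma l2_add_in_L2: "u \<in> L2 M \<Longrightarrow> v \<in> L2 M \<Longrightarrow> l2_add M u v \<in> L2 M"
  by (simp add: l2_add_def ae_class_in_L2 sq_integrable_add l2_rep_mem)

lemma l2_scale_in_L2: "u \<in> L2 M \<Longrightarrow> l2_scale M c u \<in> L2 M"
  by (simp add: l2_scale_def ae_class_in_L2 sq_integrable_scale l2_rep_mem)

lemma l2_rep_add:
  assumes "u \<in> L2 M" "v \<in> L2 M"
  shows "AE x in M. l2_rep (l2_add M u v) x = l2_rep u x + l2_rep v x"
  unfolding l2_add_def using assms by (intro l2_rep_ae_class sq_integrable_add l2_rep_mem)

lemma l2_rep_scale:
  assumes "u \<in> L2 M"
  shows "AE x in M. l2_rep (l2_scale M c u) x = c * l2_rep u x"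
  unfolding l2_scale_def using assms by (intro l2_rep_ae_class sq_integrable_scale l2_rep_mem)

lemma L2_eq_iff:
  assumes "u \<in> L2 M" "v \<in> L2 M"
  shows "u = v \<longleftrightarrow> (AE x in M. l2_rep u x = l2_rep v x)"
proof
  assume "AE x in M. l2_rep u x = l2_rep v x"
  then have "ae_class M (l2_rep u) = ae_class M (l2_rep v)" by (rule ae_class_cong)
  then show "u = v" using assms by (simp add: ae_class_l2_rep)
qed simp

lemma sq_integrable_Minkowski:
  assumes f: "f \<in> sq_integrable M" and g: "g \<in> sq_integrable M"
  shows "sqrt (LINT x|M. (cmod (f x + g x))\<^sup>2) \<le>
           sqrt (LINT x|M. (cmod (f x))\<^sup>2) + sqrt (LINT x|M. (cmod (g x))\<^sup>2)"
proof -
  have [measurable]: "f \<in> borel_measurable M" "g \<in> borel_measurable M"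
    and fi: "integrable M (\<lambda>x. (cmod (f x))\<^sup>2)" and gi: "integrable M (\<lambda>x. (cmod (g x))\<^sup>2)"
    and fgi: "integrable M (\<lambda>x. (cmod (f x + g x))\<^sup>2)"
    using f g sq_integrable_add[OF f g] by (auto simp: sq_integrable_def)
  define a where "a = sqrt (LINT x|M. (cmod (f x))\<^sup>2)"
  define b where "b = sqrt (LINT x|M. (cmod (g x))\<^sup>2)"
  have a2: "a\<^sup>2 = (LINT x|M. (cmod (f x))\<^sup>2)" and b2: "b\<^sup>2 = (LINT x|M. (cmod (g x))\<^sup>2)"
    by (simp_all add: a_def b_def)
  have ab: "a \<ge> 0" "b \<ge> 0" by (simp_all add: a_def b_def)
  consider "a = 0" | "b = 0" | "a > 0" "b > 0" using ab by linarith
  then show ?thesis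
  proof cases
    case 1
    then have "AE x in M. f x = 0"
      using a2 integral_nonneg_eq_0_iff_AE[OF fi] by simp
    then have "(LINT x|M. (cmod (f x + g x))\<^sup>2) = (LINT x|M. (cmod (g x))\<^sup>2)"
      by (intro integral_cong_AE) auto
    then show ?thesis by simp
  next
    case 2
    then have "AE x in M. g x = 0"
      using b2 integral_nonneg_eq_0_iff_AE[OF gi] by simp
    then have "(LINT x|M. (cmod (f x + g x))\<^sup>2) = (LINT x|M. (cmod (f x))\<^sup>2)"
      by (intro integral_cong_AE) auto
    then show ?thesis by simp
  next
    case 3
    have pt: "(cmod (f x + g x))\<^sup>2 \<le> (1 + b / a) * (cmod (f x))\<^sup>2 + (1 + a / b) * (cmod (g x))\<^sup>2" for x
    proof -
      let ?p = "cmod (f x)" and ?q = "cmod (g x)"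
      have "0 \<le> (b * ?p - a * ?q)\<^sup>2 / (a * b)" using 3 by simp
      also have "\<dots> = b / a * ?p\<^sup>2 + a / b * ?q\<^sup>2 - 2 * ?p * ?q"
        using 3 by (simp add: field_simps power2_eq_square)
      finally have "(?p + ?q)\<^sup>2 \<le> (1 + b / a) * ?p\<^sup>2 + (1 + a / b) * ?q\<^sup>2"
        by (simp add: power2_sum algebra_simps)
      moreover have "(cmod (f x + g x))\<^sup>2 \<le> (?p + ?q)\<^sup>2"
        by (simp add: norm_triangle_ineq)
      ultimately show ?thesis by linarith
    qed
    have "(LINT x|M. (cmod (f x + g x))\<^sup>2) \<le>
        (LINT x|M. (1 + b / a) * (cmod (f x))\<^sup>2 + (1 + a / b) * (cmod (g x))\<^sup>2)"
      using fi gi fgi pt by (intro integral_mono) auto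
    also have "\<dots> = (1 + b / a) * a\<^sup>2 + (1 + a / b) * b\<^sup>2"
      using fi gi by (simp add: a2 b2)
    also have "\<dots> = (a + b)\<^sup>2"
      using 3 by (simp add: field_simps power2_eq_square)
    finally show ?thesis
      using ab by (intro real_le_lsqrt) (auto simp: a_def b_def)
  qed
qed

lemma Metric_space_L2: "Metric_space (L2 M) (l2_dist M)"
proof
  fix u v w
  show "0 \<le> l2_dist M u v" by (simp add: l2_dist_def)
  show "l2_dist M u v = l2_dist M v u" by (simp add: l2_dist_def norm_minus_commute)
  show "l2_dist M u v = 0 \<longleftrightarrow> u = v" if "u \<in> L2 M" "v \<in> L2 M"
    using sq_integrable_diff[OF that[THEN l2_rep_mem]] that
    by (simp add: l2_dist_def L2_eq_iff sq_integrable_def integral_nonneg_eq_0_iff_AE)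
  show "l2_dist M u w \<le> l2_dist M u v + l2_dist M v w" if "u \<in> L2 M" "v \<in> L2 M" "w \<in> L2 M"
    using sq_integrable_Minkowski[OF sq_integrable_diff[of "l2_rep u" M "l2_rep v"]
      sq_integrable_diff[of "l2_rep v" M "l2_rep w"]] that
    by (simp add: l2_dist_def l2_rep_mem)
qed

lemma l2_norm_nonneg: "0 \<le> l2_norm M u"
  by (simp add: l2_norm_def)

lemma l2_norm_eq_dist: "u \<in> L2 M \<Longrightarrow> l2_norm M u = l2_dist M u (l2_zero M)"
proof -
  assume u: "u \<in> L2 M"
  have [measurable]: "l2_rep u \<in> borel_measurable M" "l2_rep (l2_zero M) \<in> borel_measurable M"
    using l2_rep_mem[OF u] l2_rep_mem[OF l2_zero_in_L2] by (auto simp: sq_integrable_def)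
  have "AE x in M. l2_rep (l2_zero M) x = 0"
    unfolding l2_zero_def by (rule l2_rep_ae_class[OF zero_sq_integrable])
  then show ?thesis
    unfolding l2_norm_def l2_dist_def
    by (intro arg_cong[where f=sqrt] integral_cong_AE) auto
qed

lemma l2_norm_diff:
  assumes "u \<in> L2 M" "v \<in> L2 M"
  shows "l2_norm M (l2_add M u (l2_scale M (-1) v)) = l2_dist M u v"
proof -
  have [measurable]: "l2_rep u \<in> borel_measurable M" "l2_rep v \<in> borel_measurable M"
    "l2_rep (l2_add M u (l2_scale M (-1) v)) \<in> borel_measurable M"
    using l2_rep_mem[OF assms(1)] l2_rep_mem[OF assms(2)]
      l2_rep_mem[OF l2_add_in_L2[OF assms(1) l2_scale_in_L2[OF assms(2)]]]
    by (auto simp: sq_integrable_def)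
  have "AE x in M. l2_rep (l2_add M u (l2_scale M (-1) v)) x = l2_rep u x - l2_rep v x"
    using l2_rep_add[OF assms(1) l2_scale_in_L2[OF assms(2), of "-1"]] l2_rep_scale[OF assms(2), of "-1"]
    by eventually_elim simp
  then show ?thesis
    unfolding l2_norm_def l2_dist_def
    by (intro arg_cong[where f=sqrt] integral_cong_AE) auto
qed

lemma l2_norm_scale: "u \<in> L2 M \<Longrightarrow> l2_norm M (l2_scale M c u) = cmod c * l2_norm M u"
proof -
  assume u: "u \<in> L2 M"
  have [measurable]: "l2_rep u \<in> borel_measurable M" "l2_rep (l2_scale M c u) \<in> borel_measurable M"
    using l2_rep_mem[OF u] l2_rep_mem[OF l2_scale_in_L2[OF u]] by (auto simp: sq_integrable_def)
  have "(LINT x|M. (cmod (l2_rep (l2_scale M c u) x))\<^sup>2) = (LINT x|M. (cmod c)\<^sup>2 * (cmod (l2_rep u x))\<^sup>2)"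
    using l2_rep_scale[OF u, of c]
    by (intro integral_cong_AE) (auto simp: norm_mult power_mult_distrib)
  then show ?thesis by (simp add: l2_norm_def real_sqrt_mult)
qed

lemma bounded_ops_mem: "T \<in> bounded_ops M \<Longrightarrow> u \<in> L2 M \<Longrightarrow> T u \<in> L2 M"
  by (auto simp: bounded_ops_def)

lemma bounded_ops_ball_bound:
  assumes "T \<in> bounded_ops M"
  obtains C where "\<And>u. u \<in> L2 M \<Longrightarrow> l2_norm M u \<le> 1 \<Longrightarrow> l2_norm M (T u) \<le> C"
proof -
  obtain C where C: "\<And>u. u \<in> L2 M \<Longrightarrow> l2_norm M (T u) \<le> C * l2_norm M u"
    using assms unfolding bounded_ops_def by blast
  show ?thesis
  proof (rule that[of "\<bar>C\<bar>"])
    fix u assume u: "u \<in> L2 M" "l2_norm M u \<le> 1"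
    have "C * l2_norm M u \<le> \<bar>C\<bar> * 1"
      using u l2_norm_nonneg[of M u] by (intro mult_mono) auto
    then show "l2_norm M (T u) \<le> \<bar>C\<bar>" using C[OF u(1)] by simp
  qed
qed

lemma op_dist_altdef:
  assumes "S \<in> bounded_ops M" "T \<in> bounded_ops M"
  shows "op_dist M S T = (SUP u\<in>{u \<in> L2 M. l2_norm M u \<le> 1}. l2_dist M (S u) (T u))"
  unfolding op_dist_def op_norm_def using assms
  by (auto simp: op_add_def op_scale_def bounded_ops_mem l2_norm_diff intro!: SUP_cong)

lemma l2_norm_zero: "l2_norm M (l2_zero M) = 0"
  using Metric_space.mdist_zero[OF Metric_space_L2 l2_zero_in_L2, of M]
  by (simp add: l2_norm_eq_dist l2_zero_in_L2)

lemma bdd_above_op_dist: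
  assumes "S \<in> bounded_ops M" "T \<in> bounded_ops M"
  shows "bdd_above ((\<lambda>u. l2_dist M (S u) (T u)) ` {u \<in> L2 M. l2_norm M u \<le> 1})"
proof -
  interpret Metric_space "L2 M" "l2_dist M" by (rule Metric_space_L2)
  obtain C where C: "\<And>u. u \<in> L2 M \<Longrightarrow> l2_norm M u \<le> 1 \<Longrightarrow> l2_norm M (S u) \<le> C"
    using bounded_ops_ball_bound[OF assms(1)] by blast
  obtain D where D: "\<And>u. u \<in> L2 M \<Longrightarrow> l2_norm M u \<le> 1 \<Longrightarrow> l2_norm M (T u) \<le> D"
    using bounded_ops_ball_bound[OF assms(2)] by blast
  show ?thesis
  proof (rule bdd_aboveI2)
    fix u assume u: "u \<in> {u \<in> L2 M. l2_norm M u \<le> 1}"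
    then have m: "S u \<in> L2 M" "T u \<in> L2 M" using assms by (auto intro: bounded_ops_mem)
    have "l2_dist M (S u) (T u) \<le> l2_dist M (S u) (l2_zero M) + l2_dist M (l2_zero M) (T u)"
      using triangle[OF m(1) l2_zero_in_L2 m(2)] .
    then show "l2_dist M (S u) (T u) \<le> C + D"
      using C[of u] D[of u] u l2_norm_eq_dist[OF m(1)] l2_norm_eq_dist[OF m(2)]
        commute[of "T u" "l2_zero M"] by auto
  qed
qed

lemma bounded_ops_eqI:
  assumes S: "S \<in> bounded_ops M" and T: "T \<in> bounded_ops M"
    and eq: "\<And>u. u \<in> L2 M \<Longrightarrow> l2_norm M u \<le> 1 \<Longrightarrow> S u = T u"
  shows "S = T"
proof (rule extensionalityI[of _ "L2 M"])
  show "S \<in> extensional (L2 M)" "T \<in> extensional (L2 M)"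
    using S T by (auto simp: bounded_ops_def PiE_def)
  fix u assume u: "u \<in> L2 M"
  define c where "c = l2_norm M u + 1"
  have c: "c > 0" using l2_norm_nonneg[of M u] by (simp add: c_def)
  define v where "v = l2_scale M (of_real (1 / c)) u"
  have v: "v \<in> L2 M" by (simp add: v_def u l2_scale_in_L2)
  have "l2_norm M v = l2_norm M u / c"
    using c unfolding v_def l2_norm_scale[OF u] norm_of_real by simp
  then have "l2_norm M v \<le> 1"
    using c by (simp add: c_def)
  then have e: "S v = T v" using eq v by blast
  have uv: "u = l2_scale M (of_real c) v"
  proof (subst L2_eq_iff)
    show "u \<in> L2 M" "l2_scale M (of_real c) v \<in> L2 M" by (simp_all add: u v l2_scale_in_L2)
    show "AE x in M. l2_rep u x = l2_rep (l2_scale M (of_real c) v) x"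
      using l2_rep_scale[OF v, of "of_real c"] l2_rep_scale[OF u, of "of_real (1/c)"]
      unfolding v_def[symmetric] by eventually_elim (use c in simp)
  qed
  have "S u = l2_scale M (of_real c) (S v)" "T u = l2_scale M (of_real c) (T v)"
    using S T v by (subst uv, simp add: bounded_ops_def)+
  then show "S u = T u" using e by simp
qed

lemma Metric_space_bounded_ops: "Metric_space (bounded_ops M) (op_dist M)"
proof -
  interpret H: Metric_space "L2 M" "l2_dist M" by (rule Metric_space_L2)
  let ?B = "{u \<in> L2 M. l2_norm M u \<le> 1}"
  have z: "l2_zero M \<in> ?B" by (simp add: l2_zero_in_L2 l2_norm_zero)
  have le: "l2_dist M (S u) (T u) \<le> op_dist M S T"
    if "S \<in> bounded_ops M" "T \<in> bounded_ops M" "u \<in> ?B" for S T u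
    using cSUP_upper[OF that(3) bdd_above_op_dist[OF that(1,2)]] by (simp add: op_dist_altdef that)
  show ?thesis
  proof
    fix S T R
    show nn: "0 \<le> op_dist M S T"
    proof (cases "S \<in> bounded_ops M \<and> T \<in> bounded_ops M")
      case True
      then show ?thesis using le[of S T "l2_zero M"] z H.nonneg order_trans by blast
    next
      case False
      then show ?thesis unfolding op_dist_def by auto
    qed
    show "op_dist M S T = op_dist M T S"
    proof (cases "S \<in> bounded_ops M \<and> T \<in> bounded_ops M")
      case True
      then show ?thesis by (simp add: op_dist_altdef H.commute)
    next
      case False
      then show ?thesis unfolding op_dist_def by auto
    qed
    show "op_dist M S T = 0 \<longleftrightarrow> S = T" if ST: "S \<in> bounded_ops M" "T \<in> bounded_ops M"
    proof
      assume d: "op_dist M S T = 0"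
      show "S = T"
      proof (rule bounded_ops_eqI[OF ST])
        fix u assume u: "u \<in> L2 M" "l2_norm M u \<le> 1"
        then have "l2_dist M (S u) (T u) = 0"
          using le[OF ST, of u] d H.nonneg[of "S u" "T u"] by simp
        then show "S u = T u" using ST u by (simp add: bounded_ops_mem)
      qed
    next
      assume "S = T"
      moreover have "op_dist M T T = (SUP u\<in>?B. 0)"
        unfolding op_dist_altdef[OF ST(2) ST(2)]
        using ST by (intro SUP_cong) (auto simp: bounded_ops_mem)
      moreover have "(SUP u\<in>?B. 0::real) = 0" using z by (intro cSUP_const) auto
      ultimately show "op_dist M S T = 0" by simp
    qed
    show "op_dist M S R \<le> op_dist M S T + op_dist M T R"
      if m: "S \<in> bounded_ops M" "T \<in> bounded_ops M" "R \<in> bounded_ops M"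
      unfolding op_dist_altdef[OF m(1,3)]
    proof (rule cSUP_least)
      show "?B \<noteq> {}" using z by blast
      fix u assume u: "u \<in> ?B"
      then have "l2_dist M (S u) (R u) \<le> l2_dist M (S u) (T u) + l2_dist M (T u) (R u)"
        using m by (intro H.triangle) (auto simp: bounded_ops_mem)
      then show "l2_dist M (S u) (R u) \<le> op_dist M S T + op_dist M T R"
        using le[OF m(1,2) u] le[OF m(2,3) u] by linarith
    qed
  qed
qed

lemma topspace_weak_star_topology:
  fixes M :: "'a measure"
  shows "topspace (weak_star_topology M) = bounded_ops M"
proof -
  have s: "sq_summable_seq M (\<lambda>_. l2_zero M)"
    by (simp add: sq_summable_seq_def l2_zero_in_L2 l2_norm_zero)
  define \<phi> where "\<phi> = (\<lambda>T::'a l2op. \<Sum>n::nat. l2_inner M (T (l2_zero M)) (l2_zero M))"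
  have "\<phi> \<in> predual_functionals M"
    unfolding predual_functionals_def \<phi>_def
    by (intro CollectI exI[of _ "\<lambda>_. l2_zero M"] conjI refl s)
  then have "bounded_ops M \<in> {{T \<in> bounded_ops M. \<phi> T \<in> G} | \<phi> G. \<phi> \<in> predual_functionals M \<and> open G}"
    by (intro CollectI exI[of _ \<phi>] exI[of _ UNIV]) auto
  then show ?thesis
    unfolding weak_star_topology_def topology_generated_by_topspace by blast
qed

end

theory Submission
  imports Defs
begin

text \<open>Let \<open>T\<close> be compact and in the weak* closure of \<open>U + V\<close>, but not in the norm closure of
  \<open>U \<inter> K + V \<inter> K\<close>. By the Hahn--Banach theorem and the duality between compact and trace class operators,
  a functional \<open>\<omega> = \<Sum>\<^sub>n F\<^sub>n \<otimes> G\<^sub>n\<close> with square summable \<open>F\<close>, \<open>G\<close> annihilates \<open>U \<inter> K\<close> and \<open>V \<inter> K\<close> but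
  not \<open>T\<close>. Cutting down to a set of finite measure on which \<open>\<Sum>\<^sub>n |F\<^sub>n|\<^sup>2\<close> and \<open>\<Sum>\<^sub>n |G\<^sub>n|\<^sup>2\<close> are bounded
  turns \<open>\<omega>\<close> into a bounded Schur multiplier \<open>S\<^sub>\<omega>\<close>, which preserves \<open>K\<close>, \<open>U\<close> and \<open>V\<close>. If \<open>\<omega>\<close> annihilates
  \<open>V\<close>, then \<open>S\<^sub>\<omega>\<close> annihilates \<open>V\<close>, hence maps the weak* closure of \<open>U + V\<close> into \<open>U\<close>. Combined with the
  symmetry \<open>\<omega>'(S\<^sub>\<omega> T) = \<omega>(S\<^sub>\<omega>\<^sub>' T)\<close>, for \<open>\<omega>'\<close> annihilating \<open>U\<close> or \<open>V\<close>, this shows that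
  \<open>S\<^sub>\<omega> T \<in> U \<inter> V \<inter> K = {0}\<close>, and testing with the indicator function of the set yields \<open>\<omega>(T) = 0\<close>.\<close>


section \<open>Square integrable functions\<close>

text \<open>The obstacle is that \<open>\<omega>\<close> annihilates only the compact parts of
  \<open>U\<close> and \<open>V\<close>, so nothing places its Schur product with \<open>T\<close>
  in \<open>U\<close> directly. The symmetry moves the question to a test functional: one that
  annihilates all of \<open>U\<close> has a Schur product with \<open>T\<close> lying in
  \<open>V\<close>, and since Schur multipliers preserve compactness, this product lies in the
  compact part of \<open>V\<close>, where \<open>\<omega>\<close> vanishes. Membership in
  \<open>U\<close> can be tested in this way because a weak* closed subspace is its own double
  annihilator. The truncation costs nothing since the compact parts are themselves bimodules; finite
  measure is what places the indicator function in the Hilbert space. Operators are handled as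
  sesquilinear forms: pointwise sums and plain equality replace calculations with almost everywhere
  classes. The trace duality is obtained by a greedy choice of orthonormal systems in place of a
  polar decomposition.\<close>

locale l2_space = sigma_finite_measure M for M :: "'a measure"
begin

abbreviation H :: "('a \<Rightarrow> complex) set" where "H \<equiv> sq_integrable M"

definition ip :: "('a \<Rightarrow> complex) \<Rightarrow> ('a \<Rightarrow> complex) \<Rightarrow> complex" where
  "ip f g = (LINT x|M. f x * cnj (g x))"

definition nrm :: "('a \<Rightarrow> complex) \<Rightarrow> real" where
  "nrm f = sqrt (LINT x|M. (cmod (f x))\<^sup>2)"

lemmas H_add [simp, intro] = sq_integrable_add[where M=M]
lemmas H_scale [simp, intro] = sq_integrable_scale[where M=M]
lemmas H_diff [simp, intro] = sq_integrable_diff[where M=M]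
lemmas H_zero [simp, intro] = zero_sq_integrable[where M=M]

lemma H_sum [simp, intro]: "(\<And>i. i \<in> I \<Longrightarrow> f i \<in> H) \<Longrightarrow> (\<lambda>x. \<Sum>i\<in>I. f i x) \<in> H"
  by (induction I rule: infinite_finite_induct) auto

lemma H_measurable [measurable_dest]: "f \<in> H \<Longrightarrow> f \<in> borel_measurable M"
  by (simp add: sq_integrable_def)

lemma H_integrable: "f \<in> H \<Longrightarrow> integrable M (\<lambda>x. (cmod (f x))\<^sup>2)"
  by (simp add: sq_integrable_def)

lemma measurable_cnj [measurable (raw)]:
  "f \<in> borel_measurable N \<Longrightarrow> (\<lambda>x. cnj (f x)) \<in> borel_measurable N"
  by (rule borel_measurable_continuous_on[OF continuous_on_cnj[OF continuous_on_id]])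

lemma H_mult_bounded:
  assumes "f \<in> H" and [measurable]: "a \<in> borel_measurable M" and "AE x in M. cmod (a x) \<le> C"
  shows "(\<lambda>x. a x * f x) \<in> H"
proof -
  note [measurable] = H_measurable[OF assms(1)]
  have "integrable M (\<lambda>x. C\<^sup>2 * (cmod (f x))\<^sup>2)"
    using H_integrable[OF assms(1)] by simp
  moreover have "AE x in M. (cmod (a x * f x))\<^sup>2 \<le> C\<^sup>2 * (cmod (f x))\<^sup>2"
    using assms(3) by eventually_elim (auto simp: norm_mult power_mult_distrib intro!: mult_right_mono power_mono)
  ultimately have "integrable M (\<lambda>x. (cmod (a x * f x))\<^sup>2)"
    by (elim Bochner_Integration.integrable_bound) auto
  then show ?thesis by (simp add: sq_integrable_def)
qed

lemma ip_integrable: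
  assumes "f \<in> H" "g \<in> H"
  shows "integrable M (\<lambda>x. f x * cnj (g x))"
proof (rule Bochner_Integration.integrable_bound)
  note [measurable] = H_measurable[OF assms(1)] H_measurable[OF assms(2)]
  show "integrable M (\<lambda>x. (cmod (f x))\<^sup>2 + (cmod (g x))\<^sup>2)"
    using assms by (auto intro: H_integrable)
  show "(\<lambda>x. f x * cnj (g x)) \<in> borel_measurable M" by measurable
  show "AE x in M. norm (f x * cnj (g x)) \<le> norm ((cmod (f x))\<^sup>2 + (cmod (g x))\<^sup>2)"
  proof (intro AE_I2)
    fix x
    have "cmod (f x) * cmod (g x) \<ge> 0" by simp
    moreover have "2 * cmod (f x) * cmod (g x) \<le> (cmod (f x))\<^sup>2 + (cmod (g x))\<^sup>2"
      by (rule sum_squares_bound)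
    ultimately have "cmod (f x) * cmod (g x) \<le> (cmod (f x))\<^sup>2 + (cmod (g x))\<^sup>2" by argo
    then show "norm (f x * cnj (g x)) \<le> norm ((cmod (f x))\<^sup>2 + (cmod (g x))\<^sup>2)"
      by (simp add: norm_mult)
  qed
qed

lemma ip_add_left: "f \<in> H \<Longrightarrow> g \<in> H \<Longrightarrow> h \<in> H \<Longrightarrow> ip (\<lambda>x. f x + g x) h = ip f h + ip g h"
  unfolding ip_def using ip_integrable[of f h] ip_integrable[of g h] by (simp add: distrib_right)

lemma ip_scale_left: "ip (\<lambda>x. c * f x) h = c * ip f h"
  unfolding ip_def by (simp add: mult.assoc)

lemma ip_cnj: "ip g f = cnj (ip f g)"
proof -
  have "cnj (ip f g) = (LINT x|M. cnj (f x * cnj (g x)))"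
    unfolding ip_def by (simp only: Bochner_Integration.integral_cnj)
  then show ?thesis unfolding ip_def by (simp add: mult.commute)
qed

lemma ip_diff_left: "f \<in> H \<Longrightarrow> g \<in> H \<Longrightarrow> h \<in> H \<Longrightarrow> ip (\<lambda>x. f x - g x) h = ip f h - ip g h"
  using ip_add_left[of f "\<lambda>x. (-1) * g x" h] ip_scale_left[of "-1" g h] H_scale[of g "-1"] by simp

lemma ip_add_right: "f \<in> H \<Longrightarrow> g \<in> H \<Longrightarrow> h \<in> H \<Longrightarrow> ip h (\<lambda>x. f x + g x) = ip h f + ip h g"
  using ip_add_left[of f g h] by (metis ip_cnj complex_cnj_add)

lemma ip_scale_right: "ip h (\<lambda>x. c * f x) = cnj c * ip h f"
  by (metis ip_cnj ip_scale_left complex_cnj_mult)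

lemma ip_diff_right: "f \<in> H \<Longrightarrow> g \<in> H \<Longrightarrow> h \<in> H \<Longrightarrow> ip h (\<lambda>x. f x - g x) = ip h f - ip h g"
  using ip_diff_left[of f g h] by (metis ip_cnj complex_cnj_diff)

lemma ip_zero [simp]: "ip (\<lambda>x. 0) f = 0" "ip f (\<lambda>x. 0) = 0"
  by (simp_all add: ip_def)

lemma ip_sum_left:
  "(\<And>i. i \<in> I \<Longrightarrow> f i \<in> H) \<Longrightarrow> h \<in> H \<Longrightarrow> ip (\<lambda>x. \<Sum>i\<in>I. f i x) h = (\<Sum>i\<in>I. ip (f i) h)"
  by (induction I rule: infinite_finite_induct) (auto simp: ip_add_left)

lemma nrm_nonneg [simp]: "0 \<le> nrm f"
  by (simp add: nrm_def)

lemma nrm_power2: "(nrm f)\<^sup>2 = (LINT x|M. (cmod (f x))\<^sup>2)"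
  by (simp add: nrm_def)

lemma ip_self: "ip f f = complex_of_real ((nrm f)\<^sup>2)"
proof -
  have "ip f f = (LINT x|M. complex_of_real ((cmod (f x))\<^sup>2))"
    unfolding ip_def by (simp add: complex_norm_square del: of_real_power)
  then show ?thesis by (simp add: nrm_power2 del: of_real_power)
qed

lemma nrm_zero [simp]: "nrm (\<lambda>x. 0) = 0"
  by (simp add: nrm_def)

lemma nrm_scale: "nrm (\<lambda>x. c * f x) = cmod c * nrm f"
  by (simp add: nrm_def norm_mult power_mult_distrib real_sqrt_mult)

lemma nrm_triangle: "f \<in> H \<Longrightarrow> g \<in> H \<Longrightarrow> nrm (\<lambda>x. f x + g x) \<le> nrm f + nrm g"
  unfolding nrm_def by (rule sq_integrable_Minkowski)

lemma nrm_diff_commute: "nrm (\<lambda>x. f x - g x) = nrm (\<lambda>x. g x - f x)"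
  by (simp add: nrm_def norm_minus_commute)

lemma nrm_cong_AE:
  "f \<in> borel_measurable M \<Longrightarrow> g \<in> borel_measurable M \<Longrightarrow> AE x in M. f x = g x \<Longrightarrow> nrm f = nrm g"
  unfolding nrm_def by (intro arg_cong[where f=sqrt] integral_cong_AE) auto

lemma ip_cong_AE:
  assumes "f \<in> H" "f' \<in> H" "g \<in> H" "g' \<in> H" "AE x in M. f x = f' x" "AE x in M. g x = g' x"
  shows "ip f g = ip f' g'"
  unfolding ip_def
proof (rule integral_cong_AE)
  note [measurable] = assms(1-4)[THEN H_measurable]
  show "(\<lambda>x. f x * cnj (g x)) \<in> borel_measurable M" "(\<lambda>x. f' x * cnj (g' x)) \<in> borel_measurable M"
    by measurable
  show "AE x in M. f x * cnj (g x) = f' x * cnj (g' x)"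
    using assms(5,6) by eventually_elim simp
qed

lemma nrm_eq_0_iff: "f \<in> H \<Longrightarrow> nrm f = 0 \<longleftrightarrow> (AE x in M. f x = 0)"
  by (simp add: nrm_def integral_nonneg_eq_0_iff_AE H_integrable)

lemma nrm_diff_sq:
  assumes "f \<in> H" "g \<in> H"
  shows "(nrm (\<lambda>x. f x - g x))\<^sup>2 = (nrm f)\<^sup>2 - 2 * Re (ip f g) + (nrm g)\<^sup>2"
proof -
  have "complex_of_real ((nrm (\<lambda>x. f x - g x))\<^sup>2) = ip f f - ip f g - (ip g f - ip g g)"
    unfolding ip_self[symmetric] using assms by (simp add: ip_diff_left ip_diff_right)
  then have "(nrm (\<lambda>x. f x - g x))\<^sup>2 = Re (ip f f - ip f g - (ip g f - ip g g))"
    by (metis Re_complex_of_real)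
  then show ?thesis using ip_cnj[of g f] by (simp add: ip_self del: of_real_power)
qed

lemma nrm_add_sq:
  assumes "f \<in> H" "g \<in> H"
  shows "(nrm (\<lambda>x. f x + g x))\<^sup>2 = (nrm f)\<^sup>2 + 2 * Re (ip f g) + (nrm g)\<^sup>2"
  using nrm_diff_sq[of f "\<lambda>x. (-1) * g x"] nrm_scale[of "-1" g] ip_scale_right[of f "-1" g] assms H_scale[of g "-1"]
  by simp

lemma Cauchy_Schwarz:
  assumes "f \<in> H" "g \<in> H"
  shows "cmod (ip f g) \<le> nrm f * nrm g"
proof (cases "nrm g = 0")
  case True
  then have "AE x in M. g x = 0" using nrm_eq_0_iff assms by simp
  then have "ip f g = ip f (\<lambda>x. 0)" using assms by (intro ip_cong_AE) auto
  then show ?thesis by simp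
next
  case False
  then have g: "nrm g > 0" using nrm_nonneg[of g] by linarith
  \<comment> \<open>With this coefficient \<open>c * g\<close> is the orthogonal projection of
    \<open>f\<close> onto the line spanned by \<open>g\<close>, so expanding the squared distance
    yields the inequality.\<close>
  define c where "c = ip f g / complex_of_real ((nrm g)\<^sup>2)"
  have "0 \<le> (nrm (\<lambda>x. f x - c * g x))\<^sup>2" by simp
  also have "\<dots> = (nrm f)\<^sup>2 - 2 * Re (cnj c * ip f g) + (cmod c * nrm g)\<^sup>2"
    using nrm_diff_sq[of f "\<lambda>x. c * g x"] assms by (simp add: ip_scale_right nrm_scale)
  also have "cnj c * ip f g = complex_of_real ((cmod (ip f g))\<^sup>2 / (nrm g)\<^sup>2)"
    by (simp add: c_def complex_norm_square[symmetric] mult.commute del: of_real_power)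
  also have "cmod c = cmod (ip f g) / (nrm g)\<^sup>2" by (simp add: c_def norm_divide norm_power)
  finally have "0 \<le> (nrm f)\<^sup>2 - 2 * ((cmod (ip f g))\<^sup>2 / (nrm g)\<^sup>2) + (cmod (ip f g) / (nrm g)\<^sup>2 * nrm g)\<^sup>2"
    by (simp del: of_real_power of_real_divide)
  also have "(cmod (ip f g) / (nrm g)\<^sup>2 * nrm g)\<^sup>2 = (cmod (ip f g))\<^sup>2 / (nrm g)\<^sup>2"
    using g by (simp add: field_simps power2_eq_square)
  finally have "(cmod (ip f g))\<^sup>2 \<le> (nrm f * nrm g)\<^sup>2"
    using g by (simp add: field_simps power_mult_distrib)
  then show ?thesis by (rule power2_le_imp_le) simp
qed

text \<open>Riesz-Fischer. A subsequence with geometrically small increments converges almost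
  everywhere, and Fatou's lemma turns the pointwise limit into a limit in norm.\<close>

lemma L2_Cauchy_converges:
  assumes f: "\<And>n. f n \<in> H"
    and C: "\<And>e. e > 0 \<Longrightarrow> \<exists>N. \<forall>m\<ge>N. \<forall>n\<ge>N. nrm (\<lambda>x. f m x - f n x) \<le> e"
  obtains g where "g \<in> H" "(\<lambda>n. nrm (\<lambda>x. f n x - g x)) \<longlonglongrightarrow> 0"
proof -
  note [measurable] = H_measurable[OF f]
  have "\<exists>N. \<forall>k. (\<forall>m\<ge>N k. \<forall>n\<ge>N k. nrm (\<lambda>x. f m x - f n x) \<le> (1/4) ^ k)"
    using C by (intro choice) simp
  then obtain N where N: "\<And>k m n. m \<ge> N k \<Longrightarrow> n \<ge> N k \<Longrightarrow> nrm (\<lambda>x. f m x - f n x) \<le> (1/4) ^ k"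
    by blast
  \<comment> \<open>The summand \<open>k\<close> drives the indices to infinity; the partial sums of
    \<open>N\<close> make them monotone and keep \<open>r k\<close> beyond
    \<open>N k\<close>.\<close>
  define r where "r k = k + (\<Sum>j\<le>k. N j)" for k
  have rN: "N k \<le> r k" for k
    unfolding r_def by (rule order_trans[OF member_le_sum[of k "{..k}" N]]) auto
  have rS: "r k \<le> r (Suc k)" for k by (simp add: r_def)
  have rk: "k \<le> r k" for k by (simp add: r_def)
  define u where "u k x = f (r (Suc k)) x - f (r k) x" for k x
  have u: "u k \<in> H" for k unfolding u_def using f by auto
  note [measurable] = H_measurable[OF u]
  have un: "nrm (u k) \<le> (1/4) ^ k" for k
    unfolding u_def using N[of k "r (Suc k)" "r k"] rN[of k] rS[of k] by simp
  \<comment> \<open>The weight \<open>4 ^ k\<close> is affordable since the squared norms decay like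
    \<open>(1/16) ^ k\<close>; it later forces pointwise geometric decay of the increments.\<close>
  have int: "(\<integral>\<^sup>+x. ennreal (4 ^ k * (cmod (u k x))\<^sup>2) \<partial>M) \<le> ennreal ((1/4) ^ k)" for k
  proof -
    have "(\<integral>\<^sup>+x. ennreal (4 ^ k * (cmod (u k x))\<^sup>2) \<partial>M) = ennreal (4 ^ k * (nrm (u k))\<^sup>2)"
      using H_integrable[OF u[of k]] by (subst nn_integral_eq_integral) (auto simp: nrm_power2)
    also have "\<dots> \<le> ennreal (4 ^ k * ((1/4) ^ k)\<^sup>2)"
      using un[of k] by (intro ennreal_leI mult_left_mono power_mono) auto
    also have "4 ^ k * ((1/4::real) ^ k)\<^sup>2 = (1/4) ^ k"
      by (simp add: power2_eq_square field_simps)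
    finally show ?thesis .
  qed
  have "(\<integral>\<^sup>+x. (\<Sum>k. ennreal (4 ^ k * (cmod (u k x))\<^sup>2)) \<partial>M) =
      (\<Sum>k. (\<integral>\<^sup>+x. ennreal (4 ^ k * (cmod (u k x))\<^sup>2) \<partial>M))"
    by (rule nn_integral_suminf) auto
  also have "\<dots> \<le> (\<Sum>k. ennreal ((1/4) ^ k))"
    by (intro suminf_le int) auto
  also have "\<dots> = ennreal (\<Sum>k. (1/4) ^ k)"
    by (intro suminf_ennreal2) (auto intro: summable_geometric)
  finally have "(\<integral>\<^sup>+x. (\<Sum>k. ennreal (4 ^ k * (cmod (u k x))\<^sup>2)) \<partial>M) \<noteq> \<infinity>"
    by (auto simp: top_unique)
  then have "AE x in M. (\<Sum>k. ennreal (4 ^ k * (cmod (u k x))\<^sup>2)) \<noteq> \<infinity>"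
    by (intro nn_integral_PInf_AE) auto
  then have conv: "AE x in M. convergent (\<lambda>k. f (r k) x)"
  proof eventually_elim
    case (elim x)
    have "summable (\<lambda>k. 4 ^ k * (cmod (u k x))\<^sup>2)"
      using elim by (intro summable_suminf_not_top) auto
    then have "bounded (range (\<lambda>k. 4 ^ k * (cmod (u k x))\<^sup>2))"
      using summable_LIMSEQ_zero convergent_imp_bounded by blast
    then obtain S where S: "\<And>k. norm (4 ^ k * (cmod (u k x))\<^sup>2) \<le> S" "S > 0"
      by (auto simp: bounded_pos)
    have le: "cmod (u k x) \<le> sqrt S * (1/2) ^ k" for k
    proof (rule power2_le_imp_le)
      have "(4::real) ^ k = (2 ^ k)\<^sup>2" by (simp add: power2_eq_square flip: power_mult_distrib)
      then show "(cmod (u k x))\<^sup>2 \<le> (sqrt S * (1/2) ^ k)\<^sup>2"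
        using S(1)[of k] S(2) by (simp add: power_mult_distrib field_simps power_divide power2_eq_square)
      show "0 \<le> sqrt S * (1/2) ^ k" using S(2) by simp
    qed
    have "summable (\<lambda>k. sqrt S * (1/2) ^ k)" by (intro summable_mult summable_geometric) simp
    then have "summable (\<lambda>k. u k x)" by (rule summable_comparison_test'[where N=0]) (rule le)
    then have "convergent (\<lambda>n. \<Sum>k<n. u k x)" by (simp add: summable_iff_convergent)
    moreover have "(\<Sum>k<n. u k x) = f (r n) x - f (r 0) x" for n
      unfolding u_def by (rule sum_lessThan_telescope)
    ultimately have "convergent (\<lambda>n. f (r n) x - f (r 0) x)" by simp
    then show ?case by (subst (asm) convergent_diff_const_right_iff)
  qed
  define g where "g x = lim (\<lambda>k. f (r k) x)" for x
  have [measurable]: "g \<in> borel_measurable M" unfolding g_def by measurable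
  have lim: "AE x in M. (\<lambda>k. f (r k) x) \<longlonglongrightarrow> g x"
    using conv by eventually_elim (simp add: g_def convergent_LIMSEQ_iff)
  \<comment> \<open>Fatou along the subsequence: \<open>f n\<close> stays fixed while the second
    index runs to infinity.\<close>
  have key: "(\<integral>\<^sup>+x. ennreal ((cmod (f n x - g x))\<^sup>2) \<partial>M) \<le> ennreal (e\<^sup>2)"
    if e: "e > 0" "\<And>m. m \<ge> K \<Longrightarrow> nrm (\<lambda>x. f n x - f m x) \<le> e" for n e K
  proof -
    have "(\<integral>\<^sup>+x. ennreal ((cmod (f n x - g x))\<^sup>2) \<partial>M) =
        (\<integral>\<^sup>+x. liminf (\<lambda>k. ennreal ((cmod (f n x - f (r k) x))\<^sup>2)) \<partial>M)"
    proof (rule nn_integral_cong_AE, use lim in eventually_elim)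
      case (elim x)
      then have "(\<lambda>k. ennreal ((cmod (f n x - f (r k) x))\<^sup>2)) \<longlonglongrightarrow> ennreal ((cmod (f n x - g x))\<^sup>2)"
        by (intro tendsto_intros)
      then show ?case by (rule lim_imp_Liminf[OF trivial_limit_sequentially, symmetric])
    qed
    also have "\<dots> \<le> liminf (\<lambda>k. \<integral>\<^sup>+x. ennreal ((cmod (f n x - f (r k) x))\<^sup>2) \<partial>M)"
      by (rule nn_integral_liminf) measurable
    also have "\<dots> \<le> liminf (\<lambda>k::nat. ennreal (e\<^sup>2))"
    proof (rule Liminf_mono, rule eventually_sequentiallyI[of K])
      fix k assume "K \<le> k"
      then have "nrm (\<lambda>x. f n x - f (r k) x) \<le> e" using e(2)[of "r k"] rk[of k] by simp
      then have "(nrm (\<lambda>x. f n x - f (r k) x))\<^sup>2 \<le> e\<^sup>2" by (intro power_mono) auto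
      moreover have "(\<integral>\<^sup>+x. ennreal ((cmod (f n x - f (r k) x))\<^sup>2) \<partial>M) = ennreal ((nrm (\<lambda>x. f n x - f (r k) x))\<^sup>2)"
        unfolding nrm_power2 using H_integrable[OF H_diff[OF f[of n] f[of "r k"]]]
        by (intro nn_integral_eq_integral) auto
      ultimately show "(\<integral>\<^sup>+x. ennreal ((cmod (f n x - f (r k) x))\<^sup>2) \<partial>M) \<le> ennreal (e\<^sup>2)"
        by (simp add: ennreal_leI)
    qed
    also have "\<dots> = ennreal (e\<^sup>2)" by (simp add: Liminf_const)
    finally show ?thesis .
  qed
  have fg: "(\<lambda>x. f n x - g x) \<in> H"
    if "e > 0" "\<And>m. m \<ge> K \<Longrightarrow> nrm (\<lambda>x. f n x - f m x) \<le> e" for n e K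
  proof -
    have "(\<integral>\<^sup>+x. ennreal ((cmod (f n x - g x))\<^sup>2) \<partial>M) \<le> ennreal (e\<^sup>2)" by (rule key[of e K n]) (use that in auto)
    also have "\<dots> < \<infinity>" by simp
    finally have "integrable M (\<lambda>x. (cmod (f n x - g x))\<^sup>2)"
      by (intro integrableI_bounded) auto
    then show ?thesis by (simp add: sq_integrable_def)
  qed
  obtain N1 where N1: "\<forall>m\<ge>N1. \<forall>n\<ge>N1. nrm (\<lambda>x. f m x - f n x) \<le> 1" using C[of 1] by auto
  have "(\<lambda>x. f N1 x - (f N1 x - g x)) \<in> H" using N1 by (intro H_diff f fg[of 1 N1]) auto
  then have gH: "g \<in> H" by simp
  have "(\<lambda>n. nrm (\<lambda>x. f n x - g x)) \<longlonglongrightarrow> 0"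
  proof (rule LIMSEQ_I)
    fix e :: real assume e: "e > 0"
    then obtain K where K: "\<forall>m\<ge>K. \<forall>n\<ge>K. nrm (\<lambda>x. f m x - f n x) \<le> e/2" using C[of "e/2"] by auto
    have le: "nrm (\<lambda>x. f n x - g x) \<le> e/2" if "n \<ge> K" for n
    proof (rule power2_le_imp_le)
      have "ennreal ((nrm (\<lambda>x. f n x - g x))\<^sup>2) = (\<integral>\<^sup>+x. ennreal ((cmod (f n x - g x))\<^sup>2) \<partial>M)"
        unfolding nrm_power2 using H_integrable[OF H_diff[OF f[of n] gH]]
        by (intro nn_integral_eq_integral[symmetric]) auto
      also have "\<dots> \<le> ennreal ((e/2)\<^sup>2)" using K that e by (intro key[of "e/2" K n]) auto
      finally show "(nrm (\<lambda>x. f n x - g x))\<^sup>2 \<le> (e/2)\<^sup>2" by (simp add: ennreal_le_iff)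
      show "0 \<le> e/2" using e by simp
    qed
    have "norm (nrm (\<lambda>x. f n x - g x) - 0) < e" if "n \<ge> K" for n
      using le[OF that] e nrm_nonneg[of "\<lambda>x. f n x - g x"] by simp
    then show "\<exists>no. \<forall>n\<ge>no. norm (nrm (\<lambda>x. f n x - g x) - 0) < e" by blast
  qed
  then show ?thesis using gH that by blast
qed

text \<open>The representing vector is the minimiser of \<open>J\<close>: if \<open>\<phi>\<close>
  is given by \<open>g\<close>, then \<open>J f\<close> is the squared distance from
  \<open>f\<close> to \<open>g\<close> minus the squared norm of \<open>g\<close>. The norm bound on
  \<open>g\<close> is recorded because the nuclear decomposition relies on it.\<close>

lemma Riesz_representation:
  assumes add: "\<And>f g. f \<in> H \<Longrightarrow> g \<in> H \<Longrightarrow> \<phi> (\<lambda>x. f x + g x) = \<phi> f + \<phi> g"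
    and scale: "\<And>c f. f \<in> H \<Longrightarrow> \<phi> (\<lambda>x. c * f x) = c * \<phi> f"
    and bd: "\<And>f. f \<in> H \<Longrightarrow> cmod (\<phi> f) \<le> C * nrm f" and C: "C \<ge> 0"
  obtains g where "g \<in> H" "\<And>f. f \<in> H \<Longrightarrow> \<phi> f = ip f g" "nrm g \<le> C"
proof -
  define J where "J f = (nrm f)\<^sup>2 - 2 * Re (\<phi> f)" for f
  have Jlow: "- C\<^sup>2 \<le> J f" if "f \<in> H" for f
  proof -
    have "Re (\<phi> f) \<le> C * nrm f" using bd[OF that] complex_Re_le_cmod order_trans by blast
    moreover have "0 \<le> (nrm f - C)\<^sup>2" by simp
    ultimately show ?thesis by (simp add: J_def power2_diff algebra_simps)
  qed
  define m where "m = (INF f\<in>H. J f)"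
  have bb: "bdd_below (J ` H)" using Jlow by (intro bdd_belowI2) auto
  have mJ: "m \<le> J f" if "f \<in> H" for f unfolding m_def using bb that by (rule cINF_lower)
  have "\<exists>f. f \<in> H \<and> J f < m + e" if "e > 0" for e
    using cINF_less_iff[OF _ bb, of "m + e"] that H_zero unfolding m_def by (metis empty_iff less_add_same_cancel1)
  then have "\<exists>f. \<forall>n. f n \<in> H \<and> J (f n) < m + 1 / Suc n"
    by (intro choice) (auto)
  then obtain f where f: "\<And>n. f n \<in> H" and fJ: "\<And>n. J (f n) < m + 1 / Suc n" by blast
  \<comment> \<open>Parallelogram law at the midpoint, where \<open>J\<close> is still at least
    \<open>m\<close>; it makes every minimising sequence Cauchy.\<close>
  have par: "(nrm (\<lambda>x. f' x - g x))\<^sup>2 \<le> 2 * (J f' - m) + 2 * (J g - m)" if "f' \<in> H" "g \<in> H" for f' g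
  proof -
    have "m \<le> J (\<lambda>x. (1/2) * (f' x + g x))" by (intro mJ H_scale H_add that)
    also have "\<dots> = (nrm (\<lambda>x. f' x + g x))\<^sup>2 / 4 - Re (\<phi> f' + \<phi> g)"
      unfolding J_def scale[OF H_add[OF that]] nrm_scale using that by (simp add: add power_mult_distrib power_divide add_divide_distrib)
    finally show ?thesis
      using nrm_add_sq[OF that] nrm_diff_sq[OF that] unfolding J_def plus_complex.sel by argo
  qed
  have cau: "\<exists>N. \<forall>k\<ge>N. \<forall>n\<ge>N. nrm (\<lambda>x. f k x - f n x) \<le> e" if e: "e > 0" for e
  proof -
    obtain N where N: "4 / e\<^sup>2 < real N" using reals_Archimedean2 by blast
    have "nrm (\<lambda>x. f k x - f n x) \<le> e" if "k \<ge> N" "n \<ge> N" for k n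
    proof (rule power2_le_imp_le)
      have N0: "N > 0" using N e by (cases N) (auto simp: divide_less_0_iff)
      have "(nrm (\<lambda>x. f k x - f n x))\<^sup>2 \<le> 2 * (1 / Suc k) + 2 * (1 / Suc n)"
        using par[OF f f, of k n] fJ[of k] fJ[of n] by argo
      also have "\<dots> \<le> 2 * (1 / N) + 2 * (1 / N)"
        using that N0 by (intro add_mono mult_left_mono divide_left_mono) auto
      also have "\<dots> \<le> e\<^sup>2" using N N0 e by (simp add: field_simps)
      finally show "(nrm (\<lambda>x. f k x - f n x))\<^sup>2 \<le> e\<^sup>2" .
    qed (use e in simp)
    then show ?thesis by blast
  qed
  obtain g where g: "g \<in> H" and lim: "(\<lambda>n. nrm (\<lambda>x. f n x - g x)) \<longlonglongrightarrow> 0"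
    by (rule L2_Cauchy_converges[OF f cau])
  have Jg: "J g \<le> m"
  proof -
    have b: "J g \<le> m + 1 / Suc n + 2 * C * nrm (\<lambda>x. f n x - g x) + 2 * nrm g * nrm (\<lambda>x. f n x - g x)" for n
    proof -
      define d where "d = (\<lambda>x. f n x - g x)"
      have d: "d \<in> H" unfolding d_def using f g by auto
      have fn: "f n = (\<lambda>x. g x + d x)" by (auto simp: d_def)
      have "J (f n) = (nrm g)\<^sup>2 + 2 * Re (ip g d) + (nrm d)\<^sup>2 - 2 * Re (\<phi> g) - 2 * Re (\<phi> d)"
        unfolding J_def fn using g d by (simp add: nrm_add_sq add)
      moreover have "\<bar>Re (ip g d)\<bar> \<le> nrm g * nrm d" using Cauchy_Schwarz[OF g d] abs_Re_le_cmod order_trans by blast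
      moreover have "Re (\<phi> d) \<le> C * nrm d" using bd[OF d] complex_Re_le_cmod order_trans by blast
      moreover have "0 \<le> (nrm d)\<^sup>2" by simp
      ultimately show ?thesis using fJ[of n] unfolding J_def d_def[symmetric] by argo
    qed
    have l: "(\<lambda>n. m + 1 / Suc n + 2 * C * nrm (\<lambda>x. f n x - g x) + 2 * nrm g * nrm (\<lambda>x. f n x - g x))
        \<longlonglongrightarrow> m + 0 + 2 * C * 0 + 2 * nrm g * 0"
      by (intro tendsto_intros lim LIMSEQ_Suc[OF lim_1_over_n])
    have "J g \<le> m + 0 + 2 * C * 0 + 2 * nrm g * 0"
      by (rule LIMSEQ_le_const[OF l]) (intro exI allI impI b)
    then show ?thesis by simp
  qed
  have re: "Re (\<phi> h) = Re (ip h g)" if h: "h \<in> H" for h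
  proof -
    define b where "b = Re (ip h g) - Re (\<phi> h)"
    \<comment> \<open>Moving away from the minimiser in direction \<open>h\<close> changes
      \<open>J\<close> by this quadratic in \<open>s\<close>, which never becomes negative; hence
      its linear coefficient vanishes.\<close>
    have q: "0 \<le> 2 * s * b + s\<^sup>2 * (nrm h)\<^sup>2" for s :: real
    proof -
      have "J g \<le> J (\<lambda>x. g x + of_real s * h x)" using Jg mJ[OF H_add[OF g H_scale[OF h]]] by (rule order_trans)
      also have "\<dots> = J g + (2 * s * b + s\<^sup>2 * (nrm h)\<^sup>2)"
      proof -
        have "Re (ip g h) = Re (ip h g)" using ip_cnj[of g h] by simp
        moreover have "(nrm (\<lambda>x. g x + of_real s * h x))\<^sup>2 = (nrm g)\<^sup>2 + 2 * (s * Re (ip g h)) + s\<^sup>2 * (nrm h)\<^sup>2"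
          unfolding nrm_add_sq[OF g H_scale[OF h]] by (simp add: nrm_scale ip_scale_right power_mult_distrib)
        moreover have "Re (\<phi> (\<lambda>x. g x + of_real s * h x)) = Re (\<phi> g) + s * Re (\<phi> h)"
          unfolding add[OF g H_scale[OF h]] scale[OF h] by simp
        ultimately show ?thesis unfolding J_def b_def by (simp add: algebra_simps)
      qed
      finally show ?thesis by simp
    qed
    have "b = 0"
    proof (cases "nrm h = 0")
      case True
      then show ?thesis using q[of 1] q[of "-1"] by simp
    next
      case False
      then have n: "(nrm h)\<^sup>2 > 0" by simp
      have "0 \<le> 2 * (- b / (nrm h)\<^sup>2) * b + (- b / (nrm h)\<^sup>2)\<^sup>2 * (nrm h)\<^sup>2" by (rule q)
      also have "\<dots> = - (b\<^sup>2 / (nrm h)\<^sup>2)" using False by (simp add: field_simps power2_eq_square)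
      finally have "b\<^sup>2 / (nrm h)\<^sup>2 \<le> 0" by simp
      then show ?thesis using n by (simp add: divide_le_0_iff)
    qed
    then show ?thesis by (simp add: b_def)
  qed
  have rep: "\<phi> h = ip h g" if h: "h \<in> H" for h
  proof (rule complex_eqI)
    show "Re (\<phi> h) = Re (ip h g)" by (rule re[OF h])
    \<comment> \<open>Complex linearity recovers the imaginary part at \<open>h\<close> from the
      real part at \<open>\<i> * h\<close>.\<close>
    have "Re (\<phi> (\<lambda>x. \<i> * h x)) = Re (ip (\<lambda>x. \<i> * h x) g)" using h by (intro re) auto
    then show "Im (\<phi> h) = Im (ip h g)" using h by (simp add: scale ip_scale_left)
  qed
  have "nrm g \<le> C"
  proof (cases "nrm g = 0")
    case False
    then have p: "nrm g > 0" using nrm_nonneg[of g] by linarith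
    have "(nrm g)\<^sup>2 = cmod (\<phi> g)" using rep[OF g] by (simp add: ip_self norm_power)
    then have "nrm g * nrm g \<le> C * nrm g" using bd[OF g] by (simp add: power2_eq_square)
    then show ?thesis using p by simp
  qed (use C in simp)
  then show ?thesis using g rep that by blast
qed

end

section \<open>Bounded sesquilinear forms and nuclear functionals\<close>

lemma suminf_eq_infsum:
  fixes f :: "nat \<Rightarrow> complex"
  assumes "(\<lambda>x. norm (f x)) summable_on UNIV"
  shows "suminf f = infsum f UNIV" "summable f"
proof -
  have "f sums infsum f UNIV"
    by (rule has_sum_imp_sums[OF has_sum_infsum[OF Infinite_Sum.abs_summable_summable[OF assms]]])
  then show "suminf f = infsum f UNIV" "summable f" by (auto simp: sums_iff)
qed

text \<open>The interchange of sums gives the symmetry between a functional and a Schur multiplier;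
  the enumeration of pairs turns a functional composed with a Schur multiplier back into a single
  nuclear series.\<close>

lemma double_series:
  fixes a :: "nat \<Rightarrow> nat \<Rightarrow> complex"
  assumes "(\<lambda>p. norm (case p of (k, n) \<Rightarrow> a k n)) summable_on UNIV"
  shows "(\<Sum>k. \<Sum>n. a k n) = (\<Sum>n. \<Sum>k. a k n)"
    and "(\<Sum>j. a (fst (prod_decode j)) (snd (prod_decode j))) = (\<Sum>k. \<Sum>n. a k n)"
proof -
  have sigma: "(\<lambda>p. norm (case p of (k, n) \<Rightarrow> a k n)) summable_on Sigma UNIV (\<lambda>_. UNIV)"
    using assms by simp
  have "bij (\<lambda>p::nat \<times> nat. (snd p, fst p))" by (rule involuntory_imp_bij) simp
  then have swapped: "(\<lambda>p. norm (case p of (n, k) \<Rightarrow> a k n)) summable_on Sigma UNIV (\<lambda>_. UNIV)"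
    using summable_on_reindex_bij_betw[of "\<lambda>p. (snd p, fst p)" UNIV UNIV "\<lambda>p. norm (case p of (k, n) \<Rightarrow> a k n)"] assms
    by (simp add: case_prod_unfold)
  have rows: "(\<lambda>n. norm (a k n)) summable_on UNIV" and rowsum: "(\<lambda>k. norm (\<Sum>\<^sub>\<infinity>n. a k n)) summable_on UNIV" for k
  proof -
    show r: "(\<lambda>n. norm (a k n)) summable_on UNIV" for k
      using sigma unfolding Infinite_Sum.abs_summable_on_Sigma_iff by auto
    have "(\<lambda>k. norm (\<Sum>\<^sub>\<infinity>n. norm (a k n))) summable_on UNIV"
      using sigma unfolding Infinite_Sum.abs_summable_on_Sigma_iff by auto
    then show "(\<lambda>k. norm (\<Sum>\<^sub>\<infinity>n. a k n)) summable_on UNIV"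
      by (rule Infinite_Sum.abs_summable_on_comparison_test) (auto intro!: norm_infsum_bound r order_trans[OF _ abs_ge_self])
  qed
  have cols: "(\<lambda>k. norm (a k n)) summable_on UNIV" and colsum: "(\<lambda>n. norm (\<Sum>\<^sub>\<infinity>k. a k n)) summable_on UNIV" for n
  proof -
    show r: "(\<lambda>k. norm (a k n)) summable_on UNIV" for n
      using swapped unfolding Infinite_Sum.abs_summable_on_Sigma_iff by auto
    have "(\<lambda>n. norm (\<Sum>\<^sub>\<infinity>k. norm (a k n))) summable_on UNIV"
      using swapped unfolding Infinite_Sum.abs_summable_on_Sigma_iff by auto
    then show "(\<lambda>n. norm (\<Sum>\<^sub>\<infinity>k. a k n)) summable_on UNIV"
      by (rule Infinite_Sum.abs_summable_on_comparison_test) (auto intro!: norm_infsum_bound r order_trans[OF _ abs_ge_self])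
  qed
  have 1: "(\<Sum>k. \<Sum>n. a k n) = (\<Sum>\<^sub>\<infinity>k. \<Sum>\<^sub>\<infinity>n. a k n)"
    by (simp add: suminf_eq_infsum(1)[OF rows] suminf_eq_infsum(1)[OF rowsum])
  have 2: "(\<Sum>n. \<Sum>k. a k n) = (\<Sum>\<^sub>\<infinity>n. \<Sum>\<^sub>\<infinity>k. a k n)"
    by (simp add: suminf_eq_infsum(1)[OF cols] suminf_eq_infsum(1)[OF colsum])
  have s: "(\<lambda>(k, n). a k n) summable_on UNIV \<times> UNIV"
    using Infinite_Sum.abs_summable_summable[OF assms] by simp
  show "(\<Sum>k. \<Sum>n. a k n) = (\<Sum>n. \<Sum>k. a k n)"
    unfolding 1 2 by (rule infsum_swap_banach[OF s])
  have "(\<lambda>j. norm (a (fst (prod_decode j)) (snd (prod_decode j)))) summable_on UNIV"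
    using assms summable_on_reindex_bij_betw[OF bij_prod_decode, of "\<lambda>p. norm (case p of (k, n) \<Rightarrow> a k n)"]
    by (simp add: case_prod_unfold)
  then have "(\<Sum>j. a (fst (prod_decode j)) (snd (prod_decode j))) =
      (\<Sum>\<^sub>\<infinity>j. a (fst (prod_decode j)) (snd (prod_decode j)))"
    by (rule suminf_eq_infsum(1))
  also have "\<dots> = (\<Sum>\<^sub>\<infinity>p. case p of (k, n) \<Rightarrow> a k n)"
    using infsum_reindex_bij_betw[OF bij_prod_decode, of "\<lambda>(k, n). a k n"] by (simp add: case_prod_unfold)
  also have "\<dots> = (\<Sum>\<^sub>\<infinity>k. \<Sum>\<^sub>\<infinity>n. a k n)"
    using infsum_Sigma_banach[OF s] by simp
  finally show "(\<Sum>j. a (fst (prod_decode j)) (snd (prod_decode j))) = (\<Sum>k. \<Sum>n. a k n)"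
    by (simp add: 1)
qed

lemma double_summable_bound:
  fixes b :: "nat \<Rightarrow> nat \<Rightarrow> real"
  assumes nonneg: "\<And>k n. 0 \<le> b k n" and bound: "\<And>k N. (\<Sum>n<N. b k n) \<le> B k" and B: "summable B"
  shows "(\<lambda>(k, n). b k n) summable_on UNIV"
proof (rule nonneg_bdd_above_summable_on)
  show "bdd_above (sum (\<lambda>(k, n). b k n) ` {F. F \<subseteq> UNIV \<and> finite F})"
  proof (rule bdd_aboveI2)
    fix F :: "(nat \<times> nat) set" assume "F \<in> {F. F \<subseteq> UNIV \<and> finite F}"
    then have F: "finite F" by simp
    obtain K where K: "\<And>p. p \<in> F \<Longrightarrow> fst p < K" using F finite_nat_set_iff_bounded[of "fst ` F"] by auto
    obtain N where N: "\<And>p. p \<in> F \<Longrightarrow> snd p < N" using F finite_nat_set_iff_bounded[of "snd ` F"] by auto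
    have B0: "0 \<le> B k" for k using bound[where N=0] by simp
    have "sum (\<lambda>(k, n). b k n) F \<le> sum (\<lambda>(k, n). b k n) ({..<K} \<times> {..<N})"
      using K N nonneg by (intro sum_mono2) force+
    also have "\<dots> = (\<Sum>k<K. \<Sum>n<N. b k n)" by (simp add: sum.cartesian_product)
    also have "\<dots> \<le> (\<Sum>k<K. B k)" by (intro sum_mono bound)
    also have "\<dots> \<le> suminf B" using B B0 by (intro sum_le_suminf) auto
    finally show "sum (\<lambda>(k, n). b k n) F \<le> suminf B" .
  qed
qed (use nonneg in auto)

lemma bounded_partial_sums_summable:
  fixes b :: "nat \<Rightarrow> real"
  assumes "\<And>n. 0 \<le> b n" "\<And>N. (\<Sum>n<N. b n) \<le> B"
  shows "summable b" "suminf b \<le> B"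
proof -
  show s: "summable b"
  proof (rule bounded_imp_summable[OF assms(1)])
    show "sum b {..n} \<le> B" for n using assms(2)[of "Suc n"] by (simp add: lessThan_Suc_atMost)
  qed
  show "suminf b \<le> B" using s assms(2) by (rule suminf_le_const)
qed

lemma sums_if_complex:
  fixes f g :: "nat \<Rightarrow> complex"
  assumes "g sums x" "f sums y"
  shows "(\<lambda>n. if even n then f (n div 2) else g ((n - 1) div 2)) sums (x + y)"
proof -
  have "(\<lambda>n. if even n then Re (f (n div 2)) else Re (g ((n - 1) div 2))) sums (Re x + Re y)"
    "(\<lambda>n. if even n then Im (f (n div 2)) else Im (g ((n - 1) div 2))) sums (Im x + Im y)"
    using assms by (auto intro!: sums_if simp: sums_complex_iff)
  then show ?thesis by (simp add: sums_complex_iff if_distrib cong: if_cong)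
qed

context l2_space
begin

section \<open>Algebra of bounded forms\<close>

type_synonym 'b form = "('b \<Rightarrow> complex) \<Rightarrow> ('b \<Rightarrow> complex) \<Rightarrow> complex"

text \<open>Nonnegativity of \<open>C\<close> is built in because the inequality alone does not give
  it when every vector of \<open>H\<close> has norm zero.\<close>

definition form_bound :: "'a form \<Rightarrow> real \<Rightarrow> bool" where
  "form_bound t C \<longleftrightarrow> 0 \<le> C \<and> (\<forall>f\<in>H. \<forall>g\<in>H. cmod (t f g) \<le> C * nrm f * nrm g)"

text \<open>Operators are replaced by their sesquilinear forms. Forms vanish off \<open>L\<^sup>2\<close>, so that equality of
  operators becomes equality of forms in HOL, while sums and multiples become pointwise.\<close>

definition bsf :: "'a form set" where
  "bsf = {t. (\<forall>f\<in>H. \<forall>g\<in>H. \<forall>h\<in>H. t (\<lambda>x. f x + g x) h = t f h + t g h) \<and>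
             (\<forall>c. \<forall>f\<in>H. \<forall>h\<in>H. t (\<lambda>x. c * f x) h = c * t f h) \<and>
             (\<forall>f\<in>H. \<forall>g\<in>H. \<forall>h\<in>H. t h (\<lambda>x. f x + g x) = t h f + t h g) \<and>
             (\<forall>c. \<forall>f\<in>H. \<forall>h\<in>H. t h (\<lambda>x. c * f x) = cnj c * t h f) \<and>
             (\<exists>C. form_bound t C) \<and> (\<forall>f g. f \<notin> H \<or> g \<notin> H \<longrightarrow> t f g = 0)}"

lemma bsfI:
  assumes "\<And>f g h. f \<in> H \<Longrightarrow> g \<in> H \<Longrightarrow> h \<in> H \<Longrightarrow> t (\<lambda>x. f x + g x) h = t f h + t g h"
    and "\<And>c f h. f \<in> H \<Longrightarrow> h \<in> H \<Longrightarrow> t (\<lambda>x. c * f x) h = c * t f h"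
    and "\<And>f g h. f \<in> H \<Longrightarrow> g \<in> H \<Longrightarrow> h \<in> H \<Longrightarrow> t h (\<lambda>x. f x + g x) = t h f + t h g"
    and "\<And>c f h. f \<in> H \<Longrightarrow> h \<in> H \<Longrightarrow> t h (\<lambda>x. c * f x) = cnj c * t h f"
    and "form_bound t C" and "\<And>f g. f \<notin> H \<or> g \<notin> H \<Longrightarrow> t f g = 0"
  shows "t \<in> bsf"
  unfolding bsf_def by (intro CollectI conjI ballI allI impI exI[of _ C] assms)

context
  fixes t assumes t: "t \<in> bsf"
begin

lemma bsf_add_left: "f \<in> H \<Longrightarrow> g \<in> H \<Longrightarrow> h \<in> H \<Longrightarrow> t (\<lambda>x. f x + g x) h = t f h + t g h"
  and bsf_scale_left: "f \<in> H \<Longrightarrow> h \<in> H \<Longrightarrow> t (\<lambda>x. c * f x) h = c * t f h"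
  and bsf_add_right: "f \<in> H \<Longrightarrow> g \<in> H \<Longrightarrow> h \<in> H \<Longrightarrow> t h (\<lambda>x. f x + g x) = t h f + t h g"
  and bsf_scale_right: "f \<in> H \<Longrightarrow> h \<in> H \<Longrightarrow> t h (\<lambda>x. c * f x) = cnj c * t h f"
  and bsf_outside: "f \<notin> H \<or> g \<notin> H \<Longrightarrow> t f g = 0"
  using t unfolding bsf_def by blast+

lemma bsf_boundE: obtains C where "form_bound t C"
  using t unfolding bsf_def by blast

lemma bsf_diff_left: "f \<in> H \<Longrightarrow> g \<in> H \<Longrightarrow> h \<in> H \<Longrightarrow> t (\<lambda>x. f x - g x) h = t f h - t g h"
  using bsf_add_left[of f "\<lambda>x. (-1) * g x" h] bsf_scale_left[of g h "-1"] H_scale[of g "-1"] by simp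

lemma bsf_diff_right: "f \<in> H \<Longrightarrow> g \<in> H \<Longrightarrow> h \<in> H \<Longrightarrow> t h (\<lambda>x. f x - g x) = t h f - t h g"
  using bsf_add_right[of f "\<lambda>x. (-1) * g x" h] bsf_scale_right[of g h "-1"] H_scale[of g "-1"] by simp

end

lemma form_boundD: "form_bound t C \<Longrightarrow> f \<in> H \<Longrightarrow> g \<in> H \<Longrightarrow> cmod (t f g) \<le> C * nrm f * nrm g"
  by (simp add: form_bound_def)

lemma form_bound_nonneg: "form_bound t C \<Longrightarrow> 0 \<le> C"
  by (simp add: form_bound_def)

lemma form_bound_mono: "form_bound t C \<Longrightarrow> C \<le> D \<Longrightarrow> form_bound t D"
  unfolding form_bound_def by (meson mult_right_mono nrm_nonneg order_trans)

lemma form_bound_zero: "form_bound (\<lambda>f g. 0) 0"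
  by (simp add: form_bound_def)

lemma form_bound_add:
  assumes "form_bound s C" "form_bound t D"
  shows "form_bound (\<lambda>f g. s f g + t f g) (C + D)"
  unfolding form_bound_def
proof (intro conjI ballI)
  fix f g assume fg: "f \<in> H" "g \<in> H"
  have "cmod (s f g + t f g) \<le> cmod (s f g) + cmod (t f g)" by (rule norm_triangle_ineq)
  also have "\<dots> \<le> C * nrm f * nrm g + D * nrm f * nrm g"
    using fg assms by (intro add_mono form_boundD)
  finally show "cmod (s f g + t f g) \<le> (C + D) * nrm f * nrm g" by (simp add: algebra_simps)
qed (use assms in \<open>auto simp: form_bound_def\<close>)

lemma form_bound_scale:
  assumes "form_bound t C" shows "form_bound (\<lambda>f g. c * t f g) (cmod c * C)"
  using assms unfolding form_bound_def
  by (auto simp: norm_mult mult.assoc intro!: mult_left_mono)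

lemma form_bound_trans:
  assumes "form_bound (\<lambda>f g. r f g - s f g) C" "form_bound (\<lambda>f g. s f g - t f g) D"
  shows "form_bound (\<lambda>f g. r f g - t f g) (C + D)"
  using form_bound_add[OF assms] by simp

lemma bsf_zero: "(\<lambda>f g. 0) \<in> bsf"
  by (rule bsfI[OF _ _ _ _ form_bound_zero]) auto

lemma bsf_add:
  assumes s: "s \<in> bsf" and t: "t \<in> bsf" shows "(\<lambda>f g. s f g + t f g) \<in> bsf"
proof -
  obtain C where C: "form_bound s C" using s by (rule bsf_boundE)
  obtain D where D: "form_bound t D" using t by (rule bsf_boundE)
  show ?thesis
    by (rule bsfI[OF _ _ _ _ form_bound_add[OF C D]])
      (simp_all add: s t bsf_add_left bsf_scale_left bsf_add_right bsf_scale_right bsf_outside algebra_simps)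
qed

lemma bsf_scale:
  assumes t: "t \<in> bsf" shows "(\<lambda>f g. c * t f g) \<in> bsf"
proof -
  obtain D where D: "form_bound t D" using t by (rule bsf_boundE)
  show ?thesis
    by (rule bsfI[OF _ _ _ _ form_bound_scale[OF D]])
      (simp_all add: t bsf_add_left bsf_scale_left bsf_add_right bsf_scale_right bsf_outside algebra_simps)
qed

lemma bsf_diff:
  assumes s: "s \<in> bsf" and t: "t \<in> bsf" shows "(\<lambda>f g. s f g - t f g) \<in> bsf"
  using bsf_add[OF s bsf_scale[OF t, of "-1"]] by simp

text \<open>Boundedness kills arguments of norm zero, so a form on functions descends to almost
  everywhere classes.\<close>

lemma bsf_cong_AE:
  assumes t: "t \<in> bsf" and H: "f \<in> H" "f' \<in> H" "g \<in> H" "g' \<in> H"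
    and ae: "AE x in M. f x = f' x" "AE x in M. g x = g' x"
  shows "t f g = t f' g'"
proof -
  obtain C where C: "form_bound t C" using t by (rule bsf_boundE)
  have "nrm (\<lambda>x. f x - f' x) = 0" "nrm (\<lambda>x. g x - g' x) = 0"
    using H ae by (subst nrm_eq_0_iff; auto)+
  then have "t (\<lambda>x. f x - f' x) g = 0" "t f' (\<lambda>x. g x - g' x) = 0"
    using form_boundD[OF C H_diff[OF H(1,2)] H(3)] form_boundD[OF C H(2) H_diff[OF H(3,4)]] by auto
  then show ?thesis using H t by (simp add: bsf_diff_left bsf_diff_right)
qed

section \<open>Nuclear functionals, the predual in terms of forms\<close>

definition ssq :: "(nat \<Rightarrow> 'a \<Rightarrow> complex) \<Rightarrow> bool" where
  "ssq F \<longleftrightarrow> (\<forall>n. F n \<in> H) \<and> summable (\<lambda>n. (nrm (F n))\<^sup>2)"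

text \<open>The trace class functional attached to two square summable sequences, with the form
  \<open>t\<close> standing for the operator; these are the functionals that define the weak*
  topology.\<close>

definition psum :: "(nat \<Rightarrow> 'a \<Rightarrow> complex) \<Rightarrow> (nat \<Rightarrow> 'a \<Rightarrow> complex) \<Rightarrow> 'a form \<Rightarrow> complex" where
  "psum F G t = (\<Sum>n. t (F n) (G n))"

lemma ssq_H: "ssq F \<Longrightarrow> F n \<in> H"
  by (simp add: ssq_def)

lemma form_le_squares:
  assumes "form_bound t C" "f \<in> H" "g \<in> H"
  shows "cmod (t f g) \<le> C * ((nrm f)\<^sup>2 + (nrm g)\<^sup>2)"
proof -
  have "nrm f * nrm g \<le> (nrm f)\<^sup>2 + (nrm g)\<^sup>2"
    using sum_squares_bound[of "nrm f" "nrm g"] mult_nonneg_nonneg[OF nrm_nonneg[of f] nrm_nonneg[of g]] by argo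
  then have "C * (nrm f * nrm g) \<le> C * ((nrm f)\<^sup>2 + (nrm g)\<^sup>2)"
    using form_bound_nonneg[OF assms(1)] by (rule mult_left_mono)
  then show ?thesis using form_boundD[OF assms] by (simp add: mult.assoc)
qed

text \<open>The constant adds the two series of squares instead of multiplying their roots;
  continuity with respect to the form bound needs no better value.\<close>

lemma psum_bound:
  assumes "ssq F" "ssq G" "form_bound t C"
  shows "summable (\<lambda>n. cmod (t (F n) (G n)))" "summable (\<lambda>n. t (F n) (G n))"
    and "cmod (psum F G t) \<le> C * (\<Sum>n. (nrm (F n))\<^sup>2 + (nrm (G n))\<^sup>2)"
proof -
  have s: "summable (\<lambda>n. (nrm (F n))\<^sup>2 + (nrm (G n))\<^sup>2)"
    using assms by (auto simp: ssq_def intro: summable_add)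
  have le: "cmod (t (F n) (G n)) \<le> C * ((nrm (F n))\<^sup>2 + (nrm (G n))\<^sup>2)" for n
    using assms by (intro form_le_squares) (auto simp: ssq_def)
  have s': "summable (\<lambda>n. C * ((nrm (F n))\<^sup>2 + (nrm (G n))\<^sup>2))" using s by (rule summable_mult)
  show 1: "summable (\<lambda>n. cmod (t (F n) (G n)))"
    by (rule summable_comparison_test'[OF s', where N=0]) (use le in simp)
  then show "summable (\<lambda>n. t (F n) (G n))" by (rule summable_norm_cancel)
  have "cmod (psum F G t) \<le> (\<Sum>n. cmod (t (F n) (G n)))" unfolding psum_def by (rule summable_norm[OF 1])
  also have "\<dots> \<le> (\<Sum>n. C * ((nrm (F n))\<^sup>2 + (nrm (G n))\<^sup>2))" by (rule suminf_le[OF le 1 s'])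
  finally show "cmod (psum F G t) \<le> C * (\<Sum>n. (nrm (F n))\<^sup>2 + (nrm (G n))\<^sup>2)"
    using s by (simp add: suminf_mult)
qed

lemma psum_summable: "ssq F \<Longrightarrow> ssq G \<Longrightarrow> t \<in> bsf \<Longrightarrow> summable (\<lambda>n. t (F n) (G n))"
  by (metis psum_bound(2) bsf_boundE)

lemma psum_add:
  "ssq F \<Longrightarrow> ssq G \<Longrightarrow> s \<in> bsf \<Longrightarrow> t \<in> bsf \<Longrightarrow> psum F G (\<lambda>f g. s f g + t f g) = psum F G s + psum F G t"
  unfolding psum_def by (simp add: suminf_add psum_summable)

lemma psum_diff:
  "ssq F \<Longrightarrow> ssq G \<Longrightarrow> s \<in> bsf \<Longrightarrow> t \<in> bsf \<Longrightarrow> psum F G (\<lambda>f g. s f g - t f g) = psum F G s - psum F G t"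
  unfolding psum_def by (simp add: suminf_diff psum_summable)

lemma psum_scale: "ssq F \<Longrightarrow> ssq G \<Longrightarrow> t \<in> bsf \<Longrightarrow> psum F G (\<lambda>f g. c * t f g) = c * psum F G t"
  unfolding psum_def by (simp add: suminf_mult psum_summable)

text \<open>Nuclear functionals are closed under addition because two pairs of sequences can be
  merged by alternation: even places carry the primed pair, odd places the other.\<close>

lemma psum_interleave:
  assumes "ssq F" "ssq G" "ssq F'" "ssq G'"
  obtains F2 G2 where "ssq F2" "ssq G2" "\<And>t. t \<in> bsf \<Longrightarrow> psum F2 G2 t = psum F G t + psum F' G' t"
proof -
  define mix where "mix F F' n = (if even n then F' (n div 2) else F ((n - 1) div 2))"
    for F F' :: "nat \<Rightarrow> 'a \<Rightarrow> complex" and n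
  have mix: "ssq (mix F F')" if F: "ssq F" "ssq F'" for F F'
  proof -
    have "(\<lambda>n. if even n then (nrm (F' (n div 2)))\<^sup>2 else (nrm (F ((n - 1) div 2)))\<^sup>2) sums
        ((\<Sum>n. (nrm (F n))\<^sup>2) + (\<Sum>n. (nrm (F' n))\<^sup>2))"
      using F unfolding ssq_def by (intro sums_if) auto
    then have "summable (\<lambda>n. if even n then (nrm (F' (n div 2)))\<^sup>2 else (nrm (F ((n - 1) div 2)))\<^sup>2)"
      by (rule sums_summable)
    also have "(\<lambda>n. if even n then (nrm (F' (n div 2)))\<^sup>2 else (nrm (F ((n - 1) div 2)))\<^sup>2) = (\<lambda>n. (nrm (mix F F' n))\<^sup>2)"
      by (auto simp: mix_def)
    finally show ?thesis using F by (simp add: ssq_def mix_def)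
  qed
  show ?thesis
  proof (rule that[OF mix[OF assms(1,3)] mix[OF assms(2,4)]])
    fix t assume t: "t \<in> bsf"
    have "(\<lambda>n. if even n then t (F' (n div 2)) (G' (n div 2)) else t (F ((n - 1) div 2)) (G ((n - 1) div 2))) sums
        (psum F G t + psum F' G' t)"
      unfolding psum_def using assms t by (intro sums_if_complex summable_sums psum_summable)
    also have "(\<lambda>n. if even n then t (F' (n div 2)) (G' (n div 2)) else t (F ((n - 1) div 2)) (G ((n - 1) div 2))) =
        (\<lambda>n. t (mix F F' n) (mix G G' n))" by (auto simp: mix_def)
    finally show "psum (mix F F') (mix G G') t = psum F G t + psum F' G' t"
      unfolding psum_def[of "mix F F'"] by (simp add: sums_iff)
  qed
qed

text \<open>Boundedness is required at every point and not merely almost everywhere, so pointwise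
  estimates carry no exceptional sets.\<close>

definition BM :: "('a \<Rightarrow> complex) set" where
  "BM = {a \<in> borel_measurable M. \<exists>C. \<forall>x. cmod (a x) \<le> C}"

lemma BM_mult_H: "a \<in> BM \<Longrightarrow> f \<in> H \<Longrightarrow> (\<lambda>x. a x * f x) \<in> H"
  by (auto simp: BM_def intro: H_mult_bounded)

lemma nrm_mult_le:
  assumes "f \<in> H" "a \<in> borel_measurable M" "\<And>x. cmod (a x) \<le> C"
  shows "nrm (\<lambda>x. a x * f x) \<le> C * nrm f"
proof -
  have C: "C \<ge> 0" using assms(3)[of undefined] norm_ge_zero order_trans by blast
  have "nrm (\<lambda>x. a x * f x) \<le> nrm (\<lambda>x. of_real C * f x)" unfolding nrm_def
  proof (intro real_sqrt_le_mono integral_mono H_integrable H_scale assms(1) H_mult_bounded[OF assms(1,2), of C])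
    show "(cmod (a x * f x))\<^sup>2 \<le> (cmod (of_real C * f x))\<^sup>2" for x
      using assms(3)[of x] C by (auto simp: norm_mult intro!: power_mono mult_right_mono)
  qed (use assms(3) in auto)
  then show ?thesis using C by (simp add: nrm_scale)
qed

text \<open>The form of \<open>M\<^sub>b\<^sup>* T M\<^sub>a\<close>, where \<open>t\<close> is the form of \<open>T\<close>.\<close>

definition mlt :: "('a \<Rightarrow> complex) \<Rightarrow> ('a \<Rightarrow> complex) \<Rightarrow> 'a form \<Rightarrow> 'a form" where
  "mlt a b t = (\<lambda>f g. if f \<in> H \<and> g \<in> H then t (\<lambda>x. a x * f x) (\<lambda>x. b x * g x) else 0)"

lemma mlt_bound:
  assumes "a \<in> BM" "b \<in> BM"
  obtains K where "K \<ge> 0" "\<forall>t C. form_bound t C \<longrightarrow> form_bound (mlt a b t) (C * K)"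
proof -
  obtain A where A: "\<And>x. cmod (a x) \<le> A" using assms by (auto simp: BM_def)
  obtain B where B: "\<And>x. cmod (b x) \<le> B" using assms by (auto simp: BM_def)
  have AB: "A \<ge> 0" "B \<ge> 0" using A[of undefined] B[of undefined] norm_ge_zero order_trans by blast+
  show ?thesis
  proof (rule that[of "A * B"], goal_cases)
    case 1
    show ?case using AB by simp
  next
    case 2
    have "form_bound (mlt a b t) (C * (A * B))" if t: "form_bound t C" for t C
      unfolding form_bound_def
    proof (intro conjI ballI)
      fix f g assume fg: "f \<in> H" "g \<in> H"
      have "cmod (mlt a b t f g) \<le> C * nrm (\<lambda>x. a x * f x) * nrm (\<lambda>x. b x * g x)"
        unfolding mlt_def using fg assms by (simp add: form_boundD[OF t] BM_mult_H)
      also have "\<dots> \<le> C * (A * nrm f) * (B * nrm g)"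
        using assms fg A B AB form_bound_nonneg[OF t]
        by (intro mult_mono mult_left_mono nrm_mult_le) (auto simp: BM_def)
      finally show "cmod (mlt a b t f g) \<le> C * (A * B) * nrm f * nrm g" by (simp add: mult_ac)
    qed (use form_bound_nonneg[OF t] AB in simp)
    then show ?case by blast
  qed
qed

lemma mlt_bsf:
  assumes t: "t \<in> bsf" and ab: "a \<in> BM" "b \<in> BM"
  shows "mlt a b t \<in> bsf"
proof -
  obtain C where C: "form_bound t C" using t by (rule bsf_boundE)
  obtain K where "K \<ge> 0" "\<forall>t C. form_bound t C \<longrightarrow> form_bound (mlt a b t) (C * K)" by (rule mlt_bound[OF ab])
  then have K: "form_bound (mlt a b t) (C * K)" using C by blast
  have e: "(\<lambda>x. a x * (f x + g x)) = (\<lambda>x. a x * f x + a x * g x)"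
    "(\<lambda>x. a x * (c * f x)) = (\<lambda>x. c * (a x * f x))" for a f g :: "'a \<Rightarrow> complex" and c
    by (auto simp: algebra_simps)
  note a = BM_mult_H[OF ab(1)] and b = BM_mult_H[OF ab(2)]
  show ?thesis
  proof (rule bsfI[OF _ _ _ _ K])
    fix f g h and c :: complex assume f: "f \<in> H" and h: "h \<in> H"
    show "mlt a b t (\<lambda>x. c * f x) h = c * mlt a b t f h"
      using bsf_scale_left[OF t a[OF f] b[OF h], of c] H_scale[OF f, of c] f h by (simp only: mlt_def e(2) if_True simp_thms)
    show "mlt a b t h (\<lambda>x. c * f x) = cnj c * mlt a b t h f"
      using bsf_scale_right[OF t b[OF f] a[OF h], of c] H_scale[OF f, of c] f h by (simp only: mlt_def e(2) if_True simp_thms)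
    assume g: "g \<in> H"
    show "mlt a b t (\<lambda>x. f x + g x) h = mlt a b t f h + mlt a b t g h"
      using bsf_add_left[OF t a[OF f] a[OF g] b[OF h]] H_add[OF f g] f g h by (simp only: mlt_def e(1) if_True simp_thms)
    show "mlt a b t h (\<lambda>x. f x + g x) = mlt a b t h f + mlt a b t h g"
      using bsf_add_right[OF t b[OF f] b[OF g] a[OF h]] H_add[OF f g] f g h by (simp only: mlt_def e(1) if_True simp_thms)
  qed (auto simp: mlt_def)
qed

section \<open>Compact forms and Schur multipliers\<close>

text \<open>The form of the rank one operator that sends \<open>f\<close> to \<open>ip f p\<close>
  times \<open>q\<close>.\<close>

definition rk :: "('a \<Rightarrow> complex) \<Rightarrow> ('a \<Rightarrow> complex) \<Rightarrow> 'a form" where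
  "rk p q = (\<lambda>f g. if f \<in> H \<and> g \<in> H then ip f p * ip q g else 0)"

lemma rk_bound:
  assumes "p \<in> H" "q \<in> H" shows "form_bound (rk p q) (nrm p * nrm q)"
  unfolding form_bound_def
proof (intro conjI ballI)
  fix f g assume fg: "f \<in> H" "g \<in> H"
  have "cmod (rk p q f g) \<le> (nrm f * nrm p) * (nrm q * nrm g)"
    unfolding rk_def using fg assms by (simp add: norm_mult mult_mono Cauchy_Schwarz)
  then show "cmod (rk p q f g) \<le> nrm p * nrm q * nrm f * nrm g" by (simp add: mult_ac)
qed simp

lemma rk_bsf:
  assumes "p \<in> H" "q \<in> H" shows "rk p q \<in> bsf"
  by (rule bsfI[OF _ _ _ _ rk_bound[OF assms]])
    (simp_all add: rk_def assms ip_add_left ip_scale_left ip_add_right ip_scale_right algebra_simps, auto)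

text \<open>The forms of finite rank, generated so that induction adds one rank one term at a time;
  scalars are absorbed into \<open>q\<close>.\<close>

inductive_set FR :: "'a form set" where
  FR_zero: "(\<lambda>f g. 0) \<in> FR"
| FR_step: "t \<in> FR \<Longrightarrow> p \<in> H \<Longrightarrow> q \<in> H \<Longrightarrow> (\<lambda>f g. rk p q f g + t f g) \<in> FR"

lemma FR_bsf: "t \<in> FR \<Longrightarrow> t \<in> bsf"
  by (induction rule: FR.induct) (auto intro: bsf_zero bsf_add rk_bsf)

lemma FR_rk: "p \<in> H \<Longrightarrow> q \<in> H \<Longrightarrow> rk p q \<in> FR"
  using FR_step[OF FR_zero, of p q] by simp

lemma FR_add: "s \<in> FR \<Longrightarrow> t \<in> FR \<Longrightarrow> (\<lambda>f g. s f g + t f g) \<in> FR"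
proof (induction rule: FR.induct)
  case FR_zero
  then show ?case by simp
next
  case (FR_step s p q)
  then show ?case using FR.FR_step[of "\<lambda>f g. s f g + t f g" p q] by (simp add: add.assoc)
qed

lemma FR_scale: "t \<in> FR \<Longrightarrow> (\<lambda>f g. c * t f g) \<in> FR"
proof (induction rule: FR.induct)
  case FR_zero
  then show ?case using FR.FR_zero by simp
next
  case (FR_step s p q)
  have "rk p (\<lambda>x. c * q x) f g = c * rk p q f g" for f g by (simp add: rk_def ip_scale_left)
  then show ?case using FR.FR_step[OF FR_step.IH FR_step.hyps(2) H_scale[OF FR_step.hyps(3), of c]]
    by (simp add: distrib_left)
qed

lemma FR_sum: "(\<And>n. n < (N::nat) \<Longrightarrow> t n \<in> FR) \<Longrightarrow> (\<lambda>f g. \<Sum>n<N. t n f g) \<in> FR"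
proof (induction N)
  case 0
  then show ?case using FR_zero by simp
next
  case (Suc N)
  then show ?case using FR_add[of "\<lambda>f g. \<Sum>n<N. t n f g" "t N"] by simp
qed

text \<open>The forms of the compact operators.\<close>

definition APX :: "'a form set" where
  "APX = {t \<in> bsf. \<forall>e>0. \<exists>s\<in>FR. form_bound (\<lambda>f g. t f g - s f g) e}"

lemma APX_bsf: "t \<in> APX \<Longrightarrow> t \<in> bsf"
  by (simp add: APX_def)

lemma APX_E:
  assumes "t \<in> APX" "e > 0" obtains s where "s \<in> FR" "form_bound (\<lambda>f g. t f g - s f g) e"
  using assms unfolding APX_def by blast

lemma APX_limit:
  assumes "t \<in> bsf" and ap: "\<And>e. e > 0 \<Longrightarrow> \<exists>s\<in>APX. form_bound (\<lambda>f g. t f g - s f g) e"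
  shows "t \<in> APX"
  unfolding APX_def
proof (intro CollectI conjI allI impI assms(1))
  fix e :: real assume "e > 0"
  then have e: "e / 2 > 0" by simp
  obtain s where s: "s \<in> APX" "form_bound (\<lambda>f g. t f g - s f g) (e/2)" using ap[OF e] by (rule bexE)
  obtain r where r: "r \<in> FR" "form_bound (\<lambda>f g. s f g - r f g) (e/2)" using APX_E[OF s(1) e] .
  have "form_bound (\<lambda>f g. t f g - r f g) (e/2 + e/2)" by (rule form_bound_trans[OF s(2) r(2)])
  then show "\<exists>s\<in>FR. form_bound (\<lambda>f g. t f g - s f g) e" using r(1) by (intro bexI[of _ r]) simp
qed

lemma FR_APX: "t \<in> FR \<Longrightarrow> t \<in> APX"
  unfolding APX_def using form_bound_mono[OF form_bound_zero]
  by (intro CollectI conjI allI impI FR_bsf bexI[of _ t]) auto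

lemma APX_add:
  assumes "s \<in> APX" "t \<in> APX" shows "(\<lambda>f g. s f g + t f g) \<in> APX"
  unfolding APX_def
proof (intro CollectI conjI allI impI)
  show "(\<lambda>f g. s f g + t f g) \<in> bsf" using assms by (intro bsf_add APX_bsf)
  fix e :: real assume "e > 0"
  then have e: "e / 2 > 0" by simp
  obtain s' where s': "s' \<in> FR" "form_bound (\<lambda>f g. s f g - s' f g) (e/2)" by (rule APX_E[OF assms(1) e])
  obtain t' where t': "t' \<in> FR" "form_bound (\<lambda>f g. t f g - t' f g) (e/2)" by (rule APX_E[OF assms(2) e])
  have "form_bound (\<lambda>f g. s f g + t f g - (s' f g + t' f g)) e"
    using form_bound_add[OF s'(2) t'(2)] by (simp add: algebra_simps)
  then show "\<exists>r\<in>FR. form_bound (\<lambda>f g. s f g + t f g - r f g) e"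
    using FR_add[OF s'(1) t'(1)] by (intro bexI[of _ "\<lambda>f g. s' f g + t' f g"])
qed

text \<open>A bounded additive map is determined on compact forms by its effect on rank one forms,
  up to arbitrarily small errors. The same criterion serves scalar multiples, multiplication by
  bounded functions and Schur multiplication.\<close>

lemma APX_preserved:
  assumes bsf: "\<And>t. t \<in> bsf \<Longrightarrow> L t \<in> bsf"
    and add: "\<And>s t. s \<in> bsf \<Longrightarrow> t \<in> bsf \<Longrightarrow> L (\<lambda>f g. s f g + t f g) = (\<lambda>f g. L s f g + L t f g)"
    and bound: "\<And>t C. t \<in> bsf \<Longrightarrow> form_bound t C \<Longrightarrow> form_bound (L t) (C * K)"
    and K: "K \<ge> 0"
    and rank1: "\<And>p q. p \<in> H \<Longrightarrow> q \<in> H \<Longrightarrow> L (rk p q) \<in> APX"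
    and t: "t \<in> APX"
  shows "L t \<in> APX"
proof (rule APX_limit)
  show "L t \<in> bsf" by (intro bsf APX_bsf t)
  have FR: "L s \<in> APX" if "s \<in> FR" for s using that
  proof (induction rule: FR.induct)
    case FR_zero
    \<comment> \<open>The image of the zero form is controlled by the bound with
      \<open>C = 0\<close>.\<close>
    have "form_bound (L (\<lambda>f g. 0)) (0 * K)" by (intro bound bsf_zero form_bound_zero)
    then have "\<exists>s\<in>APX. form_bound (\<lambda>f g. L (\<lambda>f g. 0) f g - s f g) e" if "e > 0" for e
      using that form_bound_mono[of "L (\<lambda>f g. 0)" "0 * K" e] FR_APX[OF FR.FR_zero]
      by (intro bexI[of _ "\<lambda>f g. 0"]) auto
    then show ?case by (rule APX_limit[OF bsf[OF bsf_zero]])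
  next
    case (FR_step s p q)
    show ?case unfolding add[OF rk_bsf[OF FR_step.hyps(2,3)] FR_bsf[OF FR_step.hyps(1)]]
      by (intro APX_add rank1 FR_step)
  qed
  fix e :: real assume e: "e > 0"
  \<comment> \<open>\<open>K + 1\<close> instead of \<open>K\<close> keeps the quotient meaningful
    for \<open>K = 0\<close>.\<close>
  have "e / (K + 1) > 0" using e K by simp
  then obtain s where s: "s \<in> FR" "form_bound (\<lambda>f g. t f g - s f g) (e / (K + 1))" by (rule APX_E[OF t])
  have d: "(\<lambda>f g. t f g - s f g) \<in> bsf" by (intro bsf_diff APX_bsf[OF t] FR_bsf[OF s(1)])
  have "form_bound (L (\<lambda>f g. t f g - s f g)) (e / (K + 1) * K)" by (rule bound[OF d s(2)])
  moreover have "L t = (\<lambda>f g. L (\<lambda>f g. t f g - s f g) f g + L s f g)"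
    using add[OF d FR_bsf[OF s(1)]] by simp
  then have "L (\<lambda>f g. t f g - s f g) = (\<lambda>f g. L t f g - L s f g)" by simp
  moreover have "e / (K + 1) * K \<le> e" using e K by (simp add: field_simps)
  ultimately have "form_bound (\<lambda>f g. L t f g - L s f g) e" by (simp only: form_bound_mono[of _ "e / (K + 1) * K" e])
  then show "\<exists>s\<in>APX. form_bound (\<lambda>f g. L t f g - s f g) e" using FR[OF s(1)] by (intro bexI[of _ "L s"])
qed

lemma APX_scale:
  assumes "t \<in> APX" shows "(\<lambda>f g. c * t f g) \<in> APX"
proof (rule APX_preserved[where L="\<lambda>t f g. c * t f g" and K="cmod c"])
  show "(\<lambda>f g. c * rk p q f g) \<in> APX" if "p \<in> H" "q \<in> H" for p q
    using that by (intro FR_APX FR_scale FR_rk)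
  show "form_bound (\<lambda>f g. c * t f g) (C * cmod c)" if "form_bound t C" for t C
    using form_bound_scale[OF that, of c] by (simp add: mult.commute)
qed (auto simp: bsf_scale distrib_left assms)

lemma ip_mult_left: "ip (\<lambda>x. a x * f x) p = ip f (\<lambda>x. cnj (a x) * p x)"
  by (simp add: ip_def mult_ac)

lemma ip_mult_right: "ip q (\<lambda>x. b x * g x) = ip (\<lambda>x. cnj (b x) * q x) g"
  by (simp add: ip_def mult_ac)

lemma BM_cnj: "a \<in> BM \<Longrightarrow> (\<lambda>x. cnj (a x)) \<in> BM"
  by (auto simp: BM_def)

lemma mlt_APX:
  assumes "t \<in> APX" "a \<in> BM" "b \<in> BM" shows "mlt a b t \<in> APX"
proof -
  obtain K where K: "K \<ge> 0" "\<forall>t C. form_bound t C \<longrightarrow> form_bound (mlt a b t) (C * K)"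
    by (rule mlt_bound[OF assms(2,3)])
  show ?thesis
  proof (rule APX_preserved[where L="mlt a b", OF _ _ _ K(1) _ assms(1)])
    fix p q assume pq: "p \<in> H" "q \<in> H"
    note [simp] = BM_mult_H[OF assms(2)] BM_mult_H[OF assms(3)]
    have "mlt a b (rk p q) = rk (\<lambda>x. cnj (a x) * p x) (\<lambda>x. cnj (b x) * q x)"
      unfolding mlt_def rk_def ip_mult_left[of a] ip_mult_right[of _ b] by (intro ext) simp
    then show "mlt a b (rk p q) \<in> APX"
      using FR_APX[OF FR_rk[OF BM_mult_H[OF BM_cnj[OF assms(2)] pq(1)] BM_mult_H[OF BM_cnj[OF assms(3)] pq(2)]]] by simp
  next
    show "mlt a b t \<in> bsf" if "t \<in> bsf" for t by (rule mlt_bsf[OF that assms(2,3)])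
    show "form_bound (mlt a b t) (C * K)" if "form_bound t C" for t C using K(2) that by blast
    show "mlt a b (\<lambda>f g. s f g + t f g) = (\<lambda>f g. mlt a b s f g + mlt a b t f g)" for s t
      by (intro ext) (simp add: mlt_def)
  qed
qed

text \<open>At every point the sequence of values is bounded in the sequence space l^2 by the root
  of \<open>m\<close>; two such families make a bounded Schur multiplier. The support of finite
  measure puts \<open>indicator A\<close> into \<open>H\<close>, where it acts as a unit for the
  family.\<close>

definition nice :: "real \<Rightarrow> 'a set \<Rightarrow> (nat \<Rightarrow> 'a \<Rightarrow> complex) \<Rightarrow> bool" where
  "nice m A F \<longleftrightarrow> 0 \<le> m \<and> A \<in> sets M \<and> emeasure M A < \<infinity> \<and> (\<forall>n. F n \<in> borel_measurable M) \<and>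
     (\<forall>N x. (\<Sum>n<N. (cmod (F n x))\<^sup>2) \<le> m) \<and> (\<forall>n x. x \<notin> A \<longrightarrow> F n x = 0)"

lemma nice_cmod: assumes "nice m A F" shows "cmod (F n x) \<le> sqrt m"
proof -
  have "(cmod (F n x))\<^sup>2 \<le> (\<Sum>k<Suc n. (cmod (F k x))\<^sup>2)" by (rule member_le_sum) auto
  also have "\<dots> \<le> m" using assms unfolding nice_def by blast
  finally show ?thesis by (rule real_le_rsqrt)
qed

lemma nice_BM: "nice m A F \<Longrightarrow> F n \<in> BM"
  using nice_cmod[of m A F n] unfolding BM_def nice_def by blast

lemma nice_cnj: "nice m A F \<Longrightarrow> nice m A (\<lambda>n x. cnj (F n x))"
  by (simp add: nice_def measurable_cnj)

lemma nice_mult_H: "nice m A F \<Longrightarrow> a \<in> H \<Longrightarrow> (\<lambda>x. F n x * a x) \<in> H"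
  by (rule BM_mult_H[OF nice_BM])

text \<open>The column operator taking \<open>a\<close> to the sequence of products
  \<open>F n * a\<close> has norm at most the root of \<open>m\<close>: integrate the pointwise
  bound.\<close>

lemma nice_mult_bound:
  assumes F: "nice m A F" and a: "a \<in> H"
  shows "(\<Sum>n<N. (nrm (\<lambda>x. F n x * a x))\<^sup>2) \<le> m * (nrm a)\<^sup>2"
proof -
  have i: "integrable M (\<lambda>x. (cmod (F n x * a x))\<^sup>2)" for n
    by (intro H_integrable nice_mult_H[OF F a])
  have "(\<Sum>n<N. (nrm (\<lambda>x. F n x * a x))\<^sup>2) = (LINT x|M. (\<Sum>n<N. (cmod (F n x * a x))\<^sup>2))"
    unfolding nrm_power2 using i by (intro Bochner_Integration.integral_sum[symmetric])
  also have "\<dots> \<le> (LINT x|M. m * (cmod (a x))\<^sup>2)"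
  proof (rule integral_mono)
    show "integrable M (\<lambda>x. \<Sum>n<N. (cmod (F n x * a x))\<^sup>2)" using i by (intro Bochner_Integration.integrable_sum)
    show "integrable M (\<lambda>x. m * (cmod (a x))\<^sup>2)" using H_integrable[OF a] by simp
    fix x
    have "(\<Sum>n<N. (cmod (F n x * a x))\<^sup>2) = (\<Sum>n<N. (cmod (F n x))\<^sup>2) * (cmod (a x))\<^sup>2"
      by (simp add: norm_mult power_mult_distrib sum_distrib_right)
    also have "\<dots> \<le> m * (cmod (a x))\<^sup>2" using F unfolding nice_def by (intro mult_right_mono) auto
    finally show "(\<Sum>n<N. (cmod (F n x * a x))\<^sup>2) \<le> m * (cmod (a x))\<^sup>2" .
  qed
  also have "\<dots> = m * (nrm a)\<^sup>2" by (simp add: nrm_power2)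
  finally show ?thesis .
qed

lemma nice_mult_ssq:
  assumes F: "nice m A F" and a: "a \<in> H" shows "ssq (\<lambda>n x. F n x * a x)"
  unfolding ssq_def
proof (intro conjI allI nice_mult_H[OF F a])
  show "summable (\<lambda>n. (nrm (\<lambda>x. F n x * a x))\<^sup>2)"
    by (rule bounded_partial_sums_summable(1)[OF _ nice_mult_bound[OF F a]]) simp
qed

lemma nice_double_summable:
  assumes F: "nice m A F" and F': "ssq F'"
  shows "(\<lambda>(k, n). (nrm (\<lambda>x. F n x * F' k x))\<^sup>2) summable_on UNIV"
proof (rule double_summable_bound)
  show "(\<Sum>n<N. (nrm (\<lambda>x. F n x * F' k x))\<^sup>2) \<le> m * (nrm (F' k))\<^sup>2" for k N
    by (rule nice_mult_bound[OF F ssq_H[OF F']])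
  show "summable (\<lambda>k. m * (nrm (F' k))\<^sup>2)" using F' by (auto simp: ssq_def intro: summable_mult)
qed simp

lemma indicator_H: "A \<in> sets M \<Longrightarrow> emeasure M A < \<infinity> \<Longrightarrow> (\<lambda>x. indicator A x :: complex) \<in> H"
  unfolding sq_integrable_def
proof (intro CollectI conjI)
  assume A: "A \<in> sets M" "emeasure M A < \<infinity>"
  have "(\<lambda>x. (cmod (indicator A x))\<^sup>2) = (indicator A :: 'a \<Rightarrow> real)" by (auto simp: indicator_def)
  then show "integrable M (\<lambda>x. (cmod (indicator A x))\<^sup>2)" using A by simp
qed simp

lemma nice_indicator: "nice m A F \<Longrightarrow> (\<lambda>n x. F n x * indicator A x) = F"
  by (intro ext) (auto simp: nice_def indicator_def)

text \<open>The family is unchanged by multiplication with \<open>indicator A\<close>, so it is the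
  column operator applied to one vector of \<open>H\<close>.\<close>

lemma nice_ssq: assumes "nice m A F" shows "ssq F"
proof -
  have "(\<lambda>x. indicator A x :: complex) \<in> H" using assms by (intro indicator_H) (auto simp: nice_def)
  from nice_mult_ssq[OF assms this] show ?thesis by (simp add: nice_indicator[OF assms])
qed

text \<open>If \<open>\<Sum>\<^sub>n F\<^sub>n \<otimes> G\<^sub>n\<close> is viewed as a function of two variables, \<open>psum F G\<close> is the functional
  given by this kernel and \<open>schur F G\<close> is Schur multiplication by it.\<close>

definition schur :: "(nat \<Rightarrow> 'a \<Rightarrow> complex) \<Rightarrow> (nat \<Rightarrow> 'a \<Rightarrow> complex) \<Rightarrow> 'a form \<Rightarrow> 'a form" where
  "schur F G t = (\<lambda>f g. if f \<in> H \<and> g \<in> H then psum (\<lambda>n x. F n x * f x) (\<lambda>n x. G n x * g x) t else 0)"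

context
  fixes m A F G assumes F: "nice m A F" and G: "nice m A G"
begin

lemma nice_nonneg: "0 \<le> m"
  using F by (simp add: nice_def)

text \<open>Cauchy-Schwarz for sums pairs the two column operators, each contributing a root of
  \<open>m\<close>; this is the origin of the constant \<open>m\<close> in
  \<open>schur_bound\<close>.\<close>

lemma nice_product_bound:
  assumes "f \<in> H" "g \<in> H"
  shows "(\<Sum>n<N. nrm (\<lambda>x. F n x * f x) * nrm (\<lambda>x. G n x * g x)) \<le> m * nrm f * nrm g"
proof -
  let ?p = "\<lambda>n. nrm (\<lambda>x. F n x * f x)" and ?q = "\<lambda>n. nrm (\<lambda>x. G n x * g x)"
  have "(\<Sum>n<N. ?p n * ?q n) \<le> L2_set ?p {..<N} * L2_set ?q {..<N}"
    using L2_set_mult_ineq[of ?p ?q "{..<N}"] by simp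
  also have "\<dots> \<le> sqrt (m * (nrm f)\<^sup>2) * sqrt (m * (nrm g)\<^sup>2)"
    unfolding L2_set_def
    by (intro mult_mono real_sqrt_le_mono nice_mult_bound[OF F assms(1)] nice_mult_bound[OF G assms(2)])
      (auto intro!: sum_nonneg mult_nonneg_nonneg nice_nonneg)
  also have "\<dots> = m * nrm f * nrm g"
    using nice_nonneg by (simp add: real_sqrt_mult)
  finally show ?thesis .
qed

lemma schur_bound:
  assumes t: "form_bound t C" shows "form_bound (schur F G t) (C * m)"
  unfolding form_bound_def
proof (intro conjI ballI)
  show "0 \<le> C * m" using form_bound_nonneg[OF t] nice_nonneg by simp
  fix f g assume fg: "f \<in> H" "g \<in> H"
  let ?a = "\<lambda>n. cmod (t (\<lambda>x. F n x * f x) (\<lambda>x. G n x * g x))"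
  have le: "(\<Sum>n<N. ?a n) \<le> C * m * nrm f * nrm g" for N
  proof -
    have "(\<Sum>n<N. ?a n) \<le> (\<Sum>n<N. C * (nrm (\<lambda>x. F n x * f x) * nrm (\<lambda>x. G n x * g x)))"
      using form_boundD[OF t nice_mult_H[OF F fg(1)] nice_mult_H[OF G fg(2)]]
      by (intro sum_mono) (simp add: mult.assoc)
    also have "\<dots> \<le> C * (m * nrm f * nrm g)"
      unfolding sum_distrib_left[symmetric]
      by (intro mult_left_mono nice_product_bound fg form_bound_nonneg[OF t])
    finally show ?thesis by (simp add: mult.assoc)
  qed
  have s: "summable ?a" "suminf ?a \<le> C * m * nrm f * nrm g"
    by (rule bounded_partial_sums_summable[OF _ le], simp)+
  have "cmod (schur F G t f g) \<le> suminf ?a"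
    unfolding schur_def psum_def using fg summable_norm[OF s(1)] by simp
  then show "cmod (schur F G t f g) \<le> C * m * nrm f * nrm g" using s(2) by simp
qed

lemma schur_bsf:
  assumes t: "t \<in> bsf" shows "schur F G t \<in> bsf"
proof -
  obtain C where C: "form_bound t C" using t by (rule bsf_boundE)
  have s: "summable (\<lambda>n. t (\<lambda>x. F n x * f x) (\<lambda>x. G n x * g x))" if "f \<in> H" "g \<in> H" for f g
    by (intro psum_summable nice_mult_ssq[OF F] nice_mult_ssq[OF G] that t)
  have e: "(\<lambda>x. F n x * (f x + g x)) = (\<lambda>x. F n x * f x + F n x * g x)"
    "(\<lambda>x. F n x * (c * f x)) = (\<lambda>x. c * (F n x * f x))" for F :: "nat \<Rightarrow> 'a \<Rightarrow> complex" and f g c n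
    by (auto simp: algebra_simps)
  note a = nice_mult_H[OF F] and b = nice_mult_H[OF G]
  show ?thesis
  proof (rule bsfI[OF _ _ _ _ schur_bound[OF C]])
    fix f g h and c :: complex assume f: "f \<in> H" and h: "h \<in> H"
    show "schur F G t (\<lambda>x. c * f x) h = c * schur F G t f h"
      using f h H_scale[OF f, of c]
      by (simp only: schur_def psum_def e(2) if_True simp_thms bsf_scale_left[OF t a[OF f] b[OF h]] suminf_mult[OF s[OF f h]])
    show "schur F G t h (\<lambda>x. c * f x) = cnj c * schur F G t h f"
      using f h H_scale[OF f, of c]
      by (simp only: schur_def psum_def e(2) if_True simp_thms bsf_scale_right[OF t b[OF f] a[OF h]] suminf_mult[OF s[OF h f]])
    assume g: "g \<in> H"
    show "schur F G t (\<lambda>x. f x + g x) h = schur F G t f h + schur F G t g h"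
      using f g h H_add[OF f g]
      by (simp only: schur_def psum_def e(1) if_True simp_thms bsf_add_left[OF t a[OF f] a[OF g] b[OF h]]
        suminf_add[OF s[OF f h] s[OF g h]])
    show "schur F G t h (\<lambda>x. f x + g x) = schur F G t h f + schur F G t h g"
      using f g h H_add[OF f g]
      by (simp only: schur_def psum_def e(1) if_True simp_thms bsf_add_right[OF t b[OF f] b[OF g] a[OF h]]
        suminf_add[OF s[OF h f] s[OF h g]])
  qed (auto simp: schur_def)
qed

lemma schur_add:
  assumes "s \<in> bsf" "t \<in> bsf"
  shows "schur F G (\<lambda>f g. s f g + t f g) = (\<lambda>f g. schur F G s f g + schur F G t f g)"
  by (intro ext) (simp add: schur_def psum_add nice_mult_ssq[OF F] nice_mult_ssq[OF G] assms)

text \<open>A Schur multiplier turns a rank one form into a series of rank one forms with summable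
  norms, so its partial sums converge to it in norm.\<close>

lemma schur_rk_APX:
  assumes "p \<in> H" "q \<in> H" shows "schur F G (rk p q) \<in> APX"
proof (rule APX_limit)
  show "schur F G (rk p q) \<in> bsf" by (intro schur_bsf rk_bsf assms)
  \<comment> \<open>Moving \<open>F n\<close> and \<open>G n\<close> from the arguments of the form
    to \<open>p\<close> and \<open>q\<close> conjugates them.\<close>
  define P where "P n = (\<lambda>x. cnj (F n x) * p x)" for n
  define Q where "Q n = (\<lambda>x. cnj (G n x) * q x)" for n
  have P: "P n \<in> H" for n unfolding P_def by (rule nice_mult_H[OF nice_cnj[OF F] assms(1)])
  have Q: "Q n \<in> H" for n unfolding Q_def by (rule nice_mult_H[OF nice_cnj[OF G] assms(2)])
  define c where "c n = nrm (P n) * nrm (Q n)" for n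
  have "ssq P" unfolding P_def by (rule nice_mult_ssq[OF nice_cnj[OF F] assms(1)])
  moreover have "ssq Q" unfolding Q_def by (rule nice_mult_ssq[OF nice_cnj[OF G] assms(2)])
  ultimately have "summable (\<lambda>n. (nrm (P n))\<^sup>2 + (nrm (Q n))\<^sup>2)" by (auto simp: ssq_def intro: summable_add)
  then have c: "summable c"
  proof (rule summable_comparison_test'[where N=0])
    fix n :: nat
    show "norm (c n) \<le> (nrm (P n))\<^sup>2 + (nrm (Q n))\<^sup>2"
      using sum_squares_bound[of "nrm (P n)" "nrm (Q n)"] mult_nonneg_nonneg[OF nrm_nonneg[of "P n"] nrm_nonneg[of "Q n"]]
      unfolding c_def real_norm_def by (subst abs_of_nonneg) (simp, argo)
  qed
  have c0: "c n \<ge> 0" for n by (simp add: c_def)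
  fix e :: real assume e: "e > 0"
  have "(\<lambda>N. suminf c - (\<Sum>n<N. c n)) \<longlonglongrightarrow> suminf c - suminf c"
    by (intro tendsto_intros summable_LIMSEQ c)
  then have "\<forall>\<^sub>F N in sequentially. suminf c - (\<Sum>n<N. c n) < e"
    using e by (intro order_tendstoD(2)) auto
  then obtain N where N: "suminf c - (\<Sum>n<N. c n) < e" using eventually_happens' sequentially_bot by blast
  define s where "s = (\<lambda>f g. \<Sum>n<N. rk (P n) (Q n) f g)"
  have "form_bound (\<lambda>f g. schur F G (rk p q) f g - s f g) e"
    unfolding form_bound_def
  proof (intro conjI ballI)
    fix f g assume fg: "f \<in> H" "g \<in> H"
    define a where "a n = ip f (P n) * ip (Q n) g" for n
    have an: "cmod (a n) \<le> c n * (nrm f * nrm g)" for n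
      using mult_mono[OF Cauchy_Schwarz[OF fg(1) P[of n]] Cauchy_Schwarz[OF Q[of n] fg(2)]]
      by (simp add: a_def c_def norm_mult mult_ac)
    have cs: "summable (\<lambda>n. c n * (nrm f * nrm g))" using c by (rule summable_mult2)
    have as: "summable (\<lambda>n. cmod (a n))"
      by (rule summable_comparison_test'[OF cs, where N=0]) (use an in simp)
    have "schur F G (rk p q) f g = suminf a"
      unfolding schur_def psum_def a_def P_def Q_def
      using fg by (simp add: rk_def nice_mult_H[OF F] nice_mult_H[OF G] ip_mult_left[of "F n" for n] ip_mult_right[of _ "G n" for n])
    moreover have "s f g = (\<Sum>n<N. a n)" using fg by (simp add: s_def rk_def a_def)
    ultimately have "schur F G (rk p q) f g - s f g = (\<Sum>n. a (n + N))"
      using suminf_minus_initial_segment[OF summable_norm_cancel[OF as], of N] by (simp only:)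
    also have "cmod (\<Sum>n. a (n + N)) \<le> (\<Sum>n. cmod (a (n + N)))"
      using as by (intro summable_norm) (simp add: summable_iff_shift[of "\<lambda>n. cmod (a n)"])
    also have "\<dots> \<le> (\<Sum>n. c (n + N) * (nrm f * nrm g))"
      using as cs by (intro suminf_le an)
        (simp_all only: summable_iff_shift[of "\<lambda>n. cmod (a n)"] summable_iff_shift[of "\<lambda>n. c n * (nrm f * nrm g)"])
    also have "\<dots> = (suminf c - (\<Sum>n<N. c n)) * (nrm f * nrm g)"
      using c suminf_minus_initial_segment[OF c, of N] by (simp add: suminf_mult2[symmetric] summable_iff_shift)
    also have "\<dots> \<le> e * (nrm f * nrm g)" using N by (intro mult_right_mono) auto
    finally show "cmod (schur F G (rk p q) f g - s f g) \<le> e * nrm f * nrm g" by (simp add: mult.assoc)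
  qed (use e in simp)
  moreover have "s \<in> APX" unfolding s_def by (intro FR_APX FR_sum FR_rk P Q)
  ultimately show "\<exists>s\<in>APX. form_bound (\<lambda>f g. schur F G (rk p q) f g - s f g) e" by (intro bexI[of _ s])
qed

lemma schur_APX: assumes "t \<in> APX" shows "schur F G t \<in> APX"
  by (rule APX_preserved[where L="schur F G", OF schur_bsf schur_add schur_bound nice_nonneg schur_rk_APX assms])

context
  fixes F' G' t assumes F': "ssq F'" and G': "ssq G'" and t: "t \<in> bsf"
begin

text \<open>The products of one nice and one square summable family have summable squared norms over
  pairs of indices; this justifies every later rearrangement.\<close>

lemma schur_abs_summable:
  "(\<lambda>p. norm (case p of (k, n) \<Rightarrow> t (\<lambda>x. F n x * F' k x) (\<lambda>x. G n x * G' k x))) summable_on UNIV"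
proof -
  obtain C where C: "form_bound t C" using t by (rule bsf_boundE)
  have "(\<lambda>p. (case p of (k, n) \<Rightarrow> (nrm (\<lambda>x. F n x * F' k x))\<^sup>2) + (case p of (k, n) \<Rightarrow> (nrm (\<lambda>x. G n x * G' k x))\<^sup>2))
      summable_on UNIV"
    by (intro summable_on_add nice_double_summable[OF F F'] nice_double_summable[OF G G'])
  then have "(\<lambda>p. C * ((case p of (k, n) \<Rightarrow> (nrm (\<lambda>x. F n x * F' k x))\<^sup>2) + (case p of (k, n) \<Rightarrow> (nrm (\<lambda>x. G n x * G' k x))\<^sup>2)))
      summable_on UNIV"
    by (rule summable_on_cmult_right)
  then have "(\<lambda>p. norm (C * ((case p of (k, n) \<Rightarrow> (nrm (\<lambda>x. F n x * F' k x))\<^sup>2) + (case p of (k, n) \<Rightarrow> (nrm (\<lambda>x. G n x * G' k x))\<^sup>2))))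
      summable_on UNIV"
    by (rule summable_on_cong[THEN iffD1, rotated]) (use form_bound_nonneg[OF C] in \<open>auto simp: abs_mult\<close>)
  then show ?thesis
  proof (rule Infinite_Sum.abs_summable_on_comparison_test)
    fix p :: "nat \<times> nat"
    obtain k n where p: "p = (k, n)" by (cases p)
    show "norm (case p of (k, n) \<Rightarrow> t (\<lambda>x. F n x * F' k x) (\<lambda>x. G n x * G' k x)) \<le>
      norm (C * ((case p of (k, n) \<Rightarrow> (nrm (\<lambda>x. F n x * F' k x))\<^sup>2) + (case p of (k, n) \<Rightarrow> (nrm (\<lambda>x. G n x * G' k x))\<^sup>2)))"
      unfolding p prod.case real_norm_def
      by (rule order_trans[OF form_le_squares[OF C nice_mult_H[OF F ssq_H[OF F']] nice_mult_H[OF G ssq_H[OF G']]] abs_ge_self])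
  qed
qed

lemma psum_schur: "psum F' G' (schur F G t) = (\<Sum>k. \<Sum>n. t (\<lambda>x. F n x * F' k x) (\<lambda>x. G n x * G' k x))"
  unfolding psum_def schur_def using ssq_H[OF F'] ssq_H[OF G'] by simp

text \<open>Interchanging the sums exhibits Schur multiplication, under a functional, as a series of
  two-sided multiplications by \<open>F n\<close> and \<open>G n\<close>. This is how bimodule
  invariance applies to it.\<close>

lemma psum_schur_swap: "psum F' G' (schur F G t) = (\<Sum>n. psum F' G' (mlt (F n) (G n) t))"
  unfolding psum_schur double_series(1)[OF schur_abs_summable]
  by (simp add: psum_def mlt_def ssq_H[OF F'] ssq_H[OF G'])

end

text \<open>Schur multiplication is weak* continuous: composed with a nuclear functional it gives
  the functional of the product kernel, whose terms are indexed by pairs.\<close>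

lemma psum_schur_as_psum:
  assumes F': "ssq F'" and G': "ssq G'"
  obtains F2 G2 where "ssq F2" "ssq G2" "\<And>t. t \<in> bsf \<Longrightarrow> psum F2 G2 t = psum F' G' (schur F G t)"
proof -
  \<comment> \<open>The code \<open>j\<close> stands for the pair \<open>(k, n)\<close> with
    \<open>k\<close> the index of \<open>F'\<close> and \<open>n\<close> that of \<open>F\<close>,
    in the order of \<open>schur_abs_summable\<close>.\<close>
  define pr where "pr F F' j = (\<lambda>x. F (snd (prod_decode j)) x * F' (fst (prod_decode j)) x)"
    for F F' :: "nat \<Rightarrow> 'a \<Rightarrow> complex" and j
  have pr: "ssq (pr F F')" if F: "nice m A F" and F': "ssq F'" for F F'
    unfolding ssq_def
  proof (intro conjI allI)
    show "pr F F' j \<in> H" for j unfolding pr_def by (rule nice_mult_H[OF F ssq_H[OF F']])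
    have "(\<lambda>j. case prod_decode j of (k, n) \<Rightarrow> (nrm (\<lambda>x. F n x * F' k x))\<^sup>2) summable_on UNIV"
      using nice_double_summable[OF F F']
      by (subst summable_on_reindex_bij_betw[OF bij_prod_decode])
    then show "summable (\<lambda>j. (nrm (pr F F' j))\<^sup>2)"
      by (simp add: pr_def case_prod_unfold summable_on_UNIV_nonneg_real_iff)
  qed
  show ?thesis
  proof (rule that[OF pr[OF F F'] pr[OF G G']])
    fix t assume t: "t \<in> bsf"
    show "psum (pr F F') (pr G G') t = psum F' G' (schur F G t)"
      unfolding psum_schur[OF F' G' t] double_series(2)[OF schur_abs_summable[OF F' G' t], symmetric]
      by (simp add: psum_def pr_def)
  qed
qed

end

section \<open>Schur multipliers and masa-bimodules\<close>

definition kills :: "(nat \<Rightarrow> 'a \<Rightarrow> complex) \<Rightarrow> (nat \<Rightarrow> 'a \<Rightarrow> complex) \<Rightarrow> 'a form set \<Rightarrow> bool" where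
  "kills F G U \<longleftrightarrow> (\<forall>u\<in>U. psum F G u = 0)"

definition form_subspace :: "'a form set \<Rightarrow> bool" where
  "form_subspace U \<longleftrightarrow> U \<subseteq> bsf \<and> (\<lambda>f g. 0) \<in> U \<and> (\<forall>s\<in>U. \<forall>t\<in>U. (\<lambda>f g. s f g + t f g) \<in> U) \<and>
     (\<forall>c. \<forall>t\<in>U. (\<lambda>f g. c * t f g) \<in> U)"

definition form_bimodule :: "'a form set \<Rightarrow> bool" where
  "form_bimodule U \<longleftrightarrow> form_subspace U \<and> (\<forall>t\<in>U. \<forall>a\<in>BM. \<forall>b\<in>BM. mlt a b t \<in> U)"

definition reflexive :: "'a form set \<Rightarrow> bool" where
  "reflexive U \<longleftrightarrow> (\<forall>t\<in>bsf. (\<forall>F G. ssq F \<longrightarrow> ssq G \<longrightarrow> kills F G U \<longrightarrow> psum F G t = 0) \<longrightarrow> t \<in> U)"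

text \<open>Membership in the weak* closure of \<open>U + V\<close>, expressed by annihilators: a
  functional annihilates the sum exactly when it annihilates both summands.\<close>

definition weakly_in_sum :: "'a form \<Rightarrow> 'a form set \<Rightarrow> 'a form set \<Rightarrow> bool" where
  "weakly_in_sum t U V \<longleftrightarrow> t \<in> bsf \<and>
     (\<forall>F G. ssq F \<longrightarrow> ssq G \<longrightarrow> kills F G U \<longrightarrow> kills F G V \<longrightarrow> psum F G t = 0)"

lemma weakly_in_sum_commute: "weakly_in_sum t U V \<Longrightarrow> weakly_in_sum t V U"
  unfolding weakly_in_sum_def by blast

lemma form_bimodule_mlt: "form_bimodule U \<Longrightarrow> t \<in> U \<Longrightarrow> a \<in> BM \<Longrightarrow> b \<in> BM \<Longrightarrow> mlt a b t \<in> U"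
  unfolding form_bimodule_def by blast

lemma form_bimodule_bsf: "form_bimodule U \<Longrightarrow> t \<in> U \<Longrightarrow> t \<in> bsf"
  unfolding form_bimodule_def form_subspace_def by blast

lemma psum_cut:
  assumes "ssq F" "ssq G"
  shows "psum (\<lambda>n x. a x * F n x) (\<lambda>n x. a x * G n x) t = psum F G (mlt a a t)"
  unfolding psum_def mlt_def using assms by (simp add: ssq_H)

section \<open>Truncation of nuclear functionals to bounded kernels\<close>

lemma nrm_indicator_tendsto:
  assumes f: "f \<in> H" and E: "\<And>i. E i \<in> sets M"
    and ev: "AE x in M. \<forall>\<^sub>F i in sequentially. x \<in> E i"
  shows "(\<lambda>i. nrm (\<lambda>x. indicator (E i) x * f x - f x)) \<longlonglongrightarrow> 0"
proof -
  note [measurable] = H_measurable[OF f] E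
  have "(\<lambda>i. LINT x|M. (cmod (indicator (E i) x * f x - f x))\<^sup>2) \<longlonglongrightarrow> (LINT x|M. 0)"
  proof (rule integral_dominated_convergence[where w="\<lambda>x. (cmod (f x))\<^sup>2"])
    show "integrable M (\<lambda>x. (cmod (f x))\<^sup>2)" by (rule H_integrable[OF f])
    show "AE x in M. (\<lambda>i. (cmod (indicator (E i) x * f x - f x))\<^sup>2) \<longlonglongrightarrow> 0"
      using ev
    proof eventually_elim
      case (elim x)
      then have "\<forall>\<^sub>F i in sequentially. (cmod (indicator (E i) x * f x - f x))\<^sup>2 = 0"
        by eventually_elim simp
      then show ?case by (rule tendsto_eventually)
    qed
    show "AE x in M. norm ((cmod (indicator (E i) x * f x - f x))\<^sup>2) \<le> (cmod (f x))\<^sup>2" for i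
      by (intro AE_I2) (simp add: indicator_def)
  qed measurable
  then have "(\<lambda>i. sqrt (LINT x|M. (cmod (indicator (E i) x * f x - f x))\<^sup>2)) \<longlonglongrightarrow> sqrt 0"
    by (intro tendsto_real_sqrt) simp
  then show ?thesis by (simp add: nrm_def)
qed

lemma form_tendsto:
  assumes t: "t \<in> bsf" and H: "f \<in> H" "g \<in> H" "\<And>i. f' i \<in> H" "\<And>i. g' i \<in> H"
    and f: "(\<lambda>i. nrm (\<lambda>x. f' i x - f x)) \<longlonglongrightarrow> 0" and g: "(\<lambda>i. nrm (\<lambda>x. g' i x - g x)) \<longlonglongrightarrow> 0"
  shows "(\<lambda>i::nat. t (f' i) (g' i)) \<longlonglongrightarrow> t f g"
proof -
  obtain C where C: "form_bound t C" using t by (rule bsf_boundE)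
  let ?d = "\<lambda>i. nrm (\<lambda>x. f' i x - f x)" and ?e = "\<lambda>i. nrm (\<lambda>x. g' i x - g x)"
  have le: "cmod (t (f' i) (g' i) - t f g) \<le> C * ?d i * (?e i + nrm g) + C * nrm f * ?e i" for i
  proof -
    have "t (f' i) (g' i) - t f g = t (\<lambda>x. f' i x - f x) (g' i) + t f (\<lambda>x. g' i x - g x)"
      using H t by (simp add: bsf_diff_left bsf_diff_right)
    then have "cmod (t (f' i) (g' i) - t f g) \<le> cmod (t (\<lambda>x. f' i x - f x) (g' i)) + cmod (t f (\<lambda>x. g' i x - g x))"
      by (simp only: norm_triangle_ineq)
    also have "\<dots> \<le> C * ?d i * nrm (g' i) + C * nrm f * ?e i"
      by (intro add_mono form_boundD[OF C] H_diff H)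
    also have "\<dots> \<le> C * ?d i * (?e i + nrm g) + C * nrm f * ?e i"
    proof -
      have "nrm (g' i) \<le> ?e i + nrm g" using nrm_triangle[OF H_diff[OF H(4)[of i] H(2)] H(2)] by simp
      then show ?thesis using form_bound_nonneg[OF C] by (intro add_right_mono mult_left_mono) auto
    qed
    finally show ?thesis .
  qed
  have "(\<lambda>i. C * ?d i * (?e i + nrm g) + C * nrm f * ?e i) \<longlonglongrightarrow> C * 0 * (0 + nrm g) + C * nrm f * 0"
    by (intro tendsto_intros f g)
  then have "(\<lambda>i. C * ?d i * (?e i + nrm g) + C * nrm f * ?e i) \<longlonglongrightarrow> 0" by simp
  then have "(\<lambda>i. t (f' i) (g' i) - t f g) \<longlonglongrightarrow> 0"
    by (rule Lim_null_comparison[rotated]) (intro always_eventually allI le)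
  then show ?thesis by (rule LIM_zero_cancel)
qed

text \<open>Summation and integration commute for nonnegative terms, so the pointwise series of
  squares has a finite integral and is finite almost everywhere.\<close>

lemma ssq_AE_bounded:
  assumes "ssq F"
  shows "AE x in M. \<exists>b. \<forall>N. (\<Sum>n<N. (cmod (F n x))\<^sup>2) \<le> b"
proof -
  note [measurable] = H_measurable[OF ssq_H[OF assms]]
  have "(\<integral>\<^sup>+x. (\<Sum>n. ennreal ((cmod (F n x))\<^sup>2)) \<partial>M) = (\<Sum>n. (\<integral>\<^sup>+x. ennreal ((cmod (F n x))\<^sup>2) \<partial>M))"
    by (rule nn_integral_suminf) auto
  also have "\<dots> = (\<Sum>n. ennreal ((nrm (F n))\<^sup>2))"
    unfolding nrm_power2 using H_integrable[OF ssq_H[OF assms]]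
    by (intro suminf_cong nn_integral_eq_integral) auto
  also have "\<dots> = ennreal (\<Sum>n. (nrm (F n))\<^sup>2)"
    using assms by (intro suminf_ennreal2) (auto simp: ssq_def)
  finally have "(\<integral>\<^sup>+x. (\<Sum>n. ennreal ((cmod (F n x))\<^sup>2)) \<partial>M) \<noteq> \<infinity>" by simp
  then have "AE x in M. (\<Sum>n. ennreal ((cmod (F n x))\<^sup>2)) \<noteq> \<infinity>"
    by (intro nn_integral_PInf_AE) auto
  then show ?thesis
  proof eventually_elim
    case (elim x)
    have "summable (\<lambda>n. (cmod (F n x))\<^sup>2)" using elim by (intro summable_suminf_not_top) auto
    then have "(\<Sum>n<N. (cmod (F n x))\<^sup>2) \<le> (\<Sum>n. (cmod (F n x))\<^sup>2)" for N
      by (intro sum_le_suminf) auto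
    then show ?case by blast
  qed
qed

text \<open>The truncation sets exhaust the space up to a null set and the truncated values converge
  to the full value; as the limit is nonzero, so is some truncated value.\<close>

lemma nice_cut:
  assumes F: "ssq F" and G: "ssq G" and t: "t \<in> bsf" and ne: "psum F G t \<noteq> 0"
  obtains m A a where "a \<in> BM" "nice m A (\<lambda>n x. a x * F n x)" "nice m A (\<lambda>n x. a x * G n x)"
    "psum (\<lambda>n x. a x * F n x) (\<lambda>n x. a x * G n x) t \<noteq> 0"
proof -
  note FH = ssq_H[OF F] and GH = ssq_H[OF G]
  note [measurable] = H_measurable[OF FH] H_measurable[OF GH]
  obtain B :: "nat \<Rightarrow> 'a set" where B: "range B \<subseteq> sets M" "(\<Union>i. B i) = space M"
    "\<And>i. emeasure M (B i) \<noteq> \<infinity>" "incseq B"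
    by (rule sigma_finite_incseq) blast
  have [measurable]: "B i \<in> sets M" for i using B(1) by auto
  \<comment> \<open>One index \<open>i\<close> controls both series of squares and the measure, so
    that both cut sequences are nice for the same constant and set.\<close>
  define E where "E i = {x \<in> space M. x \<in> B i \<and> (\<forall>N. (\<Sum>n<N. (cmod (F n x))\<^sup>2) \<le> real i \<and> (\<Sum>n<N. (cmod (G n x))\<^sup>2) \<le> real i)}" for i
  have E: "E i \<in> sets M" for i unfolding E_def by measurable
  have fin: "emeasure M (E i) < \<infinity>" for i
  proof -
    have "emeasure M (E i) \<le> emeasure M (B i)" by (rule emeasure_mono) (auto simp: E_def)
    also have "\<dots> < \<infinity>" using B(3)[of i] by (simp add: less_top)
    finally show ?thesis .
  qed
  have ev: "AE x in M. \<forall>\<^sub>F i in sequentially. x \<in> E i"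
    using ssq_AE_bounded[OF F] ssq_AE_bounded[OF G] AE_space
  proof eventually_elim
    case (elim x)
    obtain b c where b: "\<And>N. (\<Sum>n<N. (cmod (F n x))\<^sup>2) \<le> b" and c: "\<And>N. (\<Sum>n<N. (cmod (G n x))\<^sup>2) \<le> c"
      using elim(1,2) by blast
    obtain j where j: "x \<in> B j" using elim(3) B(2) by blast
    obtain k where k: "max b c \<le> real k" using real_arch_simple by blast
    show ?case
    proof (rule eventually_sequentiallyI[of "max j k"])
      fix i assume i: "max j k \<le> i"
      have "x \<in> B i" using j i incseqD[OF B(4), of j i] by auto
      moreover have "b \<le> real i" "c \<le> real i" using k i by auto
      ultimately show "x \<in> E i" unfolding E_def using elim(3) b c order_trans by blast
    qed
  qed
  let ?a = "\<lambda>i x. indicator (E i) x :: complex"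
  have BM: "?a i \<in> BM" for i
    unfolding BM_def using E by (intro CollectI conjI exI[of _ 1]) (auto simp: indicator_def)
  have nice: "nice (real i) (E i) (\<lambda>n x. ?a i x * F n x)"
    if F: "\<And>n. F n \<in> borel_measurable M" "\<And>x N. x \<in> E i \<Longrightarrow> (\<Sum>n<N. (cmod (F n x))\<^sup>2) \<le> real i" for F i
    unfolding nice_def
  proof (intro conjI allI impI)
    show "(\<lambda>x. ?a i x * F n x) \<in> borel_measurable M" for n using F(1)[of n] E by measurable
    show "(\<Sum>n<N. (cmod (?a i x * F n x))\<^sup>2) \<le> real i" for N x
      using F(2)[of x N] by (cases "x \<in> E i") auto
  qed (use E fin in auto)
  have FE: "nice (real i) (E i) (\<lambda>n x. ?a i x * F n x)" for i
    by (rule nice[OF H_measurable[OF FH]]) (simp add: E_def)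
  have GE: "nice (real i) (E i) (\<lambda>n x. ?a i x * G n x)" for i
    by (rule nice[OF H_measurable[OF GH]]) (simp add: E_def)
  obtain C where C: "form_bound t C" using t by (rule bsf_boundE)
  let ?s = "\<lambda>n. C * ((nrm (F n))\<^sup>2 + (nrm (G n))\<^sup>2)"
  have "summable ?s" using F G by (auto simp: ssq_def intro!: summable_mult summable_add)
  moreover have "norm (t (\<lambda>x. ?a i x * F n x) (\<lambda>x. ?a i x * G n x)) \<le> ?s n" for i n
  proof -
    have le: "nrm (\<lambda>x. ?a i x * f x) \<le> nrm f" if "f \<in> H" for f
      using nrm_mult_le[OF that, of "?a i" 1] E by (auto simp: indicator_def)
    have "norm (t (\<lambda>x. ?a i x * F n x) (\<lambda>x. ?a i x * G n x)) \<le>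
        C * ((nrm (\<lambda>x. ?a i x * F n x))\<^sup>2 + (nrm (\<lambda>x. ?a i x * G n x))\<^sup>2)"
      by (rule form_le_squares[OF C BM_mult_H[OF BM FH] BM_mult_H[OF BM GH]])
    also have "\<dots> \<le> ?s n"
      by (intro mult_left_mono add_mono power_mono le FH GH form_bound_nonneg[OF C]) auto
    finally show ?thesis .
  qed
  moreover have "(\<lambda>i. t (\<lambda>x. ?a i x * F n x) (\<lambda>x. ?a i x * G n x)) \<longlonglongrightarrow> t (F n) (G n)" for n
    by (intro form_tendsto t FH GH BM_mult_H[OF BM] nrm_indicator_tendsto E ev)
  \<comment> \<open>Tannery's theorem: truncation does not increase norms, hence \<open>?s\<close>
    dominates the series for all \<open>i\<close> at once and the limit passes inside the
    sum.\<close>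
  ultimately have "(\<lambda>i. \<Sum>n. t (\<lambda>x. ?a i x * F n x) (\<lambda>x. ?a i x * G n x)) \<longlonglongrightarrow> (\<Sum>n. t (F n) (G n))"
    using tannerys_theorem[of "\<lambda>n i. t (\<lambda>x. ?a i x * F n x) (\<lambda>x. ?a i x * G n x)" "\<lambda>n. t (F n) (G n)" sequentially ?s]
    by (simp add: case_prod_unfold)
  then have "(\<lambda>i. psum (\<lambda>n x. ?a i x * F n x) (\<lambda>n x. ?a i x * G n x) t) \<longlonglongrightarrow> psum F G t"
    by (simp only: psum_def)
  then have "\<forall>\<^sub>F i in sequentially. psum (\<lambda>n x. ?a i x * F n x) (\<lambda>n x. ?a i x * G n x) t \<noteq> 0"
    by (rule tendsto_imp_eventually_ne[OF _ ne])
  then obtain i where "psum (\<lambda>n x. ?a i x * F n x) (\<lambda>n x. ?a i x * G n x) t \<noteq> 0"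
    using eventually_happens' sequentially_bot by blast
  from that[OF BM FE GE this] show ?thesis .
qed

text \<open>Cutting the sequences amounts to multiplying the form by the indicator on both sides,
  under which a bimodule is invariant; the cut functional therefore still annihilates
  \<open>U\<close>.\<close>

lemma nice_separation:
  assumes U: "form_bimodule U" and F: "ssq F" "ssq G" "kills F G U" and t: "t \<in> bsf" "psum F G t \<noteq> 0"
  obtains m A F' G' where "nice m A F'" "nice m A G'" "kills F' G' U" "psum F' G' t \<noteq> 0"
proof -
  obtain m A a where a: "a \<in> BM" and n: "nice m A (\<lambda>n x. a x * F n x)" "nice m A (\<lambda>n x. a x * G n x)"
    "psum (\<lambda>n x. a x * F n x) (\<lambda>n x. a x * G n x) t \<noteq> 0"
    by (rule nice_cut[OF F(1,2) t])
  have "kills (\<lambda>n x. a x * F n x) (\<lambda>n x. a x * G n x) U"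
    using F(3) form_bimodule_mlt[OF U _ a a] unfolding kills_def psum_cut[OF F(1,2)] by blast
  from that[OF n(1,2) this n(3)] show ?thesis .
qed

lemma reflexive_separation:
  assumes "form_bimodule U" "reflexive U" "t \<in> bsf" "t \<notin> U"
  obtains m A F G where "nice m A F" "nice m A G" "kills F G U" "psum F G t \<noteq> 0"
proof -
  obtain F G where "ssq F" "ssq G" "kills F G U" "psum F G t \<noteq> 0"
    using assms unfolding reflexive_def by blast
  from nice_separation[OF assms(1) this(1-3) assms(3) this(4)] that show ?thesis .
qed

text \<open>A functional that annihilates \<open>U\<close> annihilates every two-sided multiple of
  \<open>t\<close>, hence their series; the double annihilator property concludes.\<close>

lemma schur_in_bimodule:
  assumes U: "form_bimodule U" "reflexive U" and F: "nice m A F" and G: "nice m A G" and t: "t \<in> U"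
  shows "schur F G t \<in> U"
proof -
  have b: "t \<in> bsf" by (rule form_bimodule_bsf[OF U(1) t])
  have "psum F' G' (schur F G t) = 0" if F': "ssq F'" "ssq G'" "kills F' G' U" for F' G'
  proof -
    have "psum F' G' (mlt (F n) (G n) t) = 0" for n
      using F'(3) form_bimodule_mlt[OF U(1) t nice_BM[OF F] nice_BM[OF G]] unfolding kills_def by blast
    then show ?thesis by (simp add: psum_schur_swap[OF F G F'(1,2) b])
  qed
  then show ?thesis using U(2) schur_bsf[OF F G b] unfolding reflexive_def by blast
qed

text \<open>Both sides are one double series in which the two kernels enter symmetrically through
  their products; they differ in the order of summation.\<close>

lemma psum_schur_exchange:
  assumes F: "nice m A F" and G: "nice m A G" and F': "nice m' A' F'" and G': "nice m' A' G'" and t: "t \<in> bsf"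
  shows "psum F' G' (schur F G t) = psum F G (schur F' G' t)"
  unfolding psum_schur[OF F' G' nice_ssq[OF F] nice_ssq[OF G] t]
    psum_schur[OF F G nice_ssq[OF F'] nice_ssq[OF G'] t]
    double_series(1)[OF schur_abs_summable[OF F G nice_ssq[OF F'] nice_ssq[OF G'] t]]
  by (simp add: mult.commute)

text \<open>If the product were outside \<open>U\<close>, a functional annihilating \<open>U\<close>
  would detect it. Composed with the Schur multiplier, that functional annihilates \<open>U\<close>
  by invariance and \<open>V\<close> by the symmetry, so it vanishes at \<open>t\<close>.\<close>

lemma schur_weakly_in_sum:
  assumes U: "form_bimodule U" "reflexive U" and V: "form_bimodule V"
    and F: "nice m A F" and G: "nice m A G" and kV: "kills F G V" and t: "weakly_in_sum t U V"
  shows "schur F G t \<in> U"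
proof (rule ccontr)
  assume n: "schur F G t \<notin> U"
  have b: "t \<in> bsf" using t by (simp add: weakly_in_sum_def)
  obtain m' A' F' G' where F': "nice m' A' F'" and G': "nice m' A' G'" and kU: "kills F' G' U"
    and ne: "psum F' G' (schur F G t) \<noteq> 0"
    by (rule reflexive_separation[OF U schur_bsf[OF F G b] n])
  \<comment> \<open>The hypothesis on \<open>t\<close> concerns nuclear functionals, so the
    composition has to be written as one.\<close>
  obtain F2 G2 where s: "ssq F2" "ssq G2" and eq: "\<And>t. t \<in> bsf \<Longrightarrow> psum F2 G2 t = psum F' G' (schur F G t)"
    using psum_schur_as_psum[OF F G nice_ssq[OF F'] nice_ssq[OF G']] by metis
  have "kills F2 G2 U"
    unfolding kills_def
  proof
    fix u assume u: "u \<in> U"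
    have "psum F2 G2 u = psum F' G' (schur F G u)" by (rule eq[OF form_bimodule_bsf[OF U(1) u]])
    also have "\<dots> = 0" using kU schur_in_bimodule[OF U F G u] unfolding kills_def by blast
    finally show "psum F2 G2 u = 0" .
  qed
  moreover have "kills F2 G2 V"
    unfolding kills_def
  proof
    fix v assume v: "v \<in> V"
    note bv = form_bimodule_bsf[OF V v]
    \<comment> \<open>After the exchange the functional annihilating \<open>V\<close> is on the
      outside and meets only two-sided multiples of \<open>v\<close>.\<close>
    have "psum F2 G2 v = psum F G (schur F' G' v)"
      unfolding eq[OF bv] by (rule psum_schur_exchange[OF F G F' G' bv])
    also have "\<dots> = (\<Sum>n. psum F G (mlt (F' n) (G' n) v))"
      by (rule psum_schur_swap[OF F' G' nice_ssq[OF F] nice_ssq[OF G] bv])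
    also have "\<dots> = (\<Sum>n. 0)"
      using kV form_bimodule_mlt[OF V v nice_BM[OF F'] nice_BM[OF G']] unfolding kills_def by simp
    finally show "psum F2 G2 v = 0" by simp
  qed
  ultimately have "psum F2 G2 t = 0" using t s unfolding weakly_in_sum_def by blast
  then show False using ne eq[OF b] by simp
qed

text \<open>The Schur product of \<open>t\<close> with a functional annihilating the compact parts of \<open>U\<close> and \<open>V\<close>
  lies in both bimodules, hence vanishes.\<close>

lemma nice_annihilates_weak_sum:
  assumes U: "form_bimodule U" "reflexive U" and V: "form_bimodule V" "reflexive V"
    and F: "nice m A F" and G: "nice m A G" and kU: "kills F G (U \<inter> APX)" and kV: "kills F G (V \<inter> APX)"
    and UV: "\<And>r. r \<in> U \<Longrightarrow> r \<in> V \<Longrightarrow> r \<in> APX \<Longrightarrow> r = (\<lambda>f g. 0)"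
    and t: "weakly_in_sum t U V" "t \<in> APX"
  shows "psum F G t = 0"
proof -
  have b: "t \<in> bsf" by (rule APX_bsf[OF t(2)])
  \<comment> \<open>The given functional annihilates only the compact part of \<open>V'\<close>, so
    \<open>schur_weakly_in_sum\<close> is applied to the separating functional, which annihilates
    all of \<open>U'\<close>. Its Schur product with \<open>t\<close> lies in \<open>V'\<close> and
    is compact, so the given functional vanishes there.\<close>
  have in1: "schur F G t \<in> U'"
    if U': "form_bimodule U'" "reflexive U'" and V': "form_bimodule V'" "reflexive V'"
      and kV': "kills F G (V' \<inter> APX)" and t': "weakly_in_sum t U' V'" for U' V'
  proof (rule ccontr)
    assume n: "schur F G t \<notin> U'"
    obtain m' A' F' G' where F': "nice m' A' F'" and G': "nice m' A' G'" and k: "kills F' G' U'"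
      and ne: "psum F' G' (schur F G t) \<noteq> 0"
      by (rule reflexive_separation[OF U' schur_bsf[OF F G b] n])
    have "schur F' G' t \<in> V'"
      by (rule schur_weakly_in_sum[OF V' U'(1) F' G' k weakly_in_sum_commute[OF t']])
    then have "psum F G (schur F' G' t) = 0"
      using kV' schur_APX[OF F' G' t(2)] unfolding kills_def by blast
    then show False using ne psum_schur_exchange[OF F G F' G' b] by simp
  qed
  have "schur F G t = (\<lambda>f g. 0)"
    by (intro UV in1[OF U V kV t(1)] in1[OF V U kU weakly_in_sum_commute[OF t(1)]] schur_APX[OF F G t(2)])
  moreover have "(\<lambda>x. indicator A x :: complex) \<in> H" using F by (intro indicator_H) (auto simp: nice_def)
  \<comment> \<open>Since both families vanish off \<open>A\<close>, testing the Schur product at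
    the indicator gives back the functional.\<close>
  then have "schur F G t (\<lambda>x. indicator A x) (\<lambda>x. indicator A x) = psum F G t"
    by (simp add: schur_def nice_indicator[OF F] nice_indicator[OF G])
  ultimately show ?thesis by simp
qed

end

section \<open>The Hahn--Banach theorem\<close>

text \<open>The space is a set of functions of two arguments, not a type, so vector operations are
  explicit and subspaces are relative to it.\<close>

definition vadd :: "('c \<Rightarrow> 'd \<Rightarrow> complex) \<Rightarrow> ('c \<Rightarrow> 'd \<Rightarrow> complex) \<Rightarrow> 'c \<Rightarrow> 'd \<Rightarrow> complex" where
  "vadd s t = (\<lambda>f g. s f g + t f g)"

definition vscl :: "complex \<Rightarrow> ('c \<Rightarrow> 'd \<Rightarrow> complex) \<Rightarrow> 'c \<Rightarrow> 'd \<Rightarrow> complex" where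
  "vscl c t = (\<lambda>f g. c * t f g)"

definition vsubspace :: "('c \<Rightarrow> 'd \<Rightarrow> complex) set \<Rightarrow> bool" where
  "vsubspace X \<longleftrightarrow> X \<noteq> {} \<and> (\<forall>s\<in>X. \<forall>t\<in>X. vadd s t \<in> X) \<and> (\<forall>c. \<forall>t\<in>X. vscl c t \<in> X)"

definition sublinear :: "('c \<Rightarrow> 'd \<Rightarrow> complex) set \<Rightarrow> (('c \<Rightarrow> 'd \<Rightarrow> complex) \<Rightarrow> real) \<Rightarrow> bool" where
  "sublinear X q \<longleftrightarrow> (\<forall>s\<in>X. \<forall>t\<in>X. q (vadd s t) \<le> q s + q t) \<and>
     (\<forall>r>0. \<forall>t\<in>X. q (vscl (of_real r) t) \<le> r * q t)"

text \<open>The modification of \<open>q\<close> along \<open>y\<close> is sublinear, lies below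
  \<open>q\<close>, and is at most \<open>- q y\<close> at the negative of \<open>y\<close>. A
  minimal \<open>q\<close> is unchanged by it, which forces additivity. The value 0 off
  \<open>X\<close> makes functionals comparable as total functions.\<close>

definition lowered :: "('c \<Rightarrow> 'd \<Rightarrow> complex) set \<Rightarrow> (('c \<Rightarrow> 'd \<Rightarrow> complex) \<Rightarrow> real) \<Rightarrow>
    ('c \<Rightarrow> 'd \<Rightarrow> complex) \<Rightarrow> ('c \<Rightarrow> 'd \<Rightarrow> complex) \<Rightarrow> real" where
  "lowered X q y x = (if x \<in> X then (INF r\<in>{0..}. q (vadd x (vscl (of_real r) y)) - r * q y) else 0)"

lemma vscl_zero: "vscl 0 t = (\<lambda>f g. 0)" and vscl_one: "vscl 1 t = t"
  and vadd_zero: "vadd t (\<lambda>f g. 0) = t" and vscl_vscl: "vscl a (vscl b t) = vscl (a * b) t"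
  and vscl_vadd: "vscl c (vadd s t) = vadd (vscl c s) (vscl c t)"
  and vscl_add: "vscl (a + b) t = vadd (vscl a t) (vscl b t)"
  by (auto simp: vscl_def vadd_def algebra_simps)

context
  fixes X :: "('c \<Rightarrow> 'd \<Rightarrow> complex) set"
  assumes X: "vsubspace X"
begin

lemma X_add: "s \<in> X \<Longrightarrow> t \<in> X \<Longrightarrow> vadd s t \<in> X"
  and X_scl: "t \<in> X \<Longrightarrow> vscl c t \<in> X"
  using X unfolding vsubspace_def by blast+

lemma X_zero: "(\<lambda>f g. 0) \<in> X"
  using X X_scl[of _ 0] unfolding vsubspace_def vscl_zero by blast

context
  fixes q assumes q: "sublinear X q"
begin

lemma sublinear_add: "s \<in> X \<Longrightarrow> t \<in> X \<Longrightarrow> q (vadd s t) \<le> q s + q t"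
  and sublinear_scl_le: "r > 0 \<Longrightarrow> t \<in> X \<Longrightarrow> q (vscl (of_real r) t) \<le> r * q t"
  using q unfolding sublinear_def by blast+

lemma sublinear_zero: "q (\<lambda>f g. 0) = 0"
proof -
  have e: "vscl c (\<lambda>f g. 0) = (\<lambda>(f::'c) (g::'d). 0)" for c by (simp add: vscl_def)
  show ?thesis using sublinear_scl_le[of 2 "\<lambda>f g. 0"] sublinear_scl_le[of "1/2" "\<lambda>f g. 0"] X_zero unfolding e by simp
qed

lemma sublinear_scl: assumes "r \<ge> 0" "t \<in> X" shows "q (vscl (of_real r) t) = r * q t"
proof (cases "r = 0")
  case True
  then show ?thesis by (simp add: vscl_zero sublinear_zero)
next
  case False
  then have r: "r > 0" using assms by simp
  have "q (vscl (of_real (1/r)) (vscl (of_real r) t)) \<le> (1/r) * q (vscl (of_real r) t)"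
    using r assms by (intro sublinear_scl_le X_scl) auto
  moreover have "vscl (of_real (1/r)) (vscl (of_real r) t) = t" using r by (simp add: vscl_vscl vscl_one)
  ultimately have "r * q t \<le> q (vscl (of_real r) t)" using r by (simp add: field_simps)
  then show ?thesis using sublinear_scl_le[OF r assms(2)] by simp
qed

lemma sublinear_neg: assumes "t \<in> X" shows "- q (vscl (-1) t) \<le> q t"
proof -
  have "vadd t (vscl (-1) t) = (\<lambda>f g. 0)" by (simp add: vadd_def vscl_def)
  then show ?thesis using sublinear_add[OF assms X_scl[OF assms, of "-1"]] sublinear_zero by simp
qed

context
  fixes y assumes y: "y \<in> X"
begin

lemma lowered_bdd: assumes "x \<in> X"
  shows "bdd_below ((\<lambda>r. q (vadd x (vscl (of_real r) y)) - r * q y) ` {0..})"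
proof (rule bdd_belowI2[of _ "- q (vscl (-1) x)"])
  fix r :: real assume "r \<in> {0..}"
  then have r: "r \<ge> 0" by simp
  have "q (vadd (vadd x (vscl (of_real r) y)) (vscl (-1) x)) \<le> q (vadd x (vscl (of_real r) y)) + q (vscl (-1) x)"
    by (intro sublinear_add X_add X_scl assms y)
  moreover have "vadd (vadd x (vscl (of_real r) y)) (vscl (-1) x) = vscl (of_real r) y"
    by (simp add: vadd_def vscl_def)
  ultimately show "- q (vscl (-1) x) \<le> q (vadd x (vscl (of_real r) y)) - r * q y"
    using sublinear_scl[OF r y] by simp
qed

lemma lowered_le: "x \<in> X \<Longrightarrow> r \<ge> 0 \<Longrightarrow> lowered X q y x \<le> q (vadd x (vscl (of_real r) y)) - r * q y"
  unfolding lowered_def using cINF_lower[OF lowered_bdd[of x], of r] by simp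

lemma lowered_ge:
  assumes "x \<in> X" "\<And>r. r \<ge> 0 \<Longrightarrow> b \<le> q (vadd x (vscl (of_real r) y)) - r * q y"
  shows "b \<le> lowered X q y x"
  unfolding lowered_def using assms by (auto intro!: cINF_greatest)

lemma lowered_le_self: "x \<in> X \<Longrightarrow> lowered X q y x \<le> q x"
  using lowered_le[of x 0] by (simp add: vscl_zero vadd_zero)

text \<open>Parameters \<open>a\<close> for \<open>s\<close> and \<open>b\<close> for
  \<open>t\<close> combine to \<open>a + b\<close> for the sum; in the homogeneity estimate the
  parameter scales along with the argument.\<close>

lemma sublinear_lowered: "sublinear X (lowered X q y)"
  unfolding sublinear_def
proof (intro conjI ballI allI impI)
  fix s t assume s: "s \<in> X" and t: "t \<in> X"
  have *: "lowered X q y (vadd s t) \<le> (q (vadd s (vscl (of_real a) y)) - a * q y) + (q (vadd t (vscl (of_real b) y)) - b * q y)"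
    if "a \<ge> 0" "b \<ge> 0" for a b
  proof -
    have "lowered X q y (vadd s t) \<le> q (vadd (vadd s t) (vscl (of_real (a + b)) y)) - (a + b) * q y"
      using that by (intro lowered_le X_add s t) auto
    also have "vadd (vadd s t) (vscl (of_real (a + b)) y) = vadd (vadd s (vscl (of_real a) y)) (vadd t (vscl (of_real b) y))"
      by (auto simp: vadd_def vscl_def algebra_simps)
    also have "q \<dots> \<le> q (vadd s (vscl (of_real a) y)) + q (vadd t (vscl (of_real b) y))"
      by (intro sublinear_add X_add X_scl s t y)
    finally show ?thesis by (simp add: algebra_simps)
  qed
  have "lowered X q y (vadd s t) - lowered X q y t \<le> lowered X q y s"
  proof (rule lowered_ge[OF s])
    fix a :: real assume a: "a \<ge> 0"
    have "lowered X q y (vadd s t) - (q (vadd s (vscl (of_real a) y)) - a * q y) \<le> lowered X q y t"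
      using *[OF a] by (intro lowered_ge t) (simp add: algebra_simps)
    then show "lowered X q y (vadd s t) - lowered X q y t \<le> q (vadd s (vscl (of_real a) y)) - a * q y" by simp
  qed
  then show "lowered X q y (vadd s t) \<le> lowered X q y s + lowered X q y t" by simp
next
  fix r :: real and t assume r: "0 < r" and t: "t \<in> X"
  have "lowered X q y (vscl (of_real r) t) / r \<le> lowered X q y t"
  proof (rule lowered_ge[OF t])
    fix a :: real assume a: "a \<ge> 0"
    have "lowered X q y (vscl (of_real r) t) \<le> q (vadd (vscl (of_real r) t) (vscl (of_real (r * a)) y)) - (r * a) * q y"
      using r a by (intro lowered_le X_scl t) auto
    also have "vadd (vscl (of_real r) t) (vscl (of_real (r * a)) y) = vscl (of_real r) (vadd t (vscl (of_real a) y))"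
      by (auto simp: vadd_def vscl_def algebra_simps)
    also have "q \<dots> = r * q (vadd t (vscl (of_real a) y))"
      using r by (intro sublinear_scl X_add X_scl t y) auto
    finally show "lowered X q y (vscl (of_real r) t) / r \<le> q (vadd t (vscl (of_real a) y)) - a * q y"
      using r by (simp add: field_simps)
  qed
  then show "lowered X q y (vscl (of_real r) t) \<le> r * lowered X q y t" using r by (simp add: field_simps)
qed

end
end

text \<open>A minimal sublinear functional is additive, since it cannot be lowered.\<close>

lemma minimal_sublinear_exists:
  assumes p: "sublinear X p"
  obtains \<Phi> where "sublinear X \<Phi>" "\<And>t. t \<in> X \<Longrightarrow> \<Phi> t \<le> p t"
    "\<And>s t. s \<in> X \<Longrightarrow> t \<in> X \<Longrightarrow> \<Phi> (vadd s t) = \<Phi> s + \<Phi> t"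
proof -
  define A where "A = {q. sublinear X q \<and> (\<forall>t\<in>X. q t \<le> p t) \<and> (\<forall>t. t \<notin> X \<longrightarrow> q t = 0)}"
  \<comment> \<open>The order is reversed because Zorn's lemma yields maximal elements while a
    minimal functional is sought.\<close>
  define P where "P q q' \<longleftrightarrow> (\<forall>t. q' t \<le> q t)" for q q' :: "('c \<Rightarrow> 'd \<Rightarrow> complex) \<Rightarrow> real"
  have "\<exists>\<Phi>\<in>A. \<forall>a\<in>A. P \<Phi> a \<longrightarrow> a = \<Phi>"
  proof (rule predicate_Zorn)
    show "partial_order_on A (relation_of P A)"
    proof (rule partial_order_on_relation_ofI)
      show "a = b" if "P a b" "P b a" for a b
        by (rule ext) (use that in \<open>simp add: P_def antisym\<close>)
    qed (auto simp: P_def intro: order_trans)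
    fix C assume "C \<in> Chains (relation_of P A)"
    then have CA: "C \<subseteq> A" and tot: "\<And>a b. a \<in> C \<Longrightarrow> b \<in> C \<Longrightarrow> P a b \<or> P b a"
      by (auto simp: Chains_def relation_of_def)
    show "\<exists>u\<in>A. \<forall>a\<in>C. P a u"
    proof (cases "C = {}")
      case True
      define p' where "p' t = (if t \<in> X then p t else 0)" for t
      have "p' \<in> A" using p X_add X_scl unfolding A_def sublinear_def p'_def by auto
      then show ?thesis using True by auto
    next
      case False
      have CA': "sublinear X q" "\<And>t. t \<in> X \<Longrightarrow> q t \<le> p t" "\<And>t. t \<notin> X \<Longrightarrow> q t = 0" if "q \<in> C" for q
        using CA that unfolding A_def by blast+
      define u where "u t = (INF q\<in>C. q t)" for t
      \<comment> \<open>Inside \<open>X\<close> the bound comes from \<open>sublinear_neg\<close>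
        and domination by \<open>p\<close>, uniformly over the chain; the 0 covers arguments outside
        \<open>X\<close>.\<close>
      have bdd: "bdd_below ((\<lambda>q. q t) ` C)" for t
      proof (rule bdd_belowI2[of _ "min 0 (- p (vscl (-1) t))"])
        fix q assume q: "q \<in> C"
        show "min 0 (- p (vscl (-1) t)) \<le> q t"
        proof (cases "t \<in> X")
          case True
          have "q (vscl (-1) t) \<le> p (vscl (-1) t)" by (rule CA'(2)[OF q X_scl[OF True]])
          then show ?thesis using sublinear_neg[OF CA'(1)[OF q] True] by simp
        qed (simp add: CA'(3)[OF q])
      qed
      have ule: "u t \<le> q t" if "q \<in> C" for q t unfolding u_def by (rule cINF_lower[OF bdd that])
      have uge: "b \<le> u t" if "\<And>q. q \<in> C \<Longrightarrow> b \<le> q t" for b t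
        unfolding u_def using False that by (rule cINF_greatest)
      have "sublinear X u"
        unfolding sublinear_def
      proof (intro conjI ballI allI impI)
        fix s t assume s: "s \<in> X" and t: "t \<in> X"
        \<comment> \<open>Of two members of a chain the smaller one can be used for both
          summands.\<close>
        have *: "u (vadd s t) \<le> a s + b t" if ab: "a \<in> C" "b \<in> C" for a b
        proof -
          obtain c where c: "c \<in> C" "c s \<le> a s" "c t \<le> b t"
            using tot[OF ab] ab unfolding P_def by (meson order_refl)
          have "u (vadd s t) \<le> c (vadd s t)" by (rule ule[OF c(1)])
          also have "\<dots> \<le> c s + c t" by (rule sublinear_add[OF CA'(1)[OF c(1)] s t])
          finally show ?thesis using c by simp
        qed
        have "u (vadd s t) - u t \<le> u s"
        proof (rule uge)
          fix a assume a: "a \<in> C"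
          have "u (vadd s t) - a s \<le> u t" using *[OF a] by (intro uge) (simp add: algebra_simps)
          then show "u (vadd s t) - u t \<le> a s" by simp
        qed
        then show "u (vadd s t) \<le> u s + u t" by simp
      next
        fix r :: real and t assume r: "r > 0" and t: "t \<in> X"
        have "u (vscl (of_real r) t) / r \<le> u t"
        proof (rule uge)
          fix q assume q: "q \<in> C"
          have "u (vscl (of_real r) t) \<le> q (vscl (of_real r) t)" by (rule ule[OF q])
          also have "\<dots> \<le> r * q t" by (rule sublinear_scl_le[OF CA'(1)[OF q] r t])
          finally show "u (vscl (of_real r) t) / r \<le> q t" using r by (simp add: field_simps)
        qed
        then show "u (vscl (of_real r) t) \<le> r * u t" using r by (simp add: field_simps)
      qed
      moreover have "u t \<le> p t" if "t \<in> X" for t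
        using False ule CA'(2)[OF _ that] order_trans by blast
      moreover have "u t = 0" if "t \<notin> X" for t
      proof -
        have "(\<lambda>q. q t) ` C = {0}" using False CA'(3)[OF _ that] by force
        then show ?thesis unfolding u_def by simp
      qed
      ultimately have "u \<in> A" unfolding A_def by blast
      then show ?thesis using ule unfolding P_def by blast
    qed
  qed
  then obtain \<Phi> where \<Phi>: "\<Phi> \<in> A" and min: "\<And>a. a \<in> A \<Longrightarrow> P \<Phi> a \<Longrightarrow> a = \<Phi>" by blast
  have s\<Phi>: "sublinear X \<Phi>" and le: "\<And>t. t \<in> X \<Longrightarrow> \<Phi> t \<le> p t" and out: "\<And>t. t \<notin> X \<Longrightarrow> \<Phi> t = 0"
    using \<Phi> unfolding A_def by blast+
  have "\<Phi> (vadd s t) = \<Phi> s + \<Phi> t" if s: "s \<in> X" and t: "t \<in> X" for s t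
  proof -
    have l: "lowered X \<Phi> t x \<le> \<Phi> x" if "x \<in> X" for x by (rule lowered_le_self[OF s\<Phi> t that])
    have "lowered X \<Phi> t = \<Phi>"
    proof (rule min)
      show "lowered X \<Phi> t \<in> A" unfolding A_def
      proof (intro CollectI conjI ballI allI impI)
        show "sublinear X (lowered X \<Phi> t)" by (rule sublinear_lowered[OF s\<Phi> t])
        show "lowered X \<Phi> t x \<le> p x" if "x \<in> X" for x using l[OF that] le[OF that] by simp
        show "lowered X \<Phi> t x = 0" if "x \<notin> X" for x using that by (simp add: lowered_def)
      qed
      show "P \<Phi> (lowered X \<Phi> t)" unfolding P_def using l out by (metis lowered_def order_refl)
    qed
    \<comment> \<open>The infimum that defines the lowered functional, evaluated at parameter 1, is
      the missing superadditivity.\<close>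
    then have "\<Phi> s \<le> \<Phi> (vadd s (vscl (of_real 1) t)) - 1 * \<Phi> t" using lowered_le[OF s\<Phi> t s, of 1] by simp
    then show ?thesis using sublinear_add[OF s\<Phi> s t] by (simp add: vscl_one)
  qed
  from that[OF s\<Phi> le this] show ?thesis .
qed

text \<open>The minimal functional is sought below \<open>lowered X p x0\<close> instead of
  \<open>p\<close>. As that is at most \<open>- p x0\<close> at the negative of \<open>x0\<close>,
  the resulting functional attains \<open>p\<close> at \<open>x0\<close> without any extension from
  a line.\<close>

lemma Hahn_Banach_complex:
  assumes sub: "\<And>s t. s \<in> X \<Longrightarrow> t \<in> X \<Longrightarrow> p (vadd s t) \<le> p s + p t"
    and hom: "\<And>c t. t \<in> X \<Longrightarrow> p (vscl c t) = cmod c * p t"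
    and x0: "x0 \<in> X"
  obtains \<phi> where "\<And>s t. s \<in> X \<Longrightarrow> t \<in> X \<Longrightarrow> \<phi> (vadd s t) = \<phi> s + \<phi> t"
    "\<And>c t. t \<in> X \<Longrightarrow> \<phi> (vscl c t) = c * \<phi> t" "\<And>t. t \<in> X \<Longrightarrow> cmod (\<phi> t) \<le> p t" "p x0 \<le> Re (\<phi> x0)"
proof -
  have p: "sublinear X p" unfolding sublinear_def using sub hom by simp
  obtain \<Phi> where s\<Phi>: "sublinear X \<Phi>" and le: "\<And>t. t \<in> X \<Longrightarrow> \<Phi> t \<le> lowered X p x0 t"
    and add: "\<And>s t. s \<in> X \<Longrightarrow> t \<in> X \<Longrightarrow> \<Phi> (vadd s t) = \<Phi> s + \<Phi> t"
    using minimal_sublinear_exists[OF sublinear_lowered[OF p x0]] by metis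
  have lep: "\<Phi> t \<le> p t" if "t \<in> X" for t using le[OF that] lowered_le_self[OF p x0 that] by simp
  have neg: "\<Phi> (vscl (-1) t) = - \<Phi> t" if "t \<in> X" for t
  proof -
    have "vadd t (vscl (-1) t) = (\<lambda>f g. 0)" by (simp add: vadd_def vscl_def)
    then show ?thesis using add[OF that X_scl[OF that, of "-1"]] sublinear_zero[OF s\<Phi>] by simp
  qed
  have rscl: "\<Phi> (vscl (of_real r) t) = r * \<Phi> t" if t: "t \<in> X" for r t
  proof (cases "r \<ge> 0")
    case True
    then show ?thesis by (rule sublinear_scl[OF s\<Phi> _ t])
  next
    case False
    have "vscl (of_real r) t = vscl (-1) (vscl (of_real (-r)) t)" by (simp add: vscl_vscl)
    then have "\<Phi> (vscl (of_real r) t) = - \<Phi> (vscl (of_real (-r)) t)" using neg[OF X_scl[OF t]] by simp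
    also have "\<Phi> (vscl (of_real (-r)) t) = (-r) * \<Phi> t" using False by (intro sublinear_scl[OF s\<Phi> _ t]) simp
    finally show ?thesis by simp
  qed
  have x0le: "p x0 \<le> \<Phi> x0"
  proof -
    have "\<Phi> (vscl (-1) x0) \<le> lowered X p x0 (vscl (-1) x0)" by (rule le[OF X_scl[OF x0]])
    also have "\<dots> \<le> p (vadd (vscl (-1) x0) (vscl (of_real 1) x0)) - 1 * p x0"
      by (rule lowered_le[OF p x0 X_scl[OF x0]]) simp
    also have "vadd (vscl (-1) x0) (vscl (of_real 1) x0) = (\<lambda>f g. 0)" by (simp add: vadd_def vscl_def)
    finally show ?thesis using neg[OF x0] sublinear_zero[OF p] by simp
  qed
  \<comment> \<open>The usual complexification of a real linear functional.\<close>
  define \<phi> where "\<phi> t = Complex (\<Phi> t) (- \<Phi> (vscl \<i> t))" for t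
  have phi_scl: "\<phi> (vscl c t) = c * \<phi> t" if t: "t \<in> X" for c t
  proof -
    have *: "\<Phi> (vscl c t) = Re c * \<Phi> t + Im c * \<Phi> (vscl \<i> t)" for c
    proof -
      have "vscl c t = vadd (vscl (of_real (Re c)) t) (vscl (of_real (Im c)) (vscl \<i> t))"
        unfolding vscl_vscl vscl_add[symmetric] by (rule arg_cong[where f="\<lambda>c. vscl c t"]) (simp add: complex_eq_iff)
      then show ?thesis using t by (simp add: add X_scl rscl)
    qed
    show ?thesis
      unfolding \<phi>_def vscl_vscl *[of c] *[of "\<i> * c"] by (simp add: complex_eq_iff)
  qed
  show ?thesis
  proof (rule that[of \<phi>])
    show "\<phi> (vadd s t) = \<phi> s + \<phi> t" if "s \<in> X" "t \<in> X" for s t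
      using that by (simp add: \<phi>_def vscl_vadd add X_scl complex_eq_iff)
    show "\<phi> (vscl c t) = c * \<phi> t" if "t \<in> X" for c t by (rule phi_scl[OF that])
    show "p x0 \<le> Re (\<phi> x0)" using x0le by (simp add: \<phi>_def)
    fix t assume t: "t \<in> X"
    \<comment> \<open>A phase that rotates the value at \<open>t\<close> to its modulus, so that the
      bound for the real part suffices.\<close>
    define c where "c = (if \<phi> t = 0 then 1 else cnj (\<phi> t) / of_real (cmod (\<phi> t)))"
    have c: "cmod c = 1" "c * \<phi> t = of_real (cmod (\<phi> t))"
      by (auto simp: c_def norm_divide complex_norm_square[symmetric] mult.commute power2_eq_square)
    have "cmod (\<phi> t) = Re (\<phi> (vscl c t))" using phi_scl[OF t, of c] c(2) by simp
    also have "\<dots> \<le> p (vscl c t)" using lep[OF X_scl[OF t]] by (simp add: \<phi>_def)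
    also have "\<dots> = p t" using hom[OF t] c(1) by simp
    finally show "cmod (\<phi> t) \<le> p t" .
  qed
qed

end

section \<open>Nuclear decomposition of forms of finite trace norm\<close>

context l2_space
begin

text \<open>Null vectors are allowed so that the greedy choice below never has to stop.\<close>

definition onz :: "(nat \<Rightarrow> 'a \<Rightarrow> complex) \<Rightarrow> nat \<Rightarrow> bool" where
  "onz e N \<longleftrightarrow> (\<forall>i<N. e i \<in> H \<and> (nrm (e i) = 0 \<or> nrm (e i) = 1) \<and> (\<forall>j<i. ip (e i) (e j) = 0))"

definition perp :: "(nat \<Rightarrow> 'a \<Rightarrow> complex) \<Rightarrow> nat \<Rightarrow> ('a \<Rightarrow> complex) set" where
  "perp e N = {f \<in> H. \<forall>j<N. ip f (e j) = 0}"

text \<open>The component of \<open>f\<close> orthogonal to the first \<open>N\<close> vectors; null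
  vectors among them contribute only null functions.\<close>

definition off :: "(nat \<Rightarrow> 'a \<Rightarrow> complex) \<Rightarrow> nat \<Rightarrow> ('a \<Rightarrow> complex) \<Rightarrow> 'a \<Rightarrow> complex" where
  "off e N f = (\<lambda>x. f x - (\<Sum>i<N. ip f (e i) * e i x))"

section \<open>Orthogonal complements of finite systems and Bessel's inequality\<close>

lemma onz_H: "onz e N \<Longrightarrow> i < N \<Longrightarrow> e i \<in> H"
  by (simp add: onz_def)

lemma onz_mono: "onz e N \<Longrightarrow> n \<le> N \<Longrightarrow> onz e n"
  by (simp add: onz_def)

lemma onz_orth: "onz e N \<Longrightarrow> i < N \<Longrightarrow> j < N \<Longrightarrow> i \<noteq> j \<Longrightarrow> ip (e i) (e j) = 0"
  unfolding onz_def by (metis ip_cnj complex_cnj_zero linorder_neqE_nat)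

text \<open>The one identity through which null vectors behave like unit vectors: for them the
  coefficient itself vanishes.\<close>

lemma onz_self: assumes "onz e N" "i < N" "f \<in> H" shows "ip f (e i) * ip (e i) (e i) = ip f (e i)"
proof -
  have "nrm (e i) = 0 \<or> nrm (e i) = 1" using assms by (simp add: onz_def)
  then show ?thesis
  proof
    assume "nrm (e i) = 0"
    then have "ip f (e i) = 0" using Cauchy_Schwarz[OF assms(3) onz_H[OF assms(1,2)]] by simp
    then show ?thesis by simp
  qed (simp add: ip_self)
qed

lemma off_zero: "off e 0 f = f"
  by (simp add: off_def)

lemma off_Suc: "off e (Suc N) f = (\<lambda>x. off e N f x - ip f (e N) * e N x)"
  by (simp add: off_def algebra_simps)

lemma off_H: assumes "onz e N" "f \<in> H" shows "off e N f \<in> H"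
  unfolding off_def using assms by (intro H_diff H_sum H_scale) (auto intro: onz_H)

lemma ip_off:
  assumes "onz e N" "f \<in> H" "h \<in> H"
  shows "ip (off e N f) h = ip f h - (\<Sum>i<N. ip f (e i) * ip (e i) h)"
proof -
  have e: "e i \<in> H" if "i \<in> {..<N}" for i using that onz_H[OF assms(1)] by simp
  have "ip (off e N f) h = ip f h - ip (\<lambda>x. \<Sum>i<N. ip f (e i) * e i x) h"
    unfolding off_def by (rule ip_diff_left[OF assms(2) H_sum[OF H_scale[OF e]] assms(3)])
  also have "ip (\<lambda>x. \<Sum>i<N. ip f (e i) * e i x) h = (\<Sum>i<N. ip (\<lambda>x. ip f (e i) * e i x) h)"
    by (rule ip_sum_left[OF H_scale[OF e] assms(3)])
  finally show ?thesis by (simp add: ip_scale_left)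
qed

lemma off_perp: assumes "onz e N" "f \<in> H" shows "off e N f \<in> perp e N"
  unfolding perp_def
proof (intro CollectI conjI allI impI off_H assms)
  fix j assume j: "j < N"
  have "(\<Sum>i<N. ip f (e i) * ip (e i) (e j)) = (\<Sum>i<N. if i = j then ip f (e j) else 0)"
    using onz_orth[OF assms(1) _ j] onz_self[OF assms(1) j assms(2)] by (intro sum.cong) auto
  also have "\<dots> = ip f (e j)" using j by simp
  finally show "ip (off e N f) (e j) = 0" by (simp add: ip_off[OF assms onz_H[OF assms(1) j]])
qed

lemma Bessel: "onz e N \<Longrightarrow> f \<in> H \<Longrightarrow> (nrm (off e N f))\<^sup>2 + (\<Sum>i<N. (cmod (ip f (e i)))\<^sup>2) = (nrm f)\<^sup>2"
proof (induction N)
  case 0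
  then show ?case by (simp add: off_zero)
next
  case (Suc N)
  have o: "onz e N" using Suc.prems(1) onz_mono by auto
  have eN: "e N \<in> H" using onz_H[OF Suc.prems(1)] by simp
  let ?c = "ip f (e N)"
  have ipo: "ip (off e N f) (e N) = ?c"
    unfolding ip_off[OF o Suc.prems(2) eN] using onz_orth[OF Suc.prems(1)] by simp
  have "(nrm (off e (Suc N) f))\<^sup>2 = (nrm (off e N f))\<^sup>2 - 2 * Re (cnj ?c * ?c) + (cmod ?c * nrm (e N))\<^sup>2"
    unfolding off_Suc nrm_diff_sq[OF off_H[OF o Suc.prems(2)] H_scale[OF eN]] ip_scale_right nrm_scale ipo ..
  also have "cnj ?c * ?c = complex_of_real ((cmod ?c)\<^sup>2)" by (simp only: complex_norm_square mult.commute)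
  also have "(cmod ?c * nrm (e N))\<^sup>2 = (cmod ?c)\<^sup>2"
  proof -
    have "cmod (ip f (e N)) * (nrm (e N))\<^sup>2 = cmod (ip f (e N))"
      using arg_cong[where f=cmod, OF onz_self[OF Suc.prems(1) _ Suc.prems(2), of N]]
      by (simp add: ip_self norm_mult norm_power)
    then show ?thesis by (simp add: power_mult_distrib power2_eq_square)
  qed
  finally have "(nrm (off e (Suc N) f))\<^sup>2 = (nrm (off e N f))\<^sup>2 - (cmod ?c)\<^sup>2" by (simp del: of_real_power)
  then show ?case using Suc.IH[OF o Suc.prems(2)] by simp
qed

lemma nrm_off_le: assumes "onz e N" "f \<in> H" shows "nrm (off e N f) \<le> nrm f"
proof (rule power2_le_imp_le)
  show "(nrm (off e N f))\<^sup>2 \<le> (nrm f)\<^sup>2"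
    using Bessel[OF assms] sum_nonneg[of "{..<N}" "\<lambda>i. (cmod (ip f (e i)))\<^sup>2", OF zero_le_power2] by linarith
qed simp

lemma Bessel_L2_set: assumes "onz e N" "f \<in> H" shows "L2_set (\<lambda>i. cmod (ip f (e i))) {..<N} \<le> nrm f"
  unfolding L2_set_def
proof (rule real_le_lsqrt)
  show "(\<Sum>i<N. (cmod (ip f (e i)))\<^sup>2) \<le> (nrm f)\<^sup>2"
    using Bessel[OF assms] zero_le_power2[of "nrm (off e N f)"] by linarith
qed (auto intro: sum_nonneg)

lemma off_add: assumes "onz e N" "f \<in> H" "g \<in> H"
  shows "off e N (\<lambda>x. f x + g x) = (\<lambda>x. off e N f x + off e N g x)"
proof
  fix x
  have "(\<Sum>i<N. ip (\<lambda>x. f x + g x) (e i) * e i x) = (\<Sum>i<N. ip f (e i) * e i x + ip g (e i) * e i x)"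
    using assms onz_H[OF assms(1)] by (intro sum.cong) (auto simp: ip_add_left distrib_right)
  then show "off e N (\<lambda>x. f x + g x) x = off e N f x + off e N g x"
    unfolding off_def sum.distrib by simp
qed

lemma off_scale: "off e N (\<lambda>x. c * f x) = (\<lambda>x. c * off e N f x)"
  unfolding off_def by (simp add: ip_scale_left sum_distrib_left algebra_simps)

lemma perp_scale: "f \<in> perp e N \<Longrightarrow> (\<lambda>x. c * f x) \<in> perp e N"
  by (auto simp: perp_def ip_scale_left)

lemma perp_zero: "(\<lambda>x. 0) \<in> perp e N"
  by (auto simp: perp_def)

lemma perp_H: "f \<in> perp e N \<Longrightarrow> f \<in> H"
  by (simp add: perp_def)

lemma perp_antimono: "f \<in> perp e N \<Longrightarrow> n \<le> N \<Longrightarrow> f \<in> perp e n"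
  by (simp add: perp_def)

text \<open>The supremum over unit vectors of the complements need not be attained, but when
  positive more than half of it is; this is the factor 2. If the form vanishes on the complements,
  zero vectors serve.\<close>

lemma greedy_step:
  assumes D: "D \<in> bsf"
  obtains f0 g0 where "f0 \<in> perp q n" "g0 \<in> perp p n" "nrm f0 = 0 \<or> nrm f0 = 1" "nrm g0 = 0 \<or> nrm g0 = 1"
    "\<And>f g. f \<in> perp q n \<Longrightarrow> g \<in> perp p n \<Longrightarrow> cmod (D f g) \<le> 2 * cmod (D f0 g0) * nrm f * nrm g"
proof (cases "\<forall>f\<in>perp q n. \<forall>g\<in>perp p n. D f g = 0")
  case True
  show ?thesis by (rule that[OF perp_zero perp_zero]) (use True in auto)
next
  case False
  obtain C where C: "form_bound D C" using D by (rule bsf_boundE)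
  define S where "S = {cmod (D f g) | f g. f \<in> perp q n \<and> g \<in> perp p n \<and> nrm f = 1 \<and> nrm g = 1}"
  have bdd: "bdd_above S"
  proof (rule bdd_aboveI[of _ C])
    fix s assume "s \<in> S"
    then obtain f g where s: "s = cmod (D f g)" and f: "f \<in> perp q n" "nrm f = 1" and g: "g \<in> perp p n" "nrm g = 1"
      unfolding S_def by blast
    show "s \<le> C" using form_boundD[OF C perp_H[OF f(1)] perp_H[OF g(1)]] f(2) g(2) by (simp add: s)
  qed
  have le: "cmod (D f g) \<le> Sup S * nrm f * nrm g" and pos: "D f g \<noteq> 0 \<Longrightarrow> Sup S > 0 \<and> S \<noteq> {}"
    if f: "f \<in> perp q n" and g: "g \<in> perp p n" for f g
  proof -
    note fH = perp_H[OF f] and gH = perp_H[OF g]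
    have "cmod (D f g) \<le> Sup S * nrm f * nrm g \<and> (D f g \<noteq> 0 \<longrightarrow> Sup S > 0 \<and> S \<noteq> {})"
    proof (cases "nrm f = 0 \<or> nrm g = 0")
      case True
      then have "cmod (D f g) \<le> 0" using form_boundD[OF C fH gH] by auto
      then show ?thesis using True by auto
    next
      case False
      then have n: "nrm f > 0" "nrm g > 0" using nrm_nonneg[of f] nrm_nonneg[of g] by linarith+
      let ?f = "\<lambda>x. of_real (1 / nrm f) * f x" and ?g = "\<lambda>x. of_real (1 / nrm g) * g x"
      have "nrm ?f = 1" "nrm ?g = 1" unfolding nrm_scale using n by (simp_all add: norm_divide)
      then have S: "cmod (D ?f ?g) \<in> S"
        unfolding S_def using perp_scale[OF f, of "of_real (1 / nrm f)"] perp_scale[OF g, of "of_real (1 / nrm g)"] by blast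
      have eq: "cmod (D ?f ?g) = cmod (D f g) / (nrm f * nrm g)"
        unfolding bsf_scale_left[OF D fH H_scale[OF gH]] bsf_scale_right[OF D gH fH]
        using n by (simp add: norm_mult norm_divide)
      have c1: "cmod (D f g) / (nrm f * nrm g) \<le> Sup S" using cSup_upper[OF S bdd] eq by simp
      have "D f g \<noteq> 0 \<longrightarrow> 0 < cmod (D f g) / (nrm f * nrm g)" using n by simp
      then have "D f g \<noteq> 0 \<longrightarrow> 0 < Sup S" using c1 by linarith
      moreover have "cmod (D f g) \<le> Sup S * nrm f * nrm g" using c1 n by (simp add: field_simps)
      ultimately show ?thesis using S by blast
    qed
    then show "cmod (D f g) \<le> Sup S * nrm f * nrm g" "D f g \<noteq> 0 \<Longrightarrow> Sup S > 0 \<and> S \<noteq> {}" by blast+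
  qed
  obtain f1 g1 where "f1 \<in> perp q n" "g1 \<in> perp p n" "D f1 g1 \<noteq> 0" using False by blast
  then have S: "Sup S > 0" "S \<noteq> {}" using pos by blast+
  have "Sup S / 2 < Sup S" using S(1) by simp
  then obtain s where "s \<in> S" "Sup S / 2 < s" using less_cSup_iff[OF S(2) bdd] by blast
  then obtain f0 g0 where 0: "f0 \<in> perp q n" "g0 \<in> perp p n" "nrm f0 = 1" "nrm g0 = 1" and lt: "Sup S / 2 < cmod (D f0 g0)"
    unfolding S_def by blast
  show ?thesis
  proof (rule that[OF 0(1,2)])
    fix f g assume "f \<in> perp q n" "g \<in> perp p n"
    then have "cmod (D f g) \<le> Sup S * nrm f * nrm g" by (rule le)
    also have "\<dots> \<le> 2 * cmod (D f0 g0) * nrm f * nrm g" using lt by (intro mult_right_mono) auto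
    finally show "cmod (D f g) \<le> 2 * cmod (D f0 g0) * nrm f * nrm g" .
  qed (use 0 in auto)
qed

lemma greedy_systems:
  assumes D: "D \<in> bsf"
  obtains q p where "\<And>N. onz q N" "\<And>N. onz p N"
    "\<And>n f g. f \<in> perp q n \<Longrightarrow> g \<in> perp p n \<Longrightarrow> cmod (D f g) \<le> 2 * cmod (D (q n) (p n)) * nrm f * nrm g"
proof -
  define good where "good s n r \<longleftrightarrow> fst r \<in> perp (\<lambda>i. fst (s i)) n \<and> snd r \<in> perp (\<lambda>i. snd (s i)) n \<and>
      (nrm (fst r) = 0 \<or> nrm (fst r) = 1) \<and> (nrm (snd r) = 0 \<or> nrm (snd r) = 1) \<and>
      (\<forall>f\<in>perp (\<lambda>i. fst (s i)) n. \<forall>g\<in>perp (\<lambda>i. snd (s i)) n. cmod (D f g) \<le> 2 * cmod (D (fst r) (snd r)) * nrm f * nrm g)"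
    for s :: "nat \<Rightarrow> ('a \<Rightarrow> complex) \<times> ('a \<Rightarrow> complex)" and n r
  \<comment> \<open>Recursive choice in which stage \<open>n\<close> consults only earlier stages;
    this holds because \<open>perp\<close> looks only at indices below \<open>n\<close>.\<close>
  have "\<exists>s. \<forall>n. good s n (s n)"
  proof (rule dependent_wellorder_choice)
    fix r and s s' :: "nat \<Rightarrow> ('a \<Rightarrow> complex) \<times> ('a \<Rightarrow> complex)" and n
    assume "\<And>y. y < n \<Longrightarrow> s y = s' y"
    then have "perp (\<lambda>i. fst (s i)) n = perp (\<lambda>i. fst (s' i)) n" "perp (\<lambda>i. snd (s i)) n = perp (\<lambda>i. snd (s' i)) n"
      unfolding perp_def by auto
    then show "good s n r = good s' n r" unfolding good_def by simp
  next
    fix n and s :: "nat \<Rightarrow> ('a \<Rightarrow> complex) \<times> ('a \<Rightarrow> complex)"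
    obtain f0 g0 where "f0 \<in> perp (\<lambda>i. fst (s i)) n" "g0 \<in> perp (\<lambda>i. snd (s i)) n"
      "nrm f0 = 0 \<or> nrm f0 = 1" "nrm g0 = 0 \<or> nrm g0 = 1"
      "\<And>f g. f \<in> perp (\<lambda>i. fst (s i)) n \<Longrightarrow> g \<in> perp (\<lambda>i. snd (s i)) n \<Longrightarrow> cmod (D f g) \<le> 2 * cmod (D f0 g0) * nrm f * nrm g"
      by (rule greedy_step[OF D]) blast
    then have "good s n (f0, g0)" unfolding good_def fst_conv snd_conv by blast
    then show "\<exists>r. good s n r" by blast
  qed
  then obtain s where s: "\<And>n. good s n (s n)" by blast
  have "onz (\<lambda>i. fst (s i)) N" "onz (\<lambda>i. snd (s i)) N" for N
    using s unfolding onz_def good_def perp_def by blast+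
  moreover have "cmod (D f g) \<le> 2 * cmod (D (fst (s n)) (snd (s n))) * nrm f * nrm g"
    if "f \<in> perp (\<lambda>i. fst (s i)) n" "g \<in> perp (\<lambda>i. snd (s i)) n" for f g n
    using s[of n] that unfolding good_def by blast
  ultimately show ?thesis by (rule that)
qed

text \<open>One vector is peeled off the first argument and then one off the second. The second
  removal meets the first argument already reduced, hence the \<open>Suc n\<close>.\<close>

lemma telescope_off:
  assumes D: "D \<in> bsf" and q: "\<And>N. onz q N" and p: "\<And>N. onz p N" and f: "f \<in> H" and g: "g \<in> H"
  shows "D f g = D (off q N f) (off p N g) +
    (\<Sum>n<N. ip f (q n) * D (q n) (off p n g) + cnj (ip g (p n)) * D (off q (Suc n) f) (p n))"
proof (induction N)
  case 0
  then show ?case by (simp add: off_zero)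
next
  case (Suc N)
  have qN: "q N \<in> H" and pN: "p N \<in> H" using onz_H[OF q[of "Suc N"]] onz_H[OF p[of "Suc N"]] by auto
  note oq = off_H[OF q f] and op = off_H[OF p g]
  have "off q N f = (\<lambda>x. off q (Suc N) f x + ip f (q N) * q N x)" by (simp add: off_Suc)
  then have 1: "D (off q N f) (off p N g) = D (off q (Suc N) f) (off p N g) + ip f (q N) * D (q N) (off p N g)"
    using bsf_add_left[OF D oq[of "Suc N"] H_scale[OF qN] op[of N], of "ip f (q N)"] bsf_scale_left[OF D qN op[of N], of "ip f (q N)"]
    by simp
  have "off p N g = (\<lambda>x. off p (Suc N) g x + ip g (p N) * p N x)" by (simp add: off_Suc)
  then have 2: "D (off q (Suc N) f) (off p N g) = D (off q (Suc N) f) (off p (Suc N) g) + cnj (ip g (p N)) * D (off q (Suc N) f) (p N)"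
    using bsf_add_right[OF D op[of "Suc N"] H_scale[OF pN] oq[of "Suc N"], of "ip g (p N)"] bsf_scale_right[OF D pN oq[of "Suc N"], of "ip g (p N)"]
    by simp
  show ?case using Suc 1 2 by simp
qed

text \<open>Vectors of norm at most \<open>2 * d\<close> and at most 1 are balanced by the root of
  \<open>d\<close>, so both become square summable once \<open>d\<close> is summable;
  \<open>4 * d\<close> is the square of \<open>2 * d\<close> over \<open>d\<close>. For
  \<open>d = 0\<close> the reciprocal is 0 and \<open>h\<close> is null, so the identities
  persist.\<close>

lemma rescale_rank_one:
  assumes d: "d \<ge> 0" and h: "h \<in> H" "nrm h \<le> 2 * d" and q: "nrm q \<le> 1" and g: "g \<in> H"
  shows "(nrm (\<lambda>x. of_real (1 / sqrt d) * h x))\<^sup>2 \<le> 4 * d" "(nrm (\<lambda>x. of_real (sqrt d) * q x))\<^sup>2 \<le> d"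
    and "ip (\<lambda>x. of_real (1 / sqrt d) * h x) g * ip f (\<lambda>x. of_real (sqrt d) * q x) = ip f q * ip h g"
    and "ip (\<lambda>x. of_real (sqrt d) * q x) f * ip g (\<lambda>x. of_real (1 / sqrt d) * h x) = ip g h * ip q f"
proof -
  have z: "ip h g = 0" "ip g h = 0" if "d = 0"
    using that h nrm_nonneg[of h] Cauchy_Schwarz[OF h(1) g] Cauchy_Schwarz[OF g h(1)] by auto
  have "(nrm h)\<^sup>2 \<le> (2 * d)\<^sup>2" using h(2) by (intro power_mono) auto
  then show "(nrm (\<lambda>x. of_real (1 / sqrt d) * h x))\<^sup>2 \<le> 4 * d"
    unfolding nrm_scale using d by (cases "d = 0") (auto simp: norm_divide power_mult_distrib power_divide field_simps power2_eq_square)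
  have "(nrm q)\<^sup>2 \<le> 1\<^sup>2" using q by (intro power_mono) auto
  then show "(nrm (\<lambda>x. of_real (sqrt d) * q x))\<^sup>2 \<le> d"
    unfolding nrm_scale using d mult_left_mono[of "(nrm q)\<^sup>2" 1 d] by (simp add: power_mult_distrib)
  show "ip (\<lambda>x. of_real (1 / sqrt d) * h x) g * ip f (\<lambda>x. of_real (sqrt d) * q x) = ip f q * ip h g"
    "ip (\<lambda>x. of_real (sqrt d) * q x) f * ip g (\<lambda>x. of_real (1 / sqrt d) * h x) = ip g h * ip q f"
    unfolding ip_scale_left ip_scale_right using d z by (cases "d = 0"; simp)+
qed

text \<open>A form of finite trace norm is a nuclear series. Choosing unit vectors that come within a
  factor of two of the supremum over the complements of their predecessors makes those suprema
  summable, and they bound the rank one forms into which the form telescopes.\<close>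

lemma nuclear_decomposition:
  assumes D: "D \<in> bsf"
    and trace: "\<And>N q p. onz q N \<Longrightarrow> onz p N \<Longrightarrow> (\<Sum>n<N. cmod (D (q n) (p n))) \<le> B"
  obtains F G where "ssq F" "ssq G" "\<And>f g. f \<in> H \<Longrightarrow> g \<in> H \<Longrightarrow> D f g = psum F G (rk g f)"
proof -
  obtain q p where q: "\<And>N. onz q N" and p: "\<And>N. onz p N"
    and gr: "\<And>n f g. f \<in> perp q n \<Longrightarrow> g \<in> perp p n \<Longrightarrow> cmod (D f g) \<le> 2 * cmod (D (q n) (p n)) * nrm f * nrm g"
    by (rule greedy_systems[OF D]) blast
  define d where "d n = cmod (D (q n) (p n))" for n
  have d0: "d n \<ge> 0" for n by (simp add: d_def)
  have ds: "summable d" by (rule bounded_partial_sums_summable(1)[of _ B]) (simp_all add: d_def trace[OF q p])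
  have qH: "q n \<in> H" and pH: "p n \<in> H" for n using onz_H[OF q[of "Suc n"]] onz_H[OF p[of "Suc n"]] by auto
  have q1: "nrm (q n) \<le> 1" and p1: "nrm (p n) \<le> 1" for n
    using q[of "Suc n"] p[of "Suc n"] unfolding onz_def by fastforce+
  have qp: "q n \<in> perp q n" and pp: "p n \<in> perp p n" for n
    using q[of "Suc n"] p[of "Suc n"] unfolding onz_def perp_def by auto
  have bd: "cmod (D f g) \<le> 2 * d n * nrm f * nrm g" if "f \<in> perp q n" "g \<in> perp p n" for f g n
    using gr[OF that] by (simp add: d_def)
  have "\<exists>h. h \<in> H \<and> (\<forall>g\<in>H. D (q n) (off p n g) = ip h g) \<and> nrm h \<le> 2 * d n" for n
  proof -
    \<comment> \<open>The form is conjugate linear in this argument, so the Riesz representation is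
      applied to its conjugate.\<close>
    have "\<exists>h\<in>H. (\<forall>g\<in>H. cnj (D (q n) (off p n g)) = ip g h) \<and> nrm h \<le> 2 * d n"
    proof (rule Riesz_representation[of "\<lambda>g. cnj (D (q n) (off p n g))" "2 * d n"])
      fix f g assume fg: "f \<in> H" "g \<in> H"
      show "cnj (D (q n) (off p n (\<lambda>x. f x + g x))) = cnj (D (q n) (off p n f)) + cnj (D (q n) (off p n g))"
        unfolding off_add[OF p fg] bsf_add_right[OF D off_H[OF p fg(1)] off_H[OF p fg(2)] qH] by simp
    next
      fix c f assume f: "f \<in> H"
      show "cnj (D (q n) (off p n (\<lambda>x. c * f x))) = c * cnj (D (q n) (off p n f))"
        unfolding off_scale bsf_scale_right[OF D off_H[OF p f] qH] by simp
    next
      fix g assume g: "g \<in> H"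
      have "cmod (D (q n) (off p n g)) \<le> 2 * d n * nrm (q n) * nrm (off p n g)" by (rule bd[OF qp off_perp[OF p g]])
      also have "\<dots> \<le> 2 * d n * 1 * nrm g"
        using d0[of n] by (intro mult_mono q1 nrm_off_le[OF p g]) auto
      finally show "cmod (cnj (D (q n) (off p n g))) \<le> 2 * d n * nrm g" by simp
    next
      show "0 \<le> 2 * d n" using d0[of n] by simp
    qed blast
    then obtain h where h: "h \<in> H" "\<And>g. g \<in> H \<Longrightarrow> cnj (D (q n) (off p n g)) = ip g h" "nrm h \<le> 2 * d n" by blast
    have "D (q n) (off p n g) = ip h g" if "g \<in> H" for g
      using h(2)[OF that] ip_cnj[of h g] complex_cnj_cnj by metis
    then show ?thesis using h by blast
  qed
  then obtain h where h: "\<And>n. h n \<in> H" "\<And>n g. g \<in> H \<Longrightarrow> D (q n) (off p n g) = ip (h n) g" "\<And>n. nrm (h n) \<le> 2 * d n"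
    by metis
  \<comment> \<open>Here the first argument is orthogonal to one vector more than the greedy bound
    at stage \<open>n\<close> requires.\<close>
  have "\<exists>k. k \<in> H \<and> (\<forall>f\<in>H. D (off q (Suc n) f) (p n) = ip f k) \<and> nrm k \<le> 2 * d n" for n
  proof (rule Riesz_representation[of "\<lambda>f. D (off q (Suc n) f) (p n)" "2 * d n"])
    fix f g assume fg: "f \<in> H" "g \<in> H"
    show "D (off q (Suc n) (\<lambda>x. f x + g x)) (p n) = D (off q (Suc n) f) (p n) + D (off q (Suc n) g) (p n)"
      unfolding off_add[OF q fg] by (rule bsf_add_left[OF D off_H[OF q fg(1)] off_H[OF q fg(2)] pH])
  next
    fix c f assume f: "f \<in> H"
    show "D (off q (Suc n) (\<lambda>x. c * f x)) (p n) = c * D (off q (Suc n) f) (p n)"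
      unfolding off_scale by (rule bsf_scale_left[OF D off_H[OF q f] pH])
  next
    fix f assume f: "f \<in> H"
    have "cmod (D (off q (Suc n) f) (p n)) \<le> 2 * d n * nrm (off q (Suc n) f) * nrm (p n)"
      by (rule bd[OF perp_antimono[OF off_perp[OF q f]] pp]) simp
    also have "\<dots> \<le> 2 * d n * nrm f * 1"
      using d0[of n] by (intro mult_mono p1 nrm_off_le[OF q f] mult_left_mono) auto
    finally show "cmod (D (off q (Suc n) f) (p n)) \<le> 2 * d n * nrm f" by simp
  next
    show "0 \<le> 2 * d n" using d0[of n] by simp
  qed blast
  then obtain k where k: "\<And>n. k n \<in> H" "\<And>n f. f \<in> H \<Longrightarrow> D (off q (Suc n) f) (p n) = ip f (k n)" "\<And>n. nrm (k n) \<le> 2 * d n"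
    by metis
  define F1 where "F1 n = (\<lambda>x. of_real (1 / sqrt (d n)) * h n x)" for n
  define G1 where "G1 n = (\<lambda>x. of_real (sqrt (d n)) * q n x)" for n
  define F2 where "F2 n = (\<lambda>x. of_real (sqrt (d n)) * p n x)" for n
  define G2 where "G2 n = (\<lambda>x. of_real (1 / sqrt (d n)) * k n x)" for n
  have ssqI: "ssq F" if "\<And>n. F n \<in> H" "\<And>n. (nrm (F n))\<^sup>2 \<le> 4 * d n" for F
    unfolding ssq_def
  proof (intro conjI allI that(1))
    show "summable (\<lambda>n. (nrm (F n))\<^sup>2)"
      by (rule summable_comparison_test'[OF summable_mult[OF ds, of 4], where N=0]) (use that(2) in simp)
  qed
  have le4: "x \<le> 4 * d n" if "x \<le> d n" for x n using that d0[of n] by simp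
  have s: "ssq F1" "ssq G1" "ssq F2" "ssq G2"
    unfolding F1_def G1_def F2_def G2_def
    by (intro ssqI H_scale h(1) qH pH k(1) rescale_rank_one(1)[OF d0 h(1) h(3) q1 H_zero]
        rescale_rank_one(1)[OF d0 k(1) k(3) p1 H_zero] le4 rescale_rank_one(2)[OF d0 h(1) h(3) q1 H_zero]
        rescale_rank_one(2)[OF d0 k(1) k(3) p1 H_zero])+
  obtain F G where FG: "ssq F" "ssq G" "\<And>t. t \<in> bsf \<Longrightarrow> psum F G t = psum F1 G1 t + psum F2 G2 t"
    using psum_interleave[OF s(1,2,3,4)] by metis
  have "D f g = psum F G (rk g f)" if f: "f \<in> H" and g: "g \<in> H" for f g
  proof -
    have t1: "rk g f (F1 n) (G1 n) = ip f (q n) * D (q n) (off p n g)" for n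
      unfolding rk_def h(2)[OF g] using ssq_H[OF s(1), of n] ssq_H[OF s(2), of n]
        rescale_rank_one(3)[OF d0[of n] h(1)[of n] h(3)[of n] q1[of n] g, of f] by (simp add: F1_def G1_def)
    have t2: "rk g f (F2 n) (G2 n) = cnj (ip g (p n)) * D (off q (Suc n) f) (p n)" for n
      unfolding rk_def k(2)[OF f] using ssq_H[OF s(3), of n] ssq_H[OF s(4), of n]
        rescale_rank_one(4)[OF d0[of n] k(1)[of n] k(3)[of n] p1[of n] f, of g] ip_cnj[of "p n" g] by (simp add: F2_def G2_def)
    \<comment> \<open>The remainder of the telescope lives on the complements of stage
      \<open>N\<close>, where the greedy bound has the factor \<open>2 * d N\<close>, and
      summability sends \<open>d\<close> to zero.\<close>
    have "(\<lambda>N. D (off q N f) (off p N g)) \<longlonglongrightarrow> 0"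
    proof (rule Lim_null_comparison)
      show "\<forall>\<^sub>F N in sequentially. cmod (D (off q N f) (off p N g)) \<le> d N * (2 * nrm f * nrm g)"
      proof (intro always_eventually allI)
        fix N
        have "cmod (D (off q N f) (off p N g)) \<le> 2 * d N * nrm (off q N f) * nrm (off p N g)"
          by (rule bd[OF off_perp[OF q f] off_perp[OF p g]])
        also have "\<dots> \<le> 2 * d N * nrm f * nrm g"
          using d0[of N] by (intro mult_mono nrm_off_le[OF q f] nrm_off_le[OF p g] mult_left_mono) auto
        finally show "cmod (D (off q N f) (off p N g)) \<le> d N * (2 * nrm f * nrm g)" by (simp add: mult_ac)
      qed
      show "(\<lambda>N. d N * (2 * nrm f * nrm g)) \<longlonglongrightarrow> 0"
        using tendsto_mult_right[OF summable_LIMSEQ_zero[OF ds], of "2 * nrm f * nrm g"] by simp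
    qed
    then have "(\<lambda>N. D f g - D (off q N f) (off p N g)) \<longlonglongrightarrow> D f g - 0" by (intro tendsto_intros)
    moreover have "D f g - D (off q N f) (off p N g) = (\<Sum>n<N. rk g f (F1 n) (G1 n) + rk g f (F2 n) (G2 n))" for N
      unfolding t1 t2 using telescope_off[OF D q p f g, of N] by simp
    ultimately have "(\<lambda>n. rk g f (F1 n) (G1 n) + rk g f (F2 n) (G2 n)) sums D f g"
      unfolding sums_def by simp
    moreover have "(\<lambda>n. rk g f (F1 n) (G1 n) + rk g f (F2 n) (G2 n)) sums (psum F1 G1 (rk g f) + psum F2 G2 (rk g f))"
      unfolding psum_def by (intro sums_add summable_sums psum_summable s rk_bsf f g)
    ultimately show ?thesis using sums_unique2 FG(3)[OF rk_bsf[OF g f]] by metis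
  qed
  from that[OF FG(1,2) this] show ?thesis .
qed

section \<open>The theorem for forms\<close>

lemma APX_vsubspace: "vsubspace APX"
  unfolding vsubspace_def vadd_def vscl_def
proof (intro conjI ballI allI APX_add APX_scale)
  show "APX \<noteq> {}" using FR_APX[OF FR_zero] by (rule ex_in_conv[THEN iffD1, OF exI])
qed

text \<open>The quotient seminorm modulo \<open>W\<close>. As the gauge in the Hahn-Banach theorem
  it makes the functional vanish on \<open>W\<close> automatically.\<close>

definition form_dist :: "'a form set \<Rightarrow> 'a form \<Rightarrow> real" where
  "form_dist W t = Inf {C. \<exists>w\<in>W. form_bound (\<lambda>f g. t f g - w f g) C}"

context
  fixes W assumes W: "form_subspace W"
begin

lemma form_dist_bdd: "bdd_below {C. \<exists>w\<in>W. form_bound (\<lambda>f g. t f g - w f g) C}"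
  by (rule bdd_belowI[of _ 0]) (auto dest: form_bound_nonneg)

lemma form_dist_le: "w \<in> W \<Longrightarrow> form_bound (\<lambda>f g. t f g - w f g) C \<Longrightarrow> form_dist W t \<le> C"
  unfolding form_dist_def by (intro cInf_lower form_dist_bdd CollectI bexI)

lemma form_dist_le_bound: "form_bound t C \<Longrightarrow> form_dist W t \<le> C"
  using form_dist_le[of "\<lambda>f g. 0" t C] W by (simp add: form_subspace_def)

lemma form_dist_ge:
  assumes "t \<in> bsf" "\<And>w C. w \<in> W \<Longrightarrow> form_bound (\<lambda>f g. t f g - w f g) C \<Longrightarrow> b \<le> C"
  shows "b \<le> form_dist W t"
  unfolding form_dist_def
proof (rule cInf_greatest)
  obtain C where "form_bound t C" using assms(1) by (rule bsf_boundE)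
  then have "form_bound (\<lambda>f g. t f g - 0) C" by simp
  moreover have "(\<lambda>f g. 0) \<in> W" using W by (simp add: form_subspace_def)
  ultimately have "C \<in> {C. \<exists>w\<in>W. form_bound (\<lambda>f g. t f g - w f g) C}" by (intro CollectI bexI[of _ "\<lambda>f g. 0"])
  then show "{C. \<exists>w\<in>W. form_bound (\<lambda>f g. t f g - w f g) C} \<noteq> {}" by blast
qed (use assms(2) in blast)

lemma form_dist_add:
  assumes s: "s \<in> bsf" and t: "t \<in> bsf"
  shows "form_dist W (vadd s t) \<le> form_dist W s + form_dist W t"
proof -
  have *: "form_dist W (vadd s t) \<le> C + D"
    if "v \<in> W" "form_bound (\<lambda>f g. s f g - v f g) C" "w \<in> W" "form_bound (\<lambda>f g. t f g - w f g) D" for v w C D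
  proof (rule form_dist_le[of "\<lambda>f g. v f g + w f g"])
    show "(\<lambda>f g. v f g + w f g) \<in> W" using W that by (simp add: form_subspace_def)
    show "form_bound (\<lambda>f g. vadd s t f g - (v f g + w f g)) (C + D)"
      using form_bound_add[OF that(2,4)] by (simp add: vadd_def algebra_simps)
  qed
  have "form_dist W (vadd s t) - form_dist W t \<le> form_dist W s"
  proof (rule form_dist_ge[OF s])
    fix v C assume v: "v \<in> W" "form_bound (\<lambda>f g. s f g - v f g) C"
    have "form_dist W (vadd s t) - C \<le> form_dist W t"
    proof (rule form_dist_ge[OF t])
      fix w D assume "w \<in> W" "form_bound (\<lambda>f g. t f g - w f g) D"
      from *[OF v this] show "form_dist W (vadd s t) - C \<le> D" by simp
    qed
    then show "form_dist W (vadd s t) - form_dist W t \<le> C" by simp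
  qed
  then show ?thesis by simp
qed

lemma form_dist_nonneg: "t \<in> bsf \<Longrightarrow> 0 \<le> form_dist W t"
  by (rule form_dist_ge) (auto dest: form_bound_nonneg)

lemma form_dist_scl:
  assumes t: "t \<in> bsf" shows "form_dist W (vscl c t) = cmod c * form_dist W t"
proof -
  have le: "form_dist W (vscl c t) \<le> cmod c * form_dist W t" if t: "t \<in> bsf" and c: "c \<noteq> 0" for c t
  proof -
    have "form_dist W (vscl c t) / cmod c \<le> form_dist W t"
    proof (rule form_dist_ge[OF t])
      fix w C assume w: "w \<in> W" "form_bound (\<lambda>f g. t f g - w f g) C"
      have "form_dist W (vscl c t) \<le> cmod c * C"
      proof (rule form_dist_le[of "\<lambda>f g. c * w f g"])
        show "(\<lambda>f g. c * w f g) \<in> W" using W w(1) by (simp add: form_subspace_def)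
        show "form_bound (\<lambda>f g. vscl c t f g - c * w f g) (cmod c * C)"
          using form_bound_scale[OF w(2), of c] by (simp add: vscl_def algebra_simps)
      qed
      then show "form_dist W (vscl c t) / cmod c \<le> C" using c by (simp add: field_simps)
    qed
    then show ?thesis using c by (simp add: field_simps)
  qed
  show ?thesis
  proof (cases "c = 0")
    case True
    have "form_dist W (\<lambda>f g. 0) \<le> 0" by (rule form_dist_le_bound[OF form_bound_zero])
    then show ?thesis using True form_dist_nonneg[OF bsf_zero] by (simp add: vscl_zero)
  next
    case False
    have "form_dist W (vscl (1 / c) (vscl c t)) \<le> cmod (1 / c) * form_dist W (vscl c t)"
      using False by (intro le) (auto simp: vscl_def bsf_scale t)
    then have "form_dist W t \<le> form_dist W (vscl c t) / cmod c"
      using False by (simp add: vscl_vscl vscl_one norm_divide)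
    then show ?thesis using le[OF t False] False by (simp add: field_simps)
  qed
qed

end

text \<open>Duality of compact and trace class operators. The values on rank one forms make up a
  form \<open>D\<close>; testing the functional on suitable contractions bounds its trace norm, so
  \<open>D\<close> is nuclear. Agreement then spreads from rank one forms by density.\<close>

lemma bounded_functional_is_psum:
  assumes add: "\<And>s t. s \<in> APX \<Longrightarrow> t \<in> APX \<Longrightarrow> \<phi> (vadd s t) = \<phi> s + \<phi> t"
    and scl: "\<And>c t. t \<in> APX \<Longrightarrow> \<phi> (vscl c t) = c * \<phi> t"
    and bd: "\<And>t C. t \<in> APX \<Longrightarrow> form_bound t C \<Longrightarrow> cmod (\<phi> t) \<le> C"
  obtains F G where "ssq F" "ssq G" "\<And>t. t \<in> APX \<Longrightarrow> \<phi> t = psum F G t"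
proof -
  have rkA: "rk p q \<in> APX" if "p \<in> H" "q \<in> H" for p q by (intro FR_APX FR_rk that)
  \<comment> \<open>\<open>rk g f\<close> is linear in \<open>f\<close> and conjugate linear in
    \<open>g\<close>; the swapped order makes \<open>D\<close> sesquilinear in the right
    arguments.\<close>
  define D where "D = (\<lambda>f g. if f \<in> H \<and> g \<in> H then \<phi> (rk g f) else 0)"
  have D: "D \<in> bsf"
  proof (rule bsfI[where C=1])
    fix f g h and c :: complex assume f: "f \<in> H" and h: "h \<in> H"
    have "rk h (\<lambda>x. c * f x) = vscl c (rk h f)" "rk (\<lambda>x. c * f x) h = vscl (cnj c) (rk f h)"
      by (auto simp: rk_def vscl_def ip_scale_left ip_scale_right fun_eq_iff)
    then show "D (\<lambda>x. c * f x) h = c * D f h" "D h (\<lambda>x. c * f x) = cnj c * D h f"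
      using f h H_scale[OF f, of c] by (auto simp: D_def scl rkA simp del: H_scale)
    assume g: "g \<in> H"
    have "rk h (\<lambda>x. f x + g x) = vadd (rk h f) (rk h g)" "rk (\<lambda>x. f x + g x) h = vadd (rk f h) (rk g h)"
      using f g by (auto simp: rk_def vadd_def ip_add_left ip_add_right fun_eq_iff algebra_simps)
    then show "D (\<lambda>x. f x + g x) h = D f h + D g h" "D h (\<lambda>x. f x + g x) = D h f + D h g"
      using f g h H_add[OF f g] by (auto simp: D_def add rkA simp del: H_add)
  next
    show "form_bound D 1" unfolding form_bound_def
    proof (intro conjI ballI)
      fix f g assume fg: "f \<in> H" "g \<in> H"
      show "cmod (D f g) \<le> 1 * nrm f * nrm g"
        using bd[OF rkA[OF fg(2,1)] rk_bound[OF fg(2,1)]] fg by (simp add: D_def mult.commute)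
    qed simp
  qed (auto simp: D_def)
  have trace: "(\<Sum>n<N. cmod (D (q n) (p n))) \<le> 1" if q: "onz q N" and p: "onz p N" for N q p
  proof -
    \<comment> \<open>With these phases the functional maps the form \<open>S N\<close> to the sum
      of the moduli, while Bessel's inequality for both systems makes \<open>S N\<close> a
      contraction.\<close>
    define c where "c n = (if D (q n) (p n) = 0 then 1 else cnj (D (q n) (p n)) / of_real (cmod (D (q n) (p n))))" for n
    have c: "cmod (c n) = 1" "c n * D (q n) (p n) = of_real (cmod (D (q n) (p n)))" for n
      by (auto simp: c_def norm_divide complex_norm_square[symmetric] mult.commute power2_eq_square)
    define S where "S K = (\<lambda>f g. \<Sum>n<K. c n * rk (p n) (q n) f g)" for K
    have qH: "q n \<in> H" and pH: "p n \<in> H" if "n < N" for n using onz_H[OF q that] onz_H[OF p that] by auto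
    have S: "S K \<in> APX \<and> \<phi> (S K) = (\<Sum>n<K. of_real (cmod (D (q n) (p n))))" if "K \<le> N" for K
      using that
    proof (induction K)
      case 0
      have "\<phi> (vscl 0 (\<lambda>f g. 0)) = 0" using scl[OF FR_APX[OF FR_zero], of 0] by simp
      then show ?case using FR_APX[OF FR_zero] by (simp add: S_def vscl_zero)
    next
      case (Suc K)
      then have K: "K < N" and IH: "S K \<in> APX" "\<phi> (S K) = (\<Sum>n<K. of_real (cmod (D (q n) (p n))))" by auto
      have r: "rk (p K) (q K) \<in> APX" by (rule rkA[OF pH[OF K] qH[OF K]])
      have r': "vscl (c K) (rk (p K) (q K)) \<in> APX" unfolding vscl_def by (rule APX_scale[OF r])
      have e: "S (Suc K) = vadd (S K) (vscl (c K) (rk (p K) (q K)))" by (simp add: S_def vadd_def vscl_def)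
      have "\<phi> (rk (p K) (q K)) = D (q K) (p K)" using qH[OF K] pH[OF K] by (simp add: D_def)
      then have "\<phi> (S (Suc K)) = \<phi> (S K) + of_real (cmod (D (q K) (p K)))"
        unfolding e using add[OF IH(1) r'] scl[OF r] c(2)[of K] by simp
      moreover have "S (Suc K) \<in> APX" unfolding e using APX_add[OF IH(1) r'] by (simp add: vadd_def)
      ultimately show ?case using IH(2) by simp
    qed
    have "form_bound (S N) 1" unfolding form_bound_def
    proof (intro conjI ballI)
      fix f g assume f: "f \<in> H" and g: "g \<in> H"
      have "cmod (S N f g) \<le> (\<Sum>n<N. cmod (c n * rk (p n) (q n) f g))" unfolding S_def by (rule norm_sum)
      also have "\<dots> = (\<Sum>n<N. cmod (ip f (p n)) * cmod (ip g (q n)))"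
        using f g c(1) ip_cnj[of _ g] by (simp add: rk_def norm_mult)
      also have "\<dots> \<le> L2_set (\<lambda>n. cmod (ip f (p n))) {..<N} * L2_set (\<lambda>n. cmod (ip g (q n))) {..<N}"
        using L2_set_mult_ineq[of "\<lambda>n. cmod (ip f (p n))" "\<lambda>n. cmod (ip g (q n))" "{..<N}"] by simp
      also have "\<dots> \<le> nrm f * nrm g"
        by (intro mult_mono Bessel_L2_set[OF p f] Bessel_L2_set[OF q g]) auto
      finally show "cmod (S N f g) \<le> 1 * nrm f * nrm g" by simp
    qed simp
    then have "cmod (\<phi> (S N)) \<le> 1" using bd S[OF order_refl] by blast
    moreover have "\<phi> (S N) = of_real (\<Sum>n<N. cmod (D (q n) (p n)))" using S[OF order_refl] by simp
    ultimately show ?thesis by (simp add: sum_nonneg del: of_real_sum)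
  qed
  obtain F G where F: "ssq F" and G: "ssq G" and rep: "\<And>f g. f \<in> H \<Longrightarrow> g \<in> H \<Longrightarrow> D f g = psum F G (rk g f)"
    using nuclear_decomposition[OF D trace] by metis
  have rk: "\<phi> (rk p q) = psum F G (rk p q)" if "p \<in> H" "q \<in> H" for p q
    using rep[OF that(2,1)] that by (simp add: D_def)
  have FR: "\<phi> s = psum F G s" if "s \<in> FR" for s using that
  proof (induction rule: FR.induct)
    case FR_zero
    have "\<phi> (vscl 0 (\<lambda>f g. 0)) = 0" using scl[OF FR_APX[OF FR.FR_zero], of 0] by simp
    then show ?case by (simp add: psum_def vscl_zero)
  next
    case (FR_step t p q)
    have "\<phi> (vadd (rk p q) t) = \<phi> (rk p q) + \<phi> t" by (rule add[OF rkA[OF FR_step.hyps(2,3)] FR_APX[OF FR_step.hyps(1)]])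
    then show ?case
      using FR_step.IH rk[OF FR_step.hyps(2,3)] psum_add[OF F G rk_bsf[OF FR_step.hyps(2,3)] FR_bsf[OF FR_step.hyps(1)]]
      by (simp add: vadd_def)
  qed
  define K where "K = (\<Sum>n. (nrm (F n))\<^sup>2 + (nrm (G n))\<^sup>2)"
  have K: "K \<ge> 0" unfolding K_def using F G by (intro suminf_nonneg summable_add) (auto simp: ssq_def)
  have "\<phi> t = psum F G t" if t: "t \<in> APX" for t
  proof -
    have "cmod (\<phi> t - psum F G t) \<le> e" if e: "e > 0" for e
    proof -
      \<comment> \<open>The error is bounded by the approximation bound for the functional plus
        \<open>K\<close> times that bound for the series, together \<open>e\<close>.\<close>
      have e': "e / (1 + K) > 0" using e K by simp
      obtain s where s: "s \<in> FR" and sb: "form_bound (\<lambda>f g. t f g - s f g) (e / (1 + K))" by (rule APX_E[OF t e'])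
      have d: "(\<lambda>f g. t f g - s f g) \<in> APX"
        using APX_add[OF t APX_scale[OF FR_APX[OF s], of "-1"]] by simp
      have "vadd (\<lambda>f g. t f g - s f g) s = t" by (simp add: vadd_def)
      then have "\<phi> t = \<phi> (\<lambda>f g. t f g - s f g) + \<phi> s" using add[OF d FR_APX[OF s]] by simp
      moreover have "psum F G (\<lambda>f g. t f g - s f g) = psum F G t - psum F G s"
        by (rule psum_diff[OF F G APX_bsf[OF t] FR_bsf[OF s]])
      ultimately have "\<phi> t - psum F G t = \<phi> (\<lambda>f g. t f g - s f g) - psum F G (\<lambda>f g. t f g - s f g)"
        using FR[OF s] by simp
      then have "cmod (\<phi> t - psum F G t) \<le> cmod (\<phi> (\<lambda>f g. t f g - s f g)) + cmod (psum F G (\<lambda>f g. t f g - s f g))"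
        by (simp only: norm_triangle_ineq4)
      moreover have "cmod (\<phi> (\<lambda>f g. t f g - s f g)) \<le> e / (1 + K)" by (rule bd[OF d sb])
      moreover have "cmod (psum F G (\<lambda>f g. t f g - s f g)) \<le> e / (1 + K) * K"
        unfolding K_def using psum_bound(3)[OF F G sb] unfolding K_def .
      moreover have "e / (1 + K) + e / (1 + K) * K = e / (1 + K) * (1 + K)" by (simp add: distrib_left)
      then have "e / (1 + K) + e / (1 + K) * K = e" using K by simp
      ultimately show ?thesis by linarith
    qed
    then have "cmod (\<phi> t - psum F G t) \<le> 0" by (rule field_le_epsilon) simp
    then show ?thesis by simp
  qed
  from that[OF F G this] show ?thesis .
qed

text \<open>The Hahn-Banach functional attains the distance of \<open>t\<close> from
  \<open>W\<close>, which is at least \<open>e\<close>, and vanishes on \<open>W\<close>, whose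
  elements have distance zero.\<close>

lemma APX_separation:
  assumes W: "form_subspace W" "W \<subseteq> APX" and t: "t \<in> APX" and e: "e > 0"
    and far: "\<And>w. w \<in> W \<Longrightarrow> \<not> form_bound (\<lambda>f g. t f g - w f g) e"
  obtains F G where "ssq F" "ssq G" "kills F G W" "psum F G t \<noteq> 0"
proof -
  obtain \<phi> where add: "\<And>s t. s \<in> APX \<Longrightarrow> t \<in> APX \<Longrightarrow> \<phi> (vadd s t) = \<phi> s + \<phi> t"
    and scl: "\<And>c t. t \<in> APX \<Longrightarrow> \<phi> (vscl c t) = c * \<phi> t"
    and le: "\<And>t. t \<in> APX \<Longrightarrow> cmod (\<phi> t) \<le> form_dist W t" and ge: "form_dist W t \<le> Re (\<phi> t)"
    using Hahn_Banach_complex[OF APX_vsubspace form_dist_add[OF W(1) APX_bsf APX_bsf] form_dist_scl[OF W(1) APX_bsf] t]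
    by metis
  have "e \<le> form_dist W t"
  proof (rule form_dist_ge[OF W(1) APX_bsf[OF t]])
    fix w C assume w: "w \<in> W" "form_bound (\<lambda>f g. t f g - w f g) C"
    show "e \<le> C" using far[OF w(1)] form_bound_mono[OF w(2), of e] by linarith
  qed
  then have ne: "\<phi> t \<noteq> 0" using ge e by auto
  obtain F G where F: "ssq F" "ssq G" and eq: "\<And>t. t \<in> APX \<Longrightarrow> \<phi> t = psum F G t"
    using bounded_functional_is_psum[OF add scl order_trans[OF le form_dist_le_bound[OF W(1)]]] by metis
  have "kills F G W" unfolding kills_def
  proof
    fix w assume w: "w \<in> W"
    have "form_bound (\<lambda>f g. w f g - w f g) 0" by (simp add: form_bound_zero)
    then have "form_dist W w \<le> 0" by (rule form_dist_le[OF W(1) w])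
    moreover have "w \<in> APX" using w W(2) by blast
    ultimately have "cmod (\<phi> w) \<le> 0" using le[of w] by linarith
    then show "psum F G w = 0" using eq[OF \<open>w \<in> APX\<close>] by simp
  qed
  moreover have "psum F G t \<noteq> 0" using ne eq[OF t] by simp
  ultimately show ?thesis using that F by blast
qed

text \<open>Separation of \<open>t\<close> from the sum of the compact parts, truncation of the
  separating functional, and \<open>nice_annihilates_weak_sum\<close> contradict each other.\<close>

theorem compact_form_in_norm_closure:
  assumes U: "form_bimodule U" "reflexive U" and V: "form_bimodule V" "reflexive V"
    and UV: "\<And>r. r \<in> U \<Longrightarrow> r \<in> V \<Longrightarrow> r \<in> APX \<Longrightarrow> r = (\<lambda>f g. 0)"
    and t: "weakly_in_sum t U V" "t \<in> APX" and e: "e > 0"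
  shows "\<exists>u\<in>U \<inter> APX. \<exists>v\<in>V \<inter> APX. form_bound (\<lambda>f g. t f g - (u f g + v f g)) e"
proof (rule ccontr)
  assume neg: "\<not> ?thesis"
  define W where "W = {(\<lambda>f g. u f g + v f g) | u v. u \<in> U \<inter> APX \<and> v \<in> V \<inter> APX}"
  have WI: "(\<lambda>f g. u f g + v f g) \<in> W" if "u \<in> U \<inter> APX" "v \<in> V \<inter> APX" for u v
    unfolding W_def using that by blast
  have WE: "\<exists>u\<in>U \<inter> APX. \<exists>v\<in>V \<inter> APX. w = (\<lambda>f g. u f g + v f g)" if "w \<in> W" for w
    using that unfolding W_def by blast
  have sub: "(\<lambda>f g. 0) \<in> U \<inter> APX" "\<And>s t. s \<in> U \<inter> APX \<Longrightarrow> t \<in> U \<inter> APX \<Longrightarrow> (\<lambda>f g. s f g + t f g) \<in> U \<inter> APX"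
    "\<And>c t. t \<in> U \<inter> APX \<Longrightarrow> (\<lambda>f g. c * t f g) \<in> U \<inter> APX"
    "\<And>t a b. t \<in> U \<inter> APX \<Longrightarrow> a \<in> BM \<Longrightarrow> b \<in> BM \<Longrightarrow> mlt a b t \<in> U \<inter> APX" if "form_bimodule U" for U
    using that FR_APX[OF FR_zero] APX_add APX_scale mlt_APX unfolding form_bimodule_def form_subspace_def by simp_all
  have Wsub: "form_subspace W" unfolding form_subspace_def
  proof (intro conjI ballI allI subsetI)
    fix w assume "w \<in> W"
    then obtain u v where uv: "u \<in> U \<inter> APX" "v \<in> V \<inter> APX" and w: "w = (\<lambda>f g. u f g + v f g)" using WE by blast
    show "w \<in> bsf" unfolding w by (intro bsf_add APX_bsf) (use uv in auto)
    show "(\<lambda>f g. c * w f g) \<in> W" for c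
      unfolding w distrib_left by (intro WI sub(3)[OF U(1)] sub(3)[OF V(1)] uv)
    fix w' assume "w' \<in> W"
    then obtain u' v' where uv': "u' \<in> U \<inter> APX" "v' \<in> V \<inter> APX" and w': "w' = (\<lambda>f g. u' f g + v' f g)" using WE by blast
    have "(\<lambda>f g. (u f g + u' f g) + (v f g + v' f g)) \<in> W"
      by (intro WI sub(2)[OF U(1)] sub(2)[OF V(1)] uv uv')
    then show "(\<lambda>f g. w f g + w' f g) \<in> W" unfolding w w' by (simp add: algebra_simps)
  next
    show "(\<lambda>f g. 0) \<in> W" using WI[OF sub(1)[OF U(1)] sub(1)[OF V(1)]] by simp
  qed
  \<comment> \<open>Invariance under multiplication by bounded functions is what lets the functional
    be truncated without losing annihilation of \<open>W\<close>.\<close>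
  have "form_bimodule W" unfolding form_bimodule_def
  proof (intro conjI ballI Wsub)
    fix w a b assume "w \<in> W" and a: "a \<in> BM" and b: "b \<in> BM"
    then obtain u v where uv: "u \<in> U \<inter> APX" "v \<in> V \<inter> APX" and w: "w = (\<lambda>f g. u f g + v f g)" using WE by blast
    have "mlt a b w = (\<lambda>f g. mlt a b u f g + mlt a b v f g)" unfolding w mlt_def by (intro ext) simp
    then show "mlt a b w \<in> W" using WI[OF sub(4)[OF U(1) uv(1) a b] sub(4)[OF V(1) uv(2) a b]] by simp
  qed
  have "W \<subseteq> APX" using WE APX_add by blast
  moreover have "\<not> form_bound (\<lambda>f g. t f g - w f g) e" if "w \<in> W" for w
    using WE[OF that] neg by blast
  ultimately obtain F G where "ssq F" "ssq G" "kills F G W" "psum F G t \<noteq> 0"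
    using APX_separation[OF Wsub _ t(2) e] by metis
  from nice_separation[OF \<open>form_bimodule W\<close> this(1-3) APX_bsf[OF t(2)] this(4)]
  obtain m A F G where F: "nice m A F" and G: "nice m A G" and k: "kills F G W" and ne: "psum F G t \<noteq> 0" .
  \<comment> \<open>Each summand sits in the sum because the other contains zero.\<close>
  have "U \<inter> APX \<subseteq> W" using WI[OF _ sub(1)[OF V(1)]] by auto
  moreover have "V \<inter> APX \<subseteq> W" using WI[OF sub(1)[OF U(1)]] by auto
  ultimately have "kills F G (U \<inter> APX)" "kills F G (V \<inter> APX)" using k unfolding kills_def by blast+
  then show False using nice_annihilates_weak_sum[OF U V F G _ _ UV t] ne by blast
qed

section \<open>Operators and their forms\<close>

text \<open>The operator acting on functions through a chosen representative of the result. It is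
  linear only almost everywhere, so its algebraic rules are stated after pairing with a
  vector.\<close>

definition app :: "'a l2op \<Rightarrow> ('a \<Rightarrow> complex) \<Rightarrow> 'a \<Rightarrow> complex" where
  "app T f = l2_rep (T (ae_class M f))"

definition frm :: "'a l2op \<Rightarrow> 'a form" where
  "frm T = (\<lambda>f g. if f \<in> H \<and> g \<in> H then ip (app T f) g else 0)"

lemma rep_H: "u \<in> L2 M \<Longrightarrow> l2_rep u \<in> H"
  by (rule l2_rep_mem)

lemma l2_inner_eq: "l2_inner M u v = ip (l2_rep u) (l2_rep v)"
  by (simp add: l2_inner_def ip_def)

lemma l2_norm_eq: "l2_norm M u = nrm (l2_rep u)"
  by (simp add: l2_norm_def nrm_def)

lemma l2_dist_eq: "l2_dist M u v = nrm (\<lambda>x. l2_rep u x - l2_rep v x)"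
  by (simp add: l2_dist_def nrm_def)

lemma rep_class_AE: "f \<in> H \<Longrightarrow> AE x in M. l2_rep (ae_class M f) x = f x"
  by (rule l2_rep_ae_class)

lemma rep_class_H: "f \<in> H \<Longrightarrow> l2_rep (ae_class M f) \<in> H"
  by (intro rep_H ae_class_in_L2)

lemma l2_norm_class: "f \<in> H \<Longrightarrow> l2_norm M (ae_class M f) = nrm f"
  unfolding l2_norm_eq using rep_class_AE rep_class_H by (intro nrm_cong_AE) (auto intro: H_measurable)

lemma ip_rep_class: "h \<in> H \<Longrightarrow> g \<in> H \<Longrightarrow> ip h (l2_rep (ae_class M g)) = ip h g"
  by (intro ip_cong_AE rep_class_H rep_class_AE) auto

lemma l2_add_class:
  assumes f: "f \<in> H" and g: "g \<in> H"
  shows "l2_add M (ae_class M f) (ae_class M g) = ae_class M (\<lambda>x. f x + g x)"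
  unfolding l2_add_def
proof (rule ae_class_cong)
  show "AE x in M. l2_rep (ae_class M f) x + l2_rep (ae_class M g) x = f x + g x"
    using rep_class_AE[OF f] rep_class_AE[OF g] by eventually_elim simp
qed

lemma l2_scale_class:
  assumes f: "f \<in> H" shows "l2_scale M c (ae_class M f) = ae_class M (\<lambda>x. c * f x)"
  unfolding l2_scale_def
proof (rule ae_class_cong)
  show "AE x in M. c * l2_rep (ae_class M f) x = c * f x"
    using rep_class_AE[OF f] by eventually_elim simp
qed

lemma class_eqI:
  assumes "f \<in> H" "g \<in> H" "\<And>h. h \<in> H \<Longrightarrow> ip f h = ip g h"
  shows "ae_class M f = ae_class M g"
proof (rule ae_class_cong)
  have d: "(\<lambda>x. f x - g x) \<in> H" using assms by simp
  have "ip (\<lambda>x. f x - g x) (\<lambda>x. f x - g x) = 0"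
    using ip_diff_left[OF assms(1,2) d] assms(3)[OF d] by simp
  then have "nrm (\<lambda>x. f x - g x) = 0" by (simp add: ip_self)
  then show "AE x in M. f x = g x" using nrm_eq_0_iff[OF d] by simp
qed

lemma L2_eqI:
  assumes "u \<in> L2 M" "v \<in> L2 M" "\<And>h. h \<in> H \<Longrightarrow> ip (l2_rep u) h = ip (l2_rep v) h"
  shows "u = v"
  using class_eqI[OF rep_H[OF assms(1)] rep_H[OF assms(2)] assms(3)] assms(1,2) by (simp add: ae_class_l2_rep)

lemma bounded_opsD:
  assumes "T \<in> bounded_ops M"
  shows "T \<in> L2 M \<rightarrow>\<^sub>E L2 M" "\<And>u v. u \<in> L2 M \<Longrightarrow> v \<in> L2 M \<Longrightarrow> T (l2_add M u v) = l2_add M (T u) (T v)"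
    "\<And>c u. u \<in> L2 M \<Longrightarrow> T (l2_scale M c u) = l2_scale M c (T u)"
  using assms unfolding bounded_ops_def by simp_all

lemma app_H: "T \<in> bounded_ops M \<Longrightarrow> f \<in> H \<Longrightarrow> app T f \<in> H"
  unfolding app_def by (rule rep_H[OF bounded_ops_mem[OF _ ae_class_in_L2]])

lemma app_bound: assumes "T \<in> bounded_ops M"
  obtains C where "C \<ge> 0" "\<And>f. f \<in> H \<Longrightarrow> nrm (app T f) \<le> C * nrm f"
proof -
  obtain C where C: "\<And>u. u \<in> L2 M \<Longrightarrow> l2_norm M (T u) \<le> C * l2_norm M u"
    using assms unfolding bounded_ops_def by blast
  show ?thesis
  proof (rule that[of "\<bar>C\<bar>"])
    fix f assume f: "f \<in> H"
    have "nrm (app T f) \<le> C * nrm f" using C[OF ae_class_in_L2[OF f]] unfolding l2_norm_class[OF f] unfolding app_def l2_norm_eq .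
    also have "\<dots> \<le> \<bar>C\<bar> * nrm f" by (intro mult_right_mono) auto
    finally show "nrm (app T f) \<le> \<bar>C\<bar> * nrm f" .
  qed simp
qed

lemma app_add_ip:
  assumes T: "T \<in> bounded_ops M" and f: "f \<in> H" and g: "g \<in> H" and h: "h \<in> H"
  shows "ip (app T (\<lambda>x. f x + g x)) h = ip (app T f) h + ip (app T g) h"
proof -
  have "AE x in M. app T (\<lambda>x. f x + g x) x = app T f x + app T g x"
    unfolding app_def l2_add_class[OF f g, symmetric] bounded_opsD(2)[OF T ae_class_in_L2[OF f] ae_class_in_L2[OF g]]
    by (intro l2_rep_add bounded_ops_mem[OF T] ae_class_in_L2 f g)
  then have "ip (app T (\<lambda>x. f x + g x)) h = ip (\<lambda>x. app T f x + app T g x) h"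
    using T f g h by (intro ip_cong_AE app_H H_add) auto
  then show ?thesis using ip_add_left[OF app_H[OF T f] app_H[OF T g] h] by simp
qed

lemma app_scale_ip:
  assumes T: "T \<in> bounded_ops M" and f: "f \<in> H" and h: "h \<in> H"
  shows "ip (app T (\<lambda>x. c * f x)) h = c * ip (app T f) h"
proof -
  have "AE x in M. app T (\<lambda>x. c * f x) x = c * app T f x"
    unfolding app_def l2_scale_class[OF f, symmetric] bounded_opsD(3)[OF T ae_class_in_L2[OF f]]
    by (intro l2_rep_scale bounded_ops_mem[OF T] ae_class_in_L2 f)
  then have "ip (app T (\<lambda>x. c * f x)) h = ip (\<lambda>x. c * app T f x) h"
    using T f h by (intro ip_cong_AE app_H H_scale) auto
  then show ?thesis by (simp add: ip_scale_left)
qed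

lemma frm_bsf: assumes T: "T \<in> bounded_ops M" shows "frm T \<in> bsf"
proof -
  obtain C where C: "C \<ge> 0" "\<And>f. f \<in> H \<Longrightarrow> nrm (app T f) \<le> C * nrm f" using app_bound[OF T] by metis
  have "form_bound (frm T) C" unfolding form_bound_def
  proof (intro conjI ballI C(1))
    fix f g assume f: "f \<in> H" and g: "g \<in> H"
    have "cmod (ip (app T f) g) \<le> nrm (app T f) * nrm g" by (rule Cauchy_Schwarz[OF app_H[OF T f] g])
    also have "\<dots> \<le> C * nrm f * nrm g" by (intro mult_right_mono C(2) f) simp
    finally show "cmod (frm T f g) \<le> C * nrm f * nrm g" using f g by (simp add: frm_def)
  qed
  then show ?thesis
  proof (rule bsfI[rotated 4])
    fix f g h and c :: complex assume f: "f \<in> H" and h: "h \<in> H"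
    show "frm T (\<lambda>x. c * f x) h = c * frm T f h" "frm T h (\<lambda>x. c * f x) = cnj c * frm T h f"
      using f h app_scale_ip[OF T f h, of c] by (simp_all add: frm_def ip_scale_right)
    assume g: "g \<in> H"
    show "frm T (\<lambda>x. f x + g x) h = frm T f h + frm T g h" "frm T h (\<lambda>x. f x + g x) = frm T h f + frm T h g"
      using f g h app_add_ip[OF T f g h] ip_add_right[OF f g app_H[OF T h]] by (simp_all add: frm_def)
  qed (auto simp: frm_def)
qed

text \<open>Only extensionality and the range are demanded, so that a map not yet known to be
  bounded can be identified with a bounded one.\<close>

lemma op_eqI:
  assumes "S \<in> extensional (L2 M)" "T \<in> extensional (L2 M)"
    "\<And>u. u \<in> L2 M \<Longrightarrow> S u \<in> L2 M" "\<And>u. u \<in> L2 M \<Longrightarrow> T u \<in> L2 M" and eq: "frm S = frm T"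
  shows "S = T"
proof (rule extensionalityI[OF assms(1,2)])
  fix u assume u: "u \<in> L2 M"
  show "S u = T u"
  proof (rule L2_eqI[OF assms(3,4)[OF u]])
    fix h assume h: "h \<in> H"
    show "ip (l2_rep (S u)) h = ip (l2_rep (T u)) h"
      using fun_cong[OF fun_cong[OF eq], of "l2_rep u" h] rep_H[OF u] h by (simp add: frm_def app_def ae_class_l2_rep[OF u])
  qed
qed

lemma bounded_ops_extensional: "T \<in> bounded_ops M \<Longrightarrow> T \<in> extensional (L2 M)"
  by (simp add: bounded_ops_def PiE_def)

lemma frm_inj: "S \<in> bounded_ops M \<Longrightarrow> T \<in> bounded_ops M \<Longrightarrow> frm S = frm T \<Longrightarrow> S = T"
  by (rule op_eqI[OF bounded_ops_extensional bounded_ops_extensional bounded_ops_mem bounded_ops_mem])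

lemma form_represent_vector:
  assumes t: "t \<in> bsf" and b: "form_bound t C" and f: "f \<in> H"
  shows "\<exists>h. h \<in> H \<and> (\<forall>g\<in>H. t f g = ip h g) \<and> nrm h \<le> C * nrm f"
proof -
  have "\<exists>h\<in>H. (\<forall>g\<in>H. cnj (t f g) = ip g h) \<and> nrm h \<le> C * nrm f"
  proof (rule Riesz_representation[of "\<lambda>g. cnj (t f g)" "C * nrm f"])
    show "cnj (t f (\<lambda>x. g x + h x)) = cnj (t f g) + cnj (t f h)" if "g \<in> H" "h \<in> H" for g h
      by (simp add: bsf_add_right[OF t that f])
    show "cnj (t f (\<lambda>x. c * g x)) = c * cnj (t f g)" if "g \<in> H" for c g
      by (simp add: bsf_scale_right[OF t that f])
    show "cmod (cnj (t f g)) \<le> C * nrm f * nrm g" if "g \<in> H" for g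
      using form_boundD[OF b f that] by simp
    show "0 \<le> C * nrm f" using form_bound_nonneg[OF b] by simp
  qed blast
  then obtain h where h: "h \<in> H" "\<And>g. g \<in> H \<Longrightarrow> cnj (t f g) = ip g h" "nrm h \<le> C * nrm f" by blast
  have "t f g = ip h g" if "g \<in> H" for g using h(2)[OF that] ip_cnj[of h g] complex_cnj_cnj by metis
  then show ?thesis using h by blast
qed

text \<open>The Riesz representation supplies the value of the operator at each function; uniqueness
  of representing vectors makes the choice linear and compatible with almost everywhere
  equality.\<close>

lemma form_represent:
  assumes t: "t \<in> bsf" obtains T where "T \<in> bounded_ops M" "frm T = t"
proof -
  obtain C where b: "form_bound t C" using t by (rule bsf_boundE)
  have "\<forall>f. \<exists>h. f \<in> H \<longrightarrow> h \<in> H \<and> (\<forall>g\<in>H. t f g = ip h g) \<and> nrm h \<le> C * nrm f"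
    using form_represent_vector[OF t b] by blast
  then obtain R where R: "\<And>f. f \<in> H \<Longrightarrow> R f \<in> H" "\<And>f g. f \<in> H \<Longrightarrow> g \<in> H \<Longrightarrow> t f g = ip (R f) g"
    "\<And>f. f \<in> H \<Longrightarrow> nrm (R f) \<le> C * nrm f" by metis
  define T where "T = (\<lambda>u\<in>L2 M. ae_class M (R (l2_rep u)))"
  \<comment> \<open>\<open>R\<close> is chosen on functions, so the value must be shown not to
    depend on the representative: equal almost everywhere arguments give the same form
    values.\<close>
  have Tc: "T (ae_class M f) = ae_class M (R f)" if f: "f \<in> H" for f
  proof -
    have "ae_class M (R (l2_rep (ae_class M f))) = ae_class M (R f)"
    proof (rule class_eqI)
      fix h assume h: "h \<in> H"
      show "ip (R (l2_rep (ae_class M f))) h = ip (R f) h"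
        unfolding R(2)[OF rep_class_H[OF f] h, symmetric] R(2)[OF f h, symmetric]
        by (rule bsf_cong_AE[OF t rep_class_H[OF f] f h h rep_class_AE[OF f]]) simp
    qed (intro R(1) rep_class_H f)+
    then show ?thesis by (simp add: T_def ae_class_in_L2[OF f])
  qed
  have "T \<in> bounded_ops M" unfolding bounded_ops_def
  proof (intro CollectI conjI ballI allI exI[of _ C])
    show "T \<in> L2 M \<rightarrow>\<^sub>E L2 M" by (auto simp: T_def ae_class_in_L2 R(1) rep_H)
    fix u assume u: "u \<in> L2 M"
    let ?f = "l2_rep u"
    have f: "?f \<in> H" by (rule rep_H[OF u])
    have uf: "u = ae_class M ?f" by (rule ae_class_l2_rep[OF u, symmetric])
    show "l2_norm M (T u) \<le> C * l2_norm M u"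
      using R(3)[OF f] Tc[OF f] uf l2_norm_class[OF R(1)[OF f]] by (simp add: l2_norm_eq[of u])
    show "T (l2_scale M c u) = l2_scale M c (T u)" for c
    proof -
      have "T (l2_scale M c (ae_class M ?f)) = l2_scale M c (T (ae_class M ?f))"
        unfolding l2_scale_class[OF f] Tc[OF f] Tc[OF H_scale[OF f]] l2_scale_class[OF R(1)[OF f]]
        by (rule class_eqI) (simp_all add: R(1) f R(2)[symmetric] ip_scale_left bsf_scale_left[OF t])
      then show ?thesis using uf by simp
    qed
    fix v assume v: "v \<in> L2 M"
    let ?g = "l2_rep v"
    have g: "?g \<in> H" by (rule rep_H[OF v])
    have vg: "v = ae_class M ?g" by (rule ae_class_l2_rep[OF v, symmetric])
    have "T (l2_add M (ae_class M ?f) (ae_class M ?g)) = l2_add M (T (ae_class M ?f)) (T (ae_class M ?g))"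
      unfolding l2_add_class[OF f g] Tc[OF f] Tc[OF g] Tc[OF H_add[OF f g]] l2_add_class[OF R(1)[OF f] R(1)[OF g]]
      by (rule class_eqI) (simp_all add: R(1) f g R(2)[symmetric] ip_add_left bsf_add_left[OF t])
    then show "T (l2_add M u v) = l2_add M (T u) (T v)" using uf vg by simp
  qed
  moreover have "frm T = t"
  proof (intro ext)
    fix f g show "frm T f g = t f g"
    proof (cases "f \<in> H \<and> g \<in> H")
      case True
      then have "ip (l2_rep (ae_class M (R f))) g = ip (R f) g"
        by (intro ip_cong_AE rep_class_H rep_class_AE R(1)) auto
      then show ?thesis using True by (simp add: frm_def app_def Tc R(2))
    qed (use bsf_outside[OF t] in \<open>auto simp: frm_def\<close>)
  qed
  ultimately show ?thesis by (rule that)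
qed

lemma frm_op_zero: "frm (op_zero M) = (\<lambda>f g. 0)"
proof (intro ext)
  fix f g
  have "ip (l2_rep (l2_zero M)) g = ip (\<lambda>x. 0) g" if "g \<in> H"
    unfolding l2_zero_def using that by (intro ip_cong_AE rep_class_H rep_class_AE) auto
  then show "frm (op_zero M) f g = 0" by (simp add: frm_def app_def op_zero_def ae_class_in_L2)
qed

lemma frm_op_add: assumes S: "S \<in> bounded_ops M" and T: "T \<in> bounded_ops M"
  shows "frm (op_add M S T) = (\<lambda>f g. frm S f g + frm T f g)"
proof (intro ext)
  fix f g
  show "frm (op_add M S T) f g = frm S f g + frm T f g"
  proof (cases "f \<in> H \<and> g \<in> H")
    case True
    then have f: "f \<in> H" and g: "g \<in> H" by auto
    note m = bounded_ops_mem[OF S ae_class_in_L2[OF f]] bounded_ops_mem[OF T ae_class_in_L2[OF f]]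
    have "ip (l2_rep (l2_add M (S (ae_class M f)) (T (ae_class M f)))) g =
        ip (\<lambda>x. l2_rep (S (ae_class M f)) x + l2_rep (T (ae_class M f)) x) g"
      using g m by (intro ip_cong_AE l2_rep_add rep_H H_add l2_add_in_L2) auto
    then show ?thesis using f g by (simp add: frm_def app_def op_add_def ae_class_in_L2 ip_add_left[OF rep_H[OF m(1)] rep_H[OF m(2)]])
  qed (auto simp: frm_def)
qed

lemma frm_op_scale: assumes T: "T \<in> bounded_ops M"
  shows "frm (op_scale M c T) = (\<lambda>f g. c * frm T f g)"
proof (intro ext)
  fix f g
  show "frm (op_scale M c T) f g = c * frm T f g"
  proof (cases "f \<in> H \<and> g \<in> H")
    case True
    then have f: "f \<in> H" and g: "g \<in> H" by auto
    note m = bounded_ops_mem[OF T ae_class_in_L2[OF f]]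
    have "ip (l2_rep (l2_scale M c (T (ae_class M f)))) g = ip (\<lambda>x. c * l2_rep (T (ae_class M f)) x) g"
      using g m by (intro ip_cong_AE l2_rep_scale rep_H H_scale l2_scale_in_L2) auto
    then show ?thesis using f g by (simp add: frm_def app_def op_scale_def ae_class_in_L2 ip_scale_left)
  qed (auto simp: frm_def)
qed

text \<open>The sum of the forms is represented by some bounded operator, and \<open>op_eqI\<close>
  identifies it with the sum.\<close>

lemma op_add_bounded: assumes S: "S \<in> bounded_ops M" and T: "T \<in> bounded_ops M"
  shows "op_add M S T \<in> bounded_ops M"
proof -
  obtain R where R: "R \<in> bounded_ops M" "frm R = (\<lambda>f g. frm S f g + frm T f g)"
    by (rule form_represent[OF bsf_add[OF frm_bsf[OF S] frm_bsf[OF T]]])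
  have "op_add M S T = R"
  proof (rule op_eqI)
    show "frm (op_add M S T) = frm R" by (simp add: frm_op_add[OF S T] R(2))
    show "op_add M S T u \<in> L2 M" if "u \<in> L2 M" for u
      using that by (simp add: op_add_def l2_add_in_L2 bounded_ops_mem[OF S] bounded_ops_mem[OF T])
    show "op_add M S T \<in> extensional (L2 M)" by (simp add: op_add_def)
  qed (rule bounded_ops_extensional[OF R(1)], rule bounded_ops_mem[OF R(1)])
  then show ?thesis using R(1) by simp
qed

lemma BM_L_inf: "a \<in> BM \<Longrightarrow> a \<in> L_inf M"
  unfolding BM_def L_inf_def by auto

text \<open>Multiplication by \<open>b\<close> in the second argument of the form is its adjoint,
  multiplication by the conjugate, applied after \<open>T\<close>.\<close>

lemma frm_mult:
  assumes T: "T \<in> bounded_ops M" and a: "a \<in> BM" and b: "b \<in> BM"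
  shows "frm (op_comp M (mult_op M (\<lambda>x. cnj (b x))) (op_comp M T (mult_op M a))) = mlt a b (frm T)"
proof (intro ext)
  fix f g
  show "frm (op_comp M (mult_op M (\<lambda>x. cnj (b x))) (op_comp M T (mult_op M a))) f g = mlt a b (frm T) f g"
  proof (cases "f \<in> H \<and> g \<in> H")
    case True
    then have f: "f \<in> H" and g: "g \<in> H" by auto
    note af = BM_mult_H[OF a f] and bg = BM_mult_H[OF b g]
    have 1: "mult_op M a (ae_class M f) = ae_class M (\<lambda>x. a x * f x)"
      unfolding mult_op_def restrict_apply'[OF ae_class_in_L2[OF f]]
    proof (rule ae_class_cong)
      show "AE x in M. a x * l2_rep (ae_class M f) x = a x * f x"
        using rep_class_AE[OF f] by eventually_elim simp
    qed
    let ?u = "T (ae_class M (\<lambda>x. a x * f x))"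
    have u: "?u \<in> L2 M" by (rule bounded_ops_mem[OF T ae_class_in_L2[OF af]])
    have c: "(\<lambda>x. cnj (b x) * l2_rep ?u x) \<in> H" by (rule BM_mult_H[OF BM_cnj[OF b] rep_H[OF u]])
    have "app (op_comp M (mult_op M (\<lambda>x. cnj (b x))) (op_comp M T (mult_op M a))) f =
        l2_rep (ae_class M (\<lambda>x. cnj (b x) * l2_rep ?u x))"
      using u by (simp add: app_def op_comp_def compose_def ae_class_in_L2[OF f] 1) (simp add: mult_op_def)
    moreover have "ip (l2_rep (ae_class M (\<lambda>x. cnj (b x) * l2_rep ?u x))) g = ip (\<lambda>x. cnj (b x) * l2_rep ?u x) g"
      by (rule ip_cong_AE[OF rep_class_H[OF c] c g g rep_class_AE[OF c]]) simp
    moreover have "ip (\<lambda>x. cnj (b x) * l2_rep ?u x) g = ip (l2_rep ?u) (\<lambda>x. b x * g x)"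
      by (rule ip_mult_right[symmetric])
    ultimately show ?thesis using f g af bg by (simp add: frm_def mlt_def app_def)
  qed (auto simp: frm_def mlt_def)
qed

lemma frm_bimodule:
  assumes "masa_bimodule M U" shows "form_bimodule (frm ` U)"
proof -
  have U: "U \<subseteq> bounded_ops M" "op_zero M \<in> U" "\<And>S T. S \<in> U \<Longrightarrow> T \<in> U \<Longrightarrow> op_add M S T \<in> U"
    "\<And>c T. T \<in> U \<Longrightarrow> op_scale M c T \<in> U"
    and mul: "\<And>T A B. T \<in> U \<Longrightarrow> A \<in> mult_masa M \<Longrightarrow> B \<in> mult_masa M \<Longrightarrow> op_comp M A (op_comp M T B) \<in> U"
    using assms unfolding masa_bimodule_def op_subspace_def by simp_all
  have UB: "T \<in> bounded_ops M" if "T \<in> U" for T using U(1) that by blast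
  show ?thesis unfolding form_bimodule_def form_subspace_def
  proof (intro conjI ballI allI subsetI)
    show "(\<lambda>f g. 0) \<in> frm ` U" using imageI[OF U(2), of frm] by (simp only: frm_op_zero)
    fix t assume "t \<in> frm ` U"
    then obtain T where T: "T \<in> U" and t: "t = frm T" by (rule imageE) auto
    show "t \<in> bsf" unfolding t by (rule frm_bsf[OF UB[OF T]])
    show "(\<lambda>f g. c * t f g) \<in> frm ` U" for c
      unfolding t frm_op_scale[OF UB[OF T], symmetric] by (rule imageI[OF U(4)[OF T]])
    show "mlt a b t \<in> frm ` U" if a: "a \<in> BM" and b: "b \<in> BM" for a b
      unfolding t frm_mult[OF UB[OF T] a b, symmetric] mult_masa_def
      by (intro imageI mul[unfolded mult_masa_def] T BM_L_inf BM_cnj a b)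
    fix s assume "s \<in> frm ` U"
    then obtain S where S: "S \<in> U" and s: "s = frm S" by (rule imageE) auto
    show "(\<lambda>f g. t f g + s f g) \<in> frm ` U"
      unfolding t s frm_op_add[OF UB[OF T] UB[OF S], symmetric] by (rule imageI[OF U(3)[OF T S]])
  qed
qed

section \<open>Norm and weak* topology in terms of forms\<close>

lemma frm_diff_eq:
  assumes "S \<in> bounded_ops M" "T \<in> bounded_ops M" "f \<in> H" "g \<in> H"
  shows "frm S f g - frm T f g = ip (\<lambda>x. app S f x - app T f x) g"
  using assms by (simp add: frm_def ip_diff_left app_H)

text \<open>Together with \<open>form_bound_op_dist\<close> this identifies the operator distance
  with the least bound of the difference of the forms.\<close>

lemma op_dist_form_bound:
  assumes S: "S \<in> bounded_ops M" and T: "T \<in> bounded_ops M"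
  shows "form_bound (\<lambda>f g. frm S f g - frm T f g) (op_dist M S T)"
  unfolding form_bound_def
proof (intro conjI ballI)
  show d0: "0 \<le> op_dist M S T" by (rule Metric_space.nonneg[OF Metric_space_bounded_ops])
  let ?d = "\<lambda>f g. frm S f g - frm T f g"
  have d: "?d \<in> bsf" by (intro bsf_diff frm_bsf S T)
  obtain C where C: "form_bound ?d C" using d by (rule bsf_boundE)
  fix f g assume f: "f \<in> H" and g: "g \<in> H"
  show "cmod (?d f g) \<le> op_dist M S T * nrm f * nrm g"
  proof (cases "nrm f = 0")
    \<comment> \<open>A null vector cannot be normalised; here any bound for the form shows that its
      value is zero.\<close>
    case True
    then show ?thesis using form_boundD[OF C f g] by simp
  next
    case False
    then have n: "nrm f > 0" using nrm_nonneg[of f] by linarith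
    define h where "h = (\<lambda>x. of_real (1 / nrm f) * f x)"
    have h: "h \<in> H" unfolding h_def by (rule H_scale[OF f])
    have "nrm h = 1" unfolding h_def nrm_scale using n by (simp add: norm_divide)
    then have "ae_class M h \<in> {u \<in> L2 M. l2_norm M u \<le> 1}" using h by (simp add: ae_class_in_L2 l2_norm_class)
    from cSUP_upper[OF this bdd_above_op_dist[OF S T]]
    have le: "nrm (\<lambda>x. app S h x - app T h x) \<le> op_dist M S T"
      unfolding op_dist_altdef[OF S T] l2_dist_eq app_def .
    have "?d h g = of_real (1 / nrm f) * ?d f g" unfolding h_def by (rule bsf_scale_left[OF d f g])
    then have "cmod (?d f g) = nrm f * cmod (?d h g)" using n by (simp add: norm_mult norm_divide)
    also have "cmod (?d h g) \<le> nrm (\<lambda>x. app S h x - app T h x) * nrm g"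
      unfolding frm_diff_eq[OF S T h g] by (intro Cauchy_Schwarz H_diff app_H S T h g)
    also have "\<dots> \<le> op_dist M S T * nrm g" by (intro mult_right_mono le) simp
    finally show ?thesis using n by (simp add: mult_ac)
  qed
qed

lemma vector_nrm_le:
  assumes "h \<in> H" "\<And>g. g \<in> H \<Longrightarrow> cmod (ip h g) \<le> C * nrm g" "C \<ge> 0"
  shows "nrm h \<le> C"
proof (cases "nrm h = 0")
  case False
  then have n: "nrm h > 0" using nrm_nonneg[of h] by linarith
  have "nrm h * nrm h \<le> C * nrm h" using assms(2)[OF assms(1)] by (simp add: ip_self norm_power power2_eq_square norm_mult)
  then show ?thesis using n by simp
qed (use assms(3) in simp)

lemma form_bound_op_dist:
  assumes S: "S \<in> bounded_ops M" and T: "T \<in> bounded_ops M" and b: "form_bound (\<lambda>f g. frm S f g - frm T f g) C"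
  shows "op_dist M S T \<le> C"
  unfolding op_dist_altdef[OF S T]
proof (rule cSUP_least)
  show "{u \<in> L2 M. l2_norm M u \<le> 1} \<noteq> {}" using l2_zero_in_L2[of M] l2_norm_zero[of M] by force
  fix u assume "u \<in> {u \<in> L2 M. l2_norm M u \<le> 1}"
  then have u: "u \<in> L2 M" and n: "nrm (l2_rep u) \<le> 1" by (auto simp: l2_norm_eq)
  note f = rep_H[OF u]
  have "nrm (\<lambda>x. app S (l2_rep u) x - app T (l2_rep u) x) \<le> C"
  proof (rule vector_nrm_le)
    fix g assume g: "g \<in> H"
    have "cmod (ip (\<lambda>x. app S (l2_rep u) x - app T (l2_rep u) x) g) \<le> C * nrm (l2_rep u) * nrm g"
      using form_boundD[OF b f g] unfolding frm_diff_eq[OF S T f g] .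
    also have "\<dots> \<le> C * 1 * nrm g" using n form_bound_nonneg[OF b] by (intro mult_right_mono mult_left_mono) auto
    finally show "cmod (ip (\<lambda>x. app S (l2_rep u) x - app T (l2_rep u) x) g) \<le> C * nrm g" by simp
  qed (intro H_diff app_H S T f form_bound_nonneg[OF b])+
  then show "l2_dist M (S u) (T u) \<le> C" by (simp add: l2_dist_eq app_def ae_class_l2_rep[OF u])
qed

lemma predual_psum:
  assumes "\<phi> \<in> predual_functionals M"
  obtains F G where "ssq F" "ssq G" "\<And>T. T \<in> bounded_ops M \<Longrightarrow> \<phi> T = psum F G (frm T)"
proof -
  obtain f g where \<phi>: "\<phi> = (\<lambda>T. \<Sum>n. l2_inner M (T (f n)) (g n))" and f: "sq_summable_seq M f" and g: "sq_summable_seq M g"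
    using assms unfolding predual_functionals_def by blast
  have fL: "f n \<in> L2 M" and gL: "g n \<in> L2 M" for n using f g unfolding sq_summable_seq_def by auto
  show ?thesis
  proof (rule that[of "\<lambda>n. l2_rep (f n)" "\<lambda>n. l2_rep (g n)"])
    show "ssq (\<lambda>n. l2_rep (f n))" "ssq (\<lambda>n. l2_rep (g n))"
      using f g fL gL by (simp_all add: ssq_def sq_summable_seq_def rep_H l2_norm_eq)
    show "\<phi> T = psum (\<lambda>n. l2_rep (f n)) (\<lambda>n. l2_rep (g n)) (frm T)" if "T \<in> bounded_ops M" for T
      unfolding \<phi> psum_def l2_inner_eq frm_def app_def by (simp add: rep_H fL gL ae_class_l2_rep)
  qed
qed

lemma psum_predual:
  assumes F: "ssq F" and G: "ssq G"
  obtains \<phi> where "\<phi> \<in> predual_functionals M" "\<And>T. T \<in> bounded_ops M \<Longrightarrow> \<phi> T = psum F G (frm T)"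
proof (rule that)
  show "(\<lambda>T. \<Sum>n. l2_inner M (T (ae_class M (F n))) (ae_class M (G n))) \<in> predual_functionals M"
    unfolding predual_functionals_def
  proof (rule CollectI, rule exI[of _ "\<lambda>n. ae_class M (F n)"], rule exI[of _ "\<lambda>n. ae_class M (G n)"], intro conjI refl)
    show "sq_summable_seq M (\<lambda>n. ae_class M (F n))" "sq_summable_seq M (\<lambda>n. ae_class M (G n))"
      using F G by (auto simp: sq_summable_seq_def ssq_def l2_norm_class ae_class_in_L2)
  qed
  show "(\<Sum>n. l2_inner M (T (ae_class M (F n))) (ae_class M (G n))) = psum F G (frm T)" if T: "T \<in> bounded_ops M" for T
    unfolding psum_def l2_inner_eq frm_def
    using ssq_H[OF F] ssq_H[OF G] by (simp add: ip_rep_class[OF app_H[OF T]] app_def[symmetric])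
qed

section \<open>Finite interpolation and the bipolar theorem for subspaces\<close>

lemma psum_scale_left:
  assumes "ssq F" "ssq G" shows "ssq (\<lambda>n x. c * F n x)" "t \<in> bsf \<Longrightarrow> psum (\<lambda>n x. c * F n x) G t = c * psum F G t"
proof -
  show "ssq (\<lambda>n x. c * F n x)"
    using assms by (auto simp: ssq_def nrm_scale power_mult_distrib intro: summable_mult)
  assume t: "t \<in> bsf"
  show "psum (\<lambda>n x. c * F n x) G t = c * psum F G t"
    unfolding psum_def bsf_scale_left[OF t ssq_H[OF assms(1)] ssq_H[OF assms(2)]]
    by (rule suminf_mult[OF psum_summable[OF assms t]])
qed

text \<open>A weak* neighbourhood tests finitely many functionals, and on those \<open>t\<close> is
  matched exactly by an element of \<open>Y\<close>: pure linear algebra. The induction removes one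
  functional by passing to its kernel in \<open>Y\<close> and correcting \<open>t\<close> by a
  multiple of \<open>y0\<close>.\<close>

lemma finite_interpolation:
  assumes "form_subspace Y" "t \<in> bsf" "\<And>F G. ssq F \<Longrightarrow> ssq G \<Longrightarrow> kills F G Y \<Longrightarrow> psum F G t = 0"
    and "\<forall>(F, G)\<in>set L. ssq F \<and> ssq G"
  shows "\<exists>y\<in>Y. \<forall>(F, G)\<in>set L. psum F G y = psum F G t"
  using assms
proof (induction L arbitrary: Y t)
  case Nil
  then show ?case by (auto simp: form_subspace_def)
next
  case (Cons FG L)
  obtain F0 G0 where FG: "FG = (F0, G0)" by (cases FG)
  have s0: "ssq F0" "ssq G0" using Cons.prems(4) FG by auto
  have L: "\<forall>(F, G)\<in>set L. ssq F \<and> ssq G" using Cons.prems(4) by simp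
  have Y: "Y \<subseteq> bsf" "(\<lambda>f g. 0) \<in> Y" "\<And>s t. s \<in> Y \<Longrightarrow> t \<in> Y \<Longrightarrow> (\<lambda>f g. s f g + t f g) \<in> Y"
    "\<And>c t. t \<in> Y \<Longrightarrow> (\<lambda>f g. c * t f g) \<in> Y"
    using Cons.prems(1) unfolding form_subspace_def by simp_all
  have Yb: "y \<in> bsf" if "y \<in> Y" for y using Y(1) that by blast
  show ?case
  proof (cases "kills F0 G0 Y")
    case True
    have "psum F0 G0 t = 0" by (rule Cons.prems(3)[OF s0 True])
    moreover obtain y where y: "y \<in> Y" "\<forall>(F, G)\<in>set L. psum F G y = psum F G t"
      using Cons.IH[OF Cons.prems(1,2,3) L] by blast
    moreover have "psum F0 G0 y = 0" using True y(1) by (simp add: kills_def)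
    ultimately show ?thesis by (intro bexI[of _ y]) (auto simp: FG)
  next
    case False
    then obtain y1 where y1: "y1 \<in> Y" "psum F0 G0 y1 \<noteq> 0" by (auto simp: kills_def)
    define y0 where "y0 = (\<lambda>f g. (1 / psum F0 G0 y1) * y1 f g)"
    have y0: "y0 \<in> Y" unfolding y0_def by (rule Y(4)[OF y1(1)])
    have p0: "psum F0 G0 y0 = 1" unfolding y0_def using psum_scale[OF s0 Yb[OF y1(1)], of "1 / psum F0 G0 y1"] y1(2) by simp
    define c where "c = psum F0 G0 t"
    define t' where "t' = (\<lambda>f g. t f g - c * y0 f g)"
    define Y' where "Y' = {y \<in> Y. psum F0 G0 y = 0}"
    have cy0: "(\<lambda>f g. c * y0 f g) \<in> bsf" by (rule Yb[OF Y(4)[OF y0]])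
    have t': "t' \<in> bsf" unfolding t'_def by (rule bsf_diff[OF Cons.prems(2) cy0])
    have pt': "psum F G t' = psum F G t - c * psum F G y0" if "ssq F" "ssq G" for F G
      unfolding t'_def by (simp add: psum_diff[OF that Cons.prems(2) cy0] psum_scale[OF that Yb[OF y0]])
    have "form_subspace Y'" unfolding form_subspace_def Y'_def
      using Y by (auto simp: psum_add[OF s0 Yb Yb] psum_scale[OF s0 Yb] psum_def[of F0 G0 "\<lambda>f g. 0"])
    \<comment> \<open>A functional that annihilates the kernel \<open>Y'\<close> annihilates all of
      \<open>Y\<close> after subtracting its value at \<open>y0\<close> times the first
      functional.\<close>
    moreover have "psum F G t' = 0" if F: "ssq F" "ssq G" "kills F G Y'" for F G
    proof -
      let ?c = "- psum F G y0"
      obtain F2 G2 where F2: "ssq F2" "ssq G2" and eq: "\<And>t. t \<in> bsf \<Longrightarrow> psum F2 G2 t = psum F G t + psum (\<lambda>n x. ?c * F0 n x) G0 t"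
        using psum_interleave[OF F(1,2) psum_scale_left(1)[OF s0] s0(2)] by metis
      have eq2: "psum F2 G2 t = psum F G t - psum F G y0 * psum F0 G0 t" if "t \<in> bsf" for t
        using eq[OF that] psum_scale_left(2)[OF s0 that, of ?c] by simp
      have "kills F2 G2 Y" unfolding kills_def
      proof
        fix y assume y: "y \<in> Y"
        define d where "d = psum F0 G0 y"
        have dy0: "(\<lambda>f g. - d * y0 f g) \<in> Y" by (rule Y(4)[OF y0])
        have z: "(\<lambda>f g. y f g + - d * y0 f g) \<in> Y" by (rule Y(3)[OF y dy0])
        have pz: "psum F G (\<lambda>f g. y f g + - d * y0 f g) = psum F G y - d * psum F G y0" if "ssq F" "ssq G" for F G
          using psum_add[OF that Yb[OF y] Yb[OF dy0]] psum_scale[OF that Yb[OF y0], of "- d"] by simp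
        have "(\<lambda>f g. y f g + - d * y0 f g) \<in> Y'" unfolding Y'_def using z pz[OF s0] p0 d_def by simp
        then have "psum F G (\<lambda>f g. y f g + - d * y0 f g) = 0" using F(3) unfolding kills_def by blast
        then show "psum F2 G2 y = 0" unfolding eq2[OF Yb[OF y]] using pz[OF F(1,2)] d_def by simp
      qed
      then have "psum F2 G2 t = 0" by (rule Cons.prems(3)[OF F2])
      then show ?thesis unfolding eq2[OF Cons.prems(2)] pt'[OF F(1,2)] c_def by (simp add: mult.commute)
    qed
    ultimately obtain y where y: "y \<in> Y'" "\<forall>(F, G)\<in>set L. psum F G y = psum F G t'"
      using Cons.IH[of Y' t'] t' L by blast
    have yY: "y \<in> Y" and y00: "psum F0 G0 y = 0" using y(1) by (auto simp: Y'_def)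
    have py: "psum F G (\<lambda>f g. y f g + c * y0 f g) = psum F G y + c * psum F G y0" if "ssq F" "ssq G" for F G
      by (simp add: psum_add[OF that Yb[OF yY] cy0] psum_scale[OF that Yb[OF y0]])
    have main: "psum F G (\<lambda>f g. y f g + c * y0 f g) = psum F G t" if m: "(F, G) \<in> set (FG # L)" for F G
    proof (cases "(F, G) = FG")
      case True
      then show ?thesis using py[OF s0] y00 p0 by (simp add: FG c_def)
    next
      case False
      then have "(F, G) \<in> set L" using m by simp
      then have "ssq F" "ssq G" "psum F G y = psum F G t'" using L y(2) by auto
      then show ?thesis using py pt' by simp
    qed
    have "\<forall>(F, G)\<in>set (FG # L). psum F G (\<lambda>f g. y f g + c * y0 f g) = psum F G t"
      by (rule ballI, clarify) (rule main)
    then show ?thesis using Y(3)[OF yY Y(4)[OF y0]] by (intro bexI[of _ "\<lambda>f g. y f g + c * y0 f g"])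
  qed
qed

text \<open>The open sets around the values are forgotten: an operator with exactly the same values
  as \<open>T\<close> stays in \<open>W\<close>. This weak form suffices because the interpolation
  is exact.\<close>

lemma weak_star_open_finite:
  assumes O: "openin (weak_star_topology M) W" "T \<in> W"
  shows "\<exists>L. (\<forall>(F, G)\<in>set L. ssq F \<and> ssq G) \<and>
    (\<forall>S\<in>bounded_ops M. (\<forall>(F, G)\<in>set L. psum F G (frm S) = psum F G (frm T)) \<longrightarrow> S \<in> W)"
proof -
  have "generate_topology_on {{T \<in> bounded_ops M. \<phi> T \<in> G} | \<phi> G. \<phi> \<in> predual_functionals M \<and> open G} W"
    using O(1) unfolding weak_star_topology_def by (rule openin_topology_generated_by)
  then show ?thesis using O(2)
  proof (induction rule: generate_topology_on.induct)
    case Empty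
    then show ?case by simp
  next
    case (Int a b)
    obtain L1 where L1: "\<forall>(F, G)\<in>set L1. ssq F \<and> ssq G"
      "\<forall>S\<in>bounded_ops M. (\<forall>(F, G)\<in>set L1. psum F G (frm S) = psum F G (frm T)) \<longrightarrow> S \<in> a"
      using Int.IH(1) Int.prems by blast
    obtain L2 where L2: "\<forall>(F, G)\<in>set L2. ssq F \<and> ssq G"
      "\<forall>S\<in>bounded_ops M. (\<forall>(F, G)\<in>set L2. psum F G (frm S) = psum F G (frm T)) \<longrightarrow> S \<in> b"
      using Int.IH(2) Int.prems by blast
    show ?case by (rule exI[of _ "L1 @ L2"]) (use L1 L2 in auto)
  next
    case (UN K)
    then obtain k where k: "k \<in> K" "T \<in> k" by blast
    obtain L where L: "\<forall>(F, G)\<in>set L. ssq F \<and> ssq G"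
      "\<forall>S\<in>bounded_ops M. (\<forall>(F, G)\<in>set L. psum F G (frm S) = psum F G (frm T)) \<longrightarrow> S \<in> k"
      using UN.IH[OF k] by blast
    show ?case by (rule exI[of _ L]) (use L k in blast)
  next
    case (Basis s)
    then obtain \<phi> G0 where s: "s = {T \<in> bounded_ops M. \<phi> T \<in> G0}" and \<phi>: "\<phi> \<in> predual_functionals M" by blast
    obtain F G where FG: "ssq F" "ssq G" "\<And>T. T \<in> bounded_ops M \<Longrightarrow> \<phi> T = psum F G (frm T)"
      using predual_psum[OF \<phi>] by metis
    have "S \<in> s" if "S \<in> bounded_ops M" "psum F G (frm S) = psum F G (frm T)" for S
    proof -
      have "T \<in> bounded_ops M" "\<phi> T \<in> G0" using Basis.prems unfolding s by auto
      then show ?thesis unfolding s using that FG(3)[of T] FG(3)[of S] by simp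
    qed
    then show ?case using FG(1,2) by (intro exI[of _ "[(F, G)]"]) simp
  qed
qed

text \<open>Bipolar theorem for subspaces. A functional that annihilates \<open>Y\<close> but not
  \<open>T\<close> gives a neighbourhood of \<open>T\<close> missing \<open>Y\<close>; conversely
  interpolation finds an element of \<open>Y\<close> in each neighbourhood.\<close>

lemma weak_star_closure_iff:
  assumes Y: "Y \<subseteq> bounded_ops M" "form_subspace (frm ` Y)" and T: "T \<in> bounded_ops M"
  shows "T \<in> weak_star_topology M closure_of Y \<longleftrightarrow>
    (\<forall>F G. ssq F \<longrightarrow> ssq G \<longrightarrow> kills F G (frm ` Y) \<longrightarrow> psum F G (frm T) = 0)"
proof
  assume cl: "T \<in> weak_star_topology M closure_of Y"
  show "\<forall>F G. ssq F \<longrightarrow> ssq G \<longrightarrow> kills F G (frm ` Y) \<longrightarrow> psum F G (frm T) = 0"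
  proof (intro allI impI, rule ccontr)
    fix F G assume F: "ssq F" "ssq G" "kills F G (frm ` Y)" and ne: "psum F G (frm T) \<noteq> 0"
    obtain \<phi> where \<phi>: "\<phi> \<in> predual_functionals M" "\<And>T. T \<in> bounded_ops M \<Longrightarrow> \<phi> T = psum F G (frm T)"
      using psum_predual[OF F(1,2)] by metis
    have "{S \<in> bounded_ops M. \<phi> S \<in> - {0}} \<in>
        {{T \<in> bounded_ops M. \<phi> T \<in> G} | \<phi> G. \<phi> \<in> predual_functionals M \<and> open G}"
      using \<phi>(1) by (intro CollectI exI[of _ \<phi>] exI[of _ "- {0}"] conjI refl) auto
    then have "openin (weak_star_topology M) {S \<in> bounded_ops M. \<phi> S \<in> - {0}}"
      unfolding weak_star_topology_def openin_topology_generated_by_iff by (rule generate_topology_on.Basis)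
    moreover have "T \<in> {S \<in> bounded_ops M. \<phi> S \<in> - {0}}" using T ne \<phi>(2)[OF T] by simp
    ultimately have "\<exists>S. S \<in> Y \<and> S \<in> {S \<in> bounded_ops M. \<phi> S \<in> - {0}}"
      using cl[unfolded in_closure_of, THEN conjunct2, rule_format, of "{S \<in> bounded_ops M. \<phi> S \<in> - {0}}"] by simp
    then obtain S where S: "S \<in> Y" "S \<in> bounded_ops M" "\<phi> S \<noteq> 0" by blast
    have "psum F G (frm S) = 0" using F(3) S(1) unfolding kills_def by (rule bspec[OF _ imageI])
    then show False using \<phi>(2)[OF S(2)] S(3) by simp
  qed
next
  assume ann: "\<forall>F G. ssq F \<longrightarrow> ssq G \<longrightarrow> kills F G (frm ` Y) \<longrightarrow> psum F G (frm T) = 0"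
  show "T \<in> weak_star_topology M closure_of Y"
    unfolding in_closure_of topspace_weak_star_topology
  proof (intro conjI allI impI T)
    fix W assume "T \<in> W \<and> openin (weak_star_topology M) W"
    then obtain L where L: "\<forall>(F, G)\<in>set L. ssq F \<and> ssq G"
      "\<forall>S\<in>bounded_ops M. (\<forall>(F, G)\<in>set L. psum F G (frm S) = psum F G (frm T)) \<longrightarrow> S \<in> W"
      using weak_star_open_finite by blast
    obtain y where y: "y \<in> frm ` Y" "\<forall>(F, G)\<in>set L. psum F G y = psum F G (frm T)"
      using finite_interpolation[OF Y(2) frm_bsf[OF T] _ L(1)] ann by blast
    obtain S where S: "S \<in> Y" "y = frm S" using y(1) by (rule imageE) auto
    have "S \<in> bounded_ops M" using S(1) Y(1) by blast
    then have "S \<in> W" using L(2) y(2) S(2) by blast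
    then show "\<exists>S. S \<in> Y \<and> S \<in> W" using S(1) by blast
  qed
qed

lemma frm_reflexive:
  assumes U: "masa_bimodule M U" and cl: "closedin (weak_star_topology M) U"
  shows "reflexive (frm ` U)"
  unfolding reflexive_def
proof (intro ballI impI)
  fix t assume t: "t \<in> bsf" and ann: "\<forall>F G. ssq F \<longrightarrow> ssq G \<longrightarrow> kills F G (frm ` U) \<longrightarrow> psum F G t = 0"
  obtain T where T: "T \<in> bounded_ops M" "frm T = t" by (rule form_represent[OF t])
  have "U \<subseteq> bounded_ops M" using U by (simp add: masa_bimodule_def op_subspace_def)
  moreover have "form_subspace (frm ` U)" using frm_bimodule[OF U] by (simp add: form_bimodule_def)
  ultimately have "T \<in> weak_star_topology M closure_of U"
    using weak_star_closure_iff[of U T] T ann by simp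
  then have "T \<in> U" using closure_of_closedin[OF cl] by simp
  then show "t \<in> frm ` U" using T(2) by blast
qed

section \<open>Compact operators in terms of forms\<close>

text \<open>A vanishing remainder says that \<open>y\<close> lies in the span up to a null function;
  this is all that is needed of the span.\<close>

lemma Gram_Schmidt: "set ys \<subseteq> H \<Longrightarrow> \<exists>e N. onz e N \<and> (\<forall>y\<in>set ys. nrm (off e N y) = 0)"
proof (induction ys)
  case Nil
  show ?case by (intro exI[of _ "\<lambda>_ _. 0"] exI[of _ 0]) (simp add: onz_def)
next
  case (Cons y ys)
  then obtain e N where e: "onz e N" and ys: "\<forall>y\<in>set ys. nrm (off e N y) = 0" by auto
  have y: "y \<in> H" and ysH: "set ys \<subseteq> H" using Cons.prems by auto
  define r where "r = off e N y"
  \<comment> \<open>For \<open>y\<close> already in the span \<open>nrm r = 0\<close>, and division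
    by zero makes \<open>v\<close> the zero function, which \<open>onz\<close> admits.\<close>
  define v where "v = (\<lambda>x. of_real (1 / nrm r) * r x)"
  define e' where "e' = e(N := v)"
  have r: "r \<in> perp e N" unfolding r_def by (rule off_perp[OF e y])
  have v: "v \<in> perp e N" unfolding v_def by (rule perp_scale[OF r])
  have nv: "nrm v = 0 \<or> nrm v = 1" unfolding v_def nrm_scale by (simp add: norm_divide)
  have e': "onz e' (Suc N)"
    unfolding onz_def
  proof (intro allI impI)
    fix i assume i: "i < Suc N"
    show "e' i \<in> H \<and> (nrm (e' i) = 0 \<or> nrm (e' i) = 1) \<and> (\<forall>j<i. ip (e' i) (e' j) = 0)"
    proof (cases "i = N")
      case True
      then show ?thesis using v nv by (auto simp: e'_def perp_def)
    next
      case False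
      then have "i < N" using i by simp
      then show ?thesis using e unfolding onz_def e'_def by auto
    qed
  qed
  have same: "off e' N z = off e N z" for z unfolding off_def e'_def by (intro ext) simp
  have e'N: "e' N = v" by (simp add: e'_def)
  have "nrm (off e' (Suc N) z) = 0" if z: "z \<in> set ys" for z
  proof -
    have zH: "z \<in> H" using z ysH by blast
    have "(nrm (off e' (Suc N) z))\<^sup>2 \<le> (nrm (off e' N z))\<^sup>2"
      using Bessel[OF e' zH] Bessel[OF onz_mono[OF e' le_SucI[OF order_refl]] zH] zero_le_power2[of "cmod (ip z (e' N))"]
      unfolding sum.lessThan_Suc by linarith
    also have "\<dots> = 0" using ys z by (simp add: same)
    finally show ?thesis by simp
  qed
  moreover have "nrm (off e' (Suc N) y) = 0"
  proof -
    have vH: "v \<in> H" by (rule perp_H[OF v])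
    have "ip r v = ip y v - (\<Sum>i<N. ip y (e i) * ip (e i) v)" unfolding r_def by (rule ip_off[OF e y vH])
    moreover have "ip (e i) v = 0" if "i < N" for i using v that ip_cnj[of "e i" v] by (simp add: perp_def)
    ultimately have "ip y v = ip r v" by simp
    also have "\<dots> = of_real (1 / nrm r) * of_real ((nrm r)\<^sup>2)" unfolding v_def ip_scale_right ip_self by simp
    finally have c: "ip y v = of_real (nrm r)" by (simp add: power2_eq_square)
    show ?thesis
    proof (cases "nrm r = 0")
      case True
      then have "v = (\<lambda>x. 0)" by (simp add: v_def)
      then show ?thesis unfolding off_Suc same e'N r_def[symmetric] using True by simp
    next
      case False
      then have "off e' (Suc N) y = (\<lambda>x. 0)" unfolding off_Suc same e'N r_def[symmetric] c by (simp add: v_def)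
      then show ?thesis by simp
    qed
  qed
  ultimately show ?case using e' by (intro exI[of _ e'] exI[of _ "Suc N"]) auto
qed

text \<open>Projecting onto the span of a finite net of the image of the unit ball changes the
  operator by at most the mesh of the net, and the projected operator has finite rank.\<close>

lemma compact_APX:
  assumes T: "T \<in> compact_ops M" shows "frm T \<in> APX"
proof -
  interpret L: Metric_space "L2 M" "l2_dist M" by (rule Metric_space_L2)
  have TB: "T \<in> bounded_ops M" using T by (simp add: compact_ops_def)
  let ?B = "{u \<in> L2 M. l2_norm M u \<le> 1}"
  have "compactin L.mtopology (L.mtopology closure_of (T ` ?B))"
    using T by (simp add: compact_ops_def l2_topology_def)
  then have tb: "L.mtotally_bounded (T ` ?B)"
    by (rule L.compact_closure_of_imp_mtotally_bounded) (auto simp: bounded_ops_mem[OF TB])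
  have tB: "frm T \<in> bsf" by (rule frm_bsf[OF TB])
  obtain C where C: "form_bound (frm T) C" using tB by (rule bsf_boundE)
  show ?thesis unfolding APX_def
  proof (intro CollectI conjI allI impI tB)
    fix \<epsilon> :: real assume \<epsilon>: "\<epsilon> > 0"
    obtain K where "finite K \<and> K \<subseteq> T ` ?B \<and> T ` ?B \<subseteq> (\<Union>x\<in>K. L.mball x \<epsilon>)"
      using tb[unfolded L.mtotally_bounded_def, rule_format, OF \<epsilon>] by (rule exE)
    note K = this[THEN conjunct1] this[THEN conjunct2, THEN conjunct1] this[THEN conjunct2, THEN conjunct2]
    have KL: "K \<subseteq> L2 M" using K(2) bounded_ops_mem[OF TB] by auto
    obtain ys where ys: "set ys = l2_rep ` K" using finite_list[OF finite_imageI[OF K(1), of l2_rep]] by blast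
    have "set ys \<subseteq> H" unfolding ys using KL rep_H by auto
    then obtain e N where e: "onz e N" and off0: "\<forall>y\<in>set ys. nrm (off e N y) = 0" using Gram_Schmidt by blast
    \<comment> \<open>\<open>k\<close> is the adjoint applied to \<open>e j\<close>, so the
      projected operator is a sum of the forms \<open>rk (k j) (e j)\<close>.\<close>
    have "\<exists>k. k \<in> H \<and> (\<forall>f\<in>H. frm T f (e j) = ip f k)" if j: "j < N" for j
    proof (rule Riesz_representation[of "\<lambda>f. frm T f (e j)" "C * nrm (e j)"])
      note ej = onz_H[OF e j]
      show "frm T (\<lambda>x. f x + g x) (e j) = frm T f (e j) + frm T g (e j)" if "f \<in> H" "g \<in> H" for f g
        by (rule bsf_add_left[OF tB that ej])
      show "frm T (\<lambda>x. c * f x) (e j) = c * frm T f (e j)" if "f \<in> H" for c f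
        by (rule bsf_scale_left[OF tB that ej])
      show "cmod (frm T f (e j)) \<le> C * nrm (e j) * nrm f" if "f \<in> H" for f
        using form_boundD[OF C that ej] by (simp add: mult_ac)
      show "0 \<le> C * nrm (e j)" using form_bound_nonneg[OF C] by simp
    qed blast
    then have "\<forall>j. \<exists>k. j < N \<longrightarrow> k \<in> H \<and> (\<forall>f\<in>H. frm T f (e j) = ip f k)" by blast
    then obtain k where k: "\<And>j. j < N \<Longrightarrow> k j \<in> H" "\<And>j f. j < N \<Longrightarrow> f \<in> H \<Longrightarrow> frm T f (e j) = ip f (k j)"
      by metis
    define s where "s = (\<lambda>f g. \<Sum>j<N. rk (k j) (e j) f g)"
    have s: "s \<in> FR" unfolding s_def by (intro FR_sum FR_rk k(1) onz_H[OF e])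
    have sd: "frm T f g - s f g = ip (off e N (app T f)) g" if f: "f \<in> H" and g: "g \<in> H" for f g
    proof -
      have "ip (off e N (app T f)) g = ip (app T f) g - (\<Sum>j<N. ip (app T f) (e j) * ip (e j) g)"
        by (rule ip_off[OF e app_H[OF TB f] g])
      moreover have "ip (app T f) (e j) = ip f (k j)" if "j < N" for j
        using k(2)[OF that f] f onz_H[OF e that] by (simp add: frm_def)
      ultimately show ?thesis using f g by (simp add: s_def rk_def frm_def)
    qed
    have unit: "nrm (off e N (app T f)) \<le> \<epsilon>" if f: "f \<in> H" "nrm f \<le> 1" for f
    proof -
      have "ae_class M f \<in> ?B" using f by (simp add: ae_class_in_L2 l2_norm_class)
      then obtain y where y: "y \<in> K" "T (ae_class M f) \<in> L.mball y \<epsilon>" using K(3) by blast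
      have yH: "l2_rep y \<in> H" using y(1) KL rep_H by blast
      have aH: "app T f \<in> H" by (rule app_H[OF TB f(1)])
      have dH: "(\<lambda>x. app T f x - l2_rep y x) \<in> H" by (rule H_diff[OF aH yH])
      have "nrm (\<lambda>x. app T f x - l2_rep y x) < \<epsilon>"
        using y(2) nrm_diff_commute[of "app T f" "l2_rep y"] by (simp add: l2_dist_eq app_def)
      then have "nrm (off e N (\<lambda>x. app T f x - l2_rep y x)) \<le> \<epsilon>" using nrm_off_le[OF e dH] by linarith
      moreover have "nrm (off e N (l2_rep y)) = 0" using off0 y(1) ys by blast
      moreover have "off e N (app T f) = (\<lambda>x. off e N (\<lambda>x. app T f x - l2_rep y x) x + off e N (l2_rep y) x)"
        using off_add[OF e dH yH] by simp
      ultimately show ?thesis using nrm_triangle[OF off_H[OF e dH] off_H[OF e yH]] by simp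
    qed
    have sb: "(\<lambda>f g. frm T f g - s f g) \<in> bsf" by (intro bsf_diff tB FR_bsf s)
    obtain D where D: "form_bound (\<lambda>f g. frm T f g - s f g) D" using sb by (rule bsf_boundE)
    have "form_bound (\<lambda>f g. frm T f g - s f g) \<epsilon>" unfolding form_bound_def
    proof (intro conjI ballI)
      fix f g assume f: "f \<in> H" and g: "g \<in> H"
      show "cmod (frm T f g - s f g) \<le> \<epsilon> * nrm f * nrm g"
      proof (cases "nrm f = 0")
        case True
        then show ?thesis using form_boundD[OF D f g] by simp
      next
        case False
        then have n: "nrm f > 0" using nrm_nonneg[of f] by linarith
        define h where "h = (\<lambda>x. of_real (1 / nrm f) * f x)"
        have h: "h \<in> H" unfolding h_def by (rule H_scale[OF f])
        have h1: "nrm h \<le> 1" unfolding h_def nrm_scale using n by (simp add: norm_divide)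
        have "frm T h g - s h g = of_real (1 / nrm f) * (frm T f g - s f g)"
          unfolding h_def by (rule bsf_scale_left[OF sb f g])
        then have "cmod (frm T f g - s f g) = nrm f * cmod (frm T h g - s h g)" using n by (simp add: norm_mult norm_divide)
        also have "cmod (frm T h g - s h g) \<le> nrm (off e N (app T h)) * nrm g"
          unfolding sd[OF h g] by (rule Cauchy_Schwarz[OF off_H[OF e app_H[OF TB h]] g])
        also have "\<dots> \<le> \<epsilon> * nrm g" by (intro mult_right_mono unit h h1) simp
        finally show ?thesis using n by (simp add: mult_ac)
      qed
    qed (use \<epsilon> in simp)
    then show "\<exists>s\<in>FR. form_bound (\<lambda>f g. frm T f g - s f g) \<epsilon>" using s by (intro bexI[of _ s])
  qed
qed

text \<open>A rank one term sends the unit ball into multiples of \<open>q\<close> with coefficients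
  in a compact disc, which has a finite net; sums of nets serve sums of terms. Closeness is
  expressed through pairings since only forms are at hand.\<close>

lemma FR_finite_net:
  assumes "t \<in> FR" "e > 0"
  shows "\<exists>K. finite K \<and> K \<subseteq> H \<and> (\<forall>f\<in>H. nrm f \<le> 1 \<longrightarrow> (\<exists>h\<in>K. \<forall>g\<in>H. cmod (t f g - ip h g) \<le> e * nrm g))"
  using assms
proof (induction arbitrary: e rule: FR.induct)
  case FR_zero
  show ?case by (rule exI[of _ "{\<lambda>x. 0}"]) (use FR_zero in auto)
next
  case (FR_step t p q)
  note p = FR_step.hyps(2) and q = FR_step.hyps(3)
  obtain K where K: "finite K" "K \<subseteq> H"
    "\<forall>f\<in>H. nrm f \<le> 1 \<longrightarrow> (\<exists>h\<in>K. \<forall>g\<in>H. cmod (t f g - ip h g) \<le> (e / 2) * nrm g)"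
    using FR_step.IH[of "e / 2"] FR_step.prems by auto
  \<comment> \<open>Half of \<open>e\<close> is left for the new term; \<open>nrm q + 1\<close>
    avoids a zero denominator.\<close>
  define d where "d = e / (2 * (nrm q + 1))"
  have "2 * (nrm q + 1) > 0" using nrm_nonneg[of q] by argo
  then have d: "d > 0" unfolding d_def using FR_step.prems by (rule divide_pos_pos[rotated])
  have "compact (cball (0::complex) (nrm p))" by simp
  then obtain D where D: "finite D" "cball (0::complex) (nrm p) \<subseteq> (\<Union>c\<in>D. ball c d)"
    using d unfolding compact_eq_totally_bounded by blast
  define K' where "K' = (\<lambda>(c, h) x. c * q x + h x) ` (D \<times> K)"
  show ?case
  proof (intro exI[of _ K'] conjI ballI impI)
    show "finite K'" unfolding K'_def using D(1) K(1) by simp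
    show "K' \<subseteq> H" unfolding K'_def using K(2) q by auto
    fix f assume f: "f \<in> H" "nrm f \<le> 1"
    obtain h where h: "h \<in> K" "\<forall>g\<in>H. cmod (t f g - ip h g) \<le> (e / 2) * nrm g" using K(3) f by blast
    have hH: "h \<in> H" using h(1) K(2) by blast
    have "cmod (ip f p) \<le> nrm f * nrm p" by (rule Cauchy_Schwarz[OF f(1) p])
    also have "\<dots> \<le> 1 * nrm p" by (intro mult_right_mono f(2)) simp
    finally have "ip f p \<in> cball 0 (nrm p)" by simp
    then obtain c where c: "c \<in> D" "ip f p \<in> ball c d" using D(2) by blast
    have cd: "cmod (ip f p - c) \<le> d" using c(2) by (simp add: dist_norm norm_minus_commute)
    show "\<exists>h\<in>K'. \<forall>g\<in>H. cmod (rk p q f g + t f g - ip h g) \<le> e * nrm g"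
    proof (intro bexI[of _ "\<lambda>x. c * q x + h x"] ballI)
      show "(\<lambda>x. c * q x + h x) \<in> K'" unfolding K'_def using c(1) h(1) by (intro image_eqI[of _ _ "(c, h)"]) auto
      fix g assume g: "g \<in> H"
      have "rk p q f g + t f g - ip (\<lambda>x. c * q x + h x) g = (ip f p - c) * ip q g + (t f g - ip h g)"
        using f g ip_add_left[OF H_scale[OF q, of c] hH g] by (simp add: rk_def ip_scale_left algebra_simps)
      then have "cmod (rk p q f g + t f g - ip (\<lambda>x. c * q x + h x) g) \<le> cmod ((ip f p - c) * ip q g) + cmod (t f g - ip h g)"
        by (simp only: norm_triangle_ineq)
      also have "cmod ((ip f p - c) * ip q g) \<le> d * (nrm q * nrm g)"
        unfolding norm_mult using d by (intro mult_mono cd Cauchy_Schwarz[OF q g]) auto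
      also have "d * (nrm q * nrm g) \<le> d * ((nrm q + 1) * nrm g)"
        using d by (intro mult_left_mono mult_right_mono) auto
      also have "d * ((nrm q + 1) * nrm g) = (e / 2) * nrm g"
      proof -
        have "nrm q + 1 > 0" using nrm_nonneg[of q] by linarith
        moreover have "e / (2 * a) * a = e / 2" if "a > 0" for a :: real using that by simp
        ultimately have "d * (nrm q + 1) = e / 2" unfolding d_def by blast
        then show ?thesis by (simp only: mult.assoc[symmetric])
      qed
      finally have "cmod (rk p q f g + t f g - ip (\<lambda>x. c * q x + h x) g) \<le> (e / 2) * nrm g + cmod (t f g - ip h g)" by simp
      also have "\<dots> \<le> (e / 2) * nrm g + (e / 2) * nrm g" by (intro add_left_mono h(2)[rule_format, OF g])
      finally show "cmod (rk p q f g + t f g - ip (\<lambda>x. c * q x + h x) g) \<le> e * nrm g" by (simp add: field_simps)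
    qed
  qed
qed

lemma L2_mcomplete: "Metric_space.mcomplete (L2 M) (l2_dist M)"
proof -
  interpret L: Metric_space "L2 M" "l2_dist M" by (rule Metric_space_L2)
  show ?thesis unfolding L.mcomplete_def
  proof (intro allI impI)
    fix \<sigma> assume c: "L.MCauchy \<sigma>"
    have \<sigma>: "\<sigma> n \<in> L2 M" for n using c unfolding L.MCauchy_def by auto
    have cau: "\<exists>N. \<forall>m\<ge>N. \<forall>n\<ge>N. nrm (\<lambda>x. l2_rep (\<sigma> m) x - l2_rep (\<sigma> n) x) \<le> e" if "e > 0" for e
    proof -
      obtain N where "\<forall>n n'. N \<le> n \<longrightarrow> N \<le> n' \<longrightarrow> l2_dist M (\<sigma> n) (\<sigma> n') < e"
        using c \<open>e > 0\<close> unfolding L.MCauchy_def by blast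
      then show ?thesis unfolding l2_dist_eq by (intro exI[of _ N]) (auto intro: less_imp_le)
    qed
    obtain g where g: "g \<in> H" "(\<lambda>n. nrm (\<lambda>x. l2_rep (\<sigma> n) x - g x)) \<longlonglongrightarrow> 0"
      by (rule L2_Cauchy_converges[OF rep_H[OF \<sigma>] cau])
    have "l2_dist M (\<sigma> n) (ae_class M g) = nrm (\<lambda>x. l2_rep (\<sigma> n) x - g x)" for n
      unfolding l2_dist_eq
    proof (rule nrm_cong_AE)
      show "(\<lambda>x. l2_rep (\<sigma> n) x - l2_rep (ae_class M g) x) \<in> borel_measurable M" "(\<lambda>x. l2_rep (\<sigma> n) x - g x) \<in> borel_measurable M"
        by (intro H_measurable H_diff rep_H[OF \<sigma>] rep_class_H g)+
      show "AE x in M. l2_rep (\<sigma> n) x - l2_rep (ae_class M g) x = l2_rep (\<sigma> n) x - g x"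
        using rep_class_AE[OF g(1)] by eventually_elim simp
    qed
    then have "(\<lambda>n. l2_dist M (\<sigma> n) (ae_class M g)) \<longlonglongrightarrow> 0" using g(2) by simp
    then have "limitin L.mtopology \<sigma> (ae_class M g) sequentially"
      unfolding L.limitin_metric_dist_null using \<sigma> ae_class_in_L2[OF g(1)] by simp
    then show "\<exists>x. limitin L.mtopology \<sigma> x sequentially" by blast
  qed
qed

text \<open>The finite rank approximation gives a finite net for the image of the unit ball, and
  completeness turns total boundedness into compactness of the closure.\<close>

lemma APX_compact:
  assumes T: "T \<in> bounded_ops M" and A: "frm T \<in> APX" shows "T \<in> compact_ops M"
proof -
  interpret L: Metric_space "L2 M" "l2_dist M" by (rule Metric_space_L2)
  let ?B = "{u \<in> L2 M. l2_norm M u \<le> 1}"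
  have "L.mtotally_bounded (T ` ?B)" unfolding L.mtotally_bounded_def
  proof (intro allI impI)
    fix \<epsilon> :: real assume \<epsilon>: "\<epsilon> > 0"
    then have e8: "\<epsilon> / 8 > 0" by simp
    obtain s where s: "s \<in> FR" and sb: "form_bound (\<lambda>f g. frm T f g - s f g) (\<epsilon> / 8)" by (rule APX_E[OF A e8])
    obtain K where K: "finite K" "K \<subseteq> H"
      "\<forall>f\<in>H. nrm f \<le> 1 \<longrightarrow> (\<exists>h\<in>K. \<forall>g\<in>H. cmod (s f g - ip h g) \<le> (\<epsilon> / 8) * nrm g)"
      using FR_finite_net[OF s e8] by blast
    have near: "\<exists>h\<in>K. nrm (\<lambda>x. l2_rep (T u) x - h x) \<le> \<epsilon> / 4" if "u \<in> ?B" for u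
    proof -
      have u: "u \<in> L2 M" and n: "nrm (l2_rep u) \<le> 1" using that by (auto simp: l2_norm_eq)
      note f = rep_H[OF u] and Tu = rep_H[OF bounded_ops_mem[OF T u]]
      obtain h where h: "h \<in> K" "\<forall>g\<in>H. cmod (s (l2_rep u) g - ip h g) \<le> (\<epsilon> / 8) * nrm g" using K(3) f n by blast
      have hH: "h \<in> H" using h(1) K(2) by blast
      have "nrm (\<lambda>x. l2_rep (T u) x - h x) \<le> \<epsilon> / 4"
      proof (rule vector_nrm_le)
        fix g assume g: "g \<in> H"
        have "ip (\<lambda>x. l2_rep (T u) x - h x) g = (frm T (l2_rep u) g - s (l2_rep u) g) + (s (l2_rep u) g - ip h g)"
          using f g ip_diff_left[OF Tu hH g] by (simp add: frm_def app_def ae_class_l2_rep[OF u])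
        then have "cmod (ip (\<lambda>x. l2_rep (T u) x - h x) g) \<le> cmod (frm T (l2_rep u) g - s (l2_rep u) g) + cmod (s (l2_rep u) g - ip h g)"
          by (simp only: norm_triangle_ineq)
        also have "\<dots> \<le> (\<epsilon> / 8) * nrm (l2_rep u) * nrm g + (\<epsilon> / 8) * nrm g"
          by (intro add_mono form_boundD[OF sb f g] h(2)[rule_format, OF g])
        also have "(\<epsilon> / 8) * nrm (l2_rep u) * nrm g \<le> (\<epsilon> / 8) * 1 * nrm g"
          using n e8 by (intro mult_right_mono mult_left_mono) auto
        finally show "cmod (ip (\<lambda>x. l2_rep (T u) x - h x) g) \<le> \<epsilon> / 4 * nrm g" by simp
      qed (use H_diff[OF Tu hH] \<epsilon> in auto)
      then show ?thesis using h(1) by blast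
    qed
    \<comment> \<open>Net points must lie in the image itself, so each useful \<open>h\<close> is
      replaced by some \<open>T u\<close> near it; two distances of a quarter then stay below
      \<open>\<epsilon>\<close>.\<close>
    define P where "P h u \<longleftrightarrow> u \<in> ?B \<and> nrm (\<lambda>x. l2_rep (T u) x - h x) \<le> \<epsilon> / 4" for h u
    define K' where "K' = {T (SOME u. P h u) | h. h \<in> K \<and> (\<exists>u. P h u)}"
    have P: "P h (SOME u. P h u)" if "\<exists>u. P h u" for h using that by (rule someI_ex)
    have "K' \<subseteq> (\<lambda>h. T (SOME u. P h u)) ` K" unfolding K'_def by blast
    then have "finite K'" using K(1) finite_surj by blast
    moreover have "K' \<subseteq> T ` ?B"
    proof
      fix y assume "y \<in> K'"
      then obtain h where y: "y = T (SOME u. P h u)" and ex: "\<exists>u. P h u" unfolding K'_def by blast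
      have PB: "u \<in> ?B" if "P h u" for u using that unfolding P_def by (rule conjunct1)
      show "y \<in> T ` ?B" unfolding y by (rule imageI[OF PB[OF P[OF ex]]])
    qed
    moreover have "T ` ?B \<subseteq> (\<Union>x\<in>K'. L.mball x \<epsilon>)"
    proof
      fix y assume "y \<in> T ` ?B"
      then obtain u where u: "u \<in> ?B" and y: "y = T u" by (rule imageE) auto
      obtain h where h: "h \<in> K" "nrm (\<lambda>x. l2_rep (T u) x - h x) \<le> \<epsilon> / 4" using near[OF u] by blast
      have ex: "\<exists>u. P h u" using u h(2) unfolding P_def by blast
      define w where "w = (SOME u. P h u)"
      have w: "w \<in> ?B" "nrm (\<lambda>x. l2_rep (T w) x - h x) \<le> \<epsilon> / 4" using P[OF ex] unfolding w_def[symmetric] unfolding P_def by blast+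
      have uL: "T u \<in> L2 M" and wL: "T w \<in> L2 M" using u w(1) bounded_ops_mem[OF T] by auto
      have hH: "h \<in> H" using h(1) K(2) by blast
      have "l2_dist M (T w) (T u) = nrm (\<lambda>x. (l2_rep (T w) x - h x) + (h x - l2_rep (T u) x))" by (simp add: l2_dist_eq)
      also have "\<dots> \<le> nrm (\<lambda>x. l2_rep (T w) x - h x) + nrm (\<lambda>x. h x - l2_rep (T u) x)"
        by (intro nrm_triangle H_diff rep_H uL wL hH)
      also have "\<dots> \<le> \<epsilon> / 4 + \<epsilon> / 4" using w(2) h(2) nrm_diff_commute[of h "l2_rep (T u)"] by simp
      also have "\<dots> < \<epsilon>" using \<epsilon> by simp
      finally have "y \<in> L.mball (T w) \<epsilon>" using uL wL y by simp
      moreover have "T w \<in> K'" unfolding K'_def w_def using h(1) ex by blast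
      ultimately show "y \<in> (\<Union>x\<in>K'. L.mball x \<epsilon>)" by blast
    qed
    ultimately show "\<exists>K. finite K \<and> K \<subseteq> T ` ?B \<and> T ` ?B \<subseteq> (\<Union>x\<in>K. L.mball x \<epsilon>)" by blast
  qed
  then have "compactin L.mtopology (L.mtopology closure_of (T ` ?B))"
    using L.mtotally_bounded_eq_compact_closure_of[OF L2_mcomplete] by simp
  then show ?thesis using T by (simp add: compact_ops_def l2_topology_def)
qed

section \<open>The theorem for operators\<close>

text \<open>Closure is described by closed balls, since \<open>form_bound\<close> is a non-strict
  inequality.\<close>

lemma norm_closure_iff:
  assumes "W \<subseteq> bounded_ops M"
  shows "T \<in> op_norm_topology M closure_of W \<longleftrightarrow>
    T \<in> bounded_ops M \<and> (\<forall>r>0. \<exists>S\<in>W. form_bound (\<lambda>f g. frm T f g - frm S f g) r)"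
proof -
  interpret B: Metric_space "bounded_ops M" "op_dist M" by (rule Metric_space_bounded_ops)
  have "S \<in> B.mcball T r \<longleftrightarrow> form_bound (\<lambda>f g. frm T f g - frm S f g) r" if "T \<in> bounded_ops M" "S \<in> W" for S r
  proof -
    have S: "S \<in> bounded_ops M" using assms that(2) by blast
    show ?thesis
      using form_bound_op_dist[OF that(1) S] form_bound_mono[OF op_dist_form_bound[OF that(1) S]] that(1) S
      unfolding B.in_mcball by blast
  qed
  then show ?thesis unfolding op_norm_topology_def B.metric_closure_of_alt by blast
qed

lemma frm_op_set_plus_subspace:
  assumes "masa_bimodule M U" "masa_bimodule M V"
  shows "op_set_plus M U V \<subseteq> bounded_ops M" "form_subspace (frm ` op_set_plus M U V)"
    and "frm ` op_set_plus M U V = {(\<lambda>f g. u f g + v f g) | u v. u \<in> frm ` U \<and> v \<in> frm ` V}"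
proof -
  have U: "U \<subseteq> bounded_ops M" and V: "V \<subseteq> bounded_ops M"
    using assms by (auto simp: masa_bimodule_def op_subspace_def)
  have UB: "S \<in> bounded_ops M" if "S \<in> U" for S using U that by blast
  have VB: "S \<in> bounded_ops M" if "S \<in> V" for S using V that by blast
  show sub: "op_set_plus M U V \<subseteq> bounded_ops M"
    unfolding op_set_plus_def using op_add_bounded[OF UB VB] by blast
  show eq: "frm ` op_set_plus M U V = {(\<lambda>f g. u f g + v f g) | u v. u \<in> frm ` U \<and> v \<in> frm ` V}"
  proof (intro set_eqI iffI)
    fix t assume "t \<in> frm ` op_set_plus M U V"
    then obtain A B where "A \<in> U" "B \<in> V" "t = frm (op_add M A B)" unfolding op_set_plus_def by blast
    then show "t \<in> {(\<lambda>f g. u f g + v f g) | u v. u \<in> frm ` U \<and> v \<in> frm ` V}"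
      using frm_op_add[OF UB VB] by blast
  next
    fix t assume "t \<in> {(\<lambda>f g. u f g + v f g) | u v. u \<in> frm ` U \<and> v \<in> frm ` V}"
    then obtain A B where "A \<in> U" "B \<in> V" "t = (\<lambda>f g. frm A f g + frm B f g)" by blast
    then show "t \<in> frm ` op_set_plus M U V"
      unfolding op_set_plus_def using frm_op_add[OF UB VB] by (intro image_eqI[of _ _ "op_add M A B"]) auto
  qed
  have X: "(\<lambda>f g. 0) \<in> X" "\<And>s t. s \<in> X \<Longrightarrow> t \<in> X \<Longrightarrow> (\<lambda>f g. s f g + t f g) \<in> X"
    "\<And>c t. t \<in> X \<Longrightarrow> (\<lambda>f g. c * t f g) \<in> X"
    if "form_bimodule X" for X
    using that unfolding form_bimodule_def form_subspace_def by simp_all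
  note u = X[OF frm_bimodule]
  have I: "(\<lambda>f g. u f g + v f g) \<in> frm ` op_set_plus M U V" if "u \<in> frm ` U" "v \<in> frm ` V" for u v
    unfolding eq using that by blast
  show "form_subspace (frm ` op_set_plus M U V)" unfolding form_subspace_def
  proof (intro conjI ballI allI)
    show "frm ` op_set_plus M U V \<subseteq> bsf" using sub frm_bsf by blast
    show "(\<lambda>f g. 0) \<in> frm ` op_set_plus M U V" using I[OF u(1)[OF assms(1)] u(1)[OF assms(2)]] by simp
    fix t assume "t \<in> frm ` op_set_plus M U V"
    then obtain u1 v1 where t: "t = (\<lambda>f g. u1 f g + v1 f g)" "u1 \<in> frm ` U" "v1 \<in> frm ` V" unfolding eq by blast
    show "(\<lambda>f g. c * t f g) \<in> frm ` op_set_plus M U V" for c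
      unfolding t(1) distrib_left by (rule I[OF u(3)[OF assms(1) t(2)] u(3)[OF assms(2) t(3)]])
    fix s assume "s \<in> frm ` op_set_plus M U V"
    then obtain u2 v2 where s: "s = (\<lambda>f g. u2 f g + v2 f g)" "u2 \<in> frm ` U" "v2 \<in> frm ` V" unfolding eq by blast
    have "(\<lambda>f g. t f g + s f g) = (\<lambda>f g. (u1 f g + u2 f g) + (v1 f g + v2 f g))" by (simp add: t(1) s(1) algebra_simps)
    then show "(\<lambda>f g. t f g + s f g) \<in> frm ` op_set_plus M U V"
      using I[OF u(2)[OF assms(1) t(2) s(2)] u(2)[OF assms(2) t(3) s(3)]] by simp
  qed
qed

lemma weak_star_closure_weakly_in_sum:
  assumes "masa_bimodule M U" "masa_bimodule M V" and T: "T \<in> weak_star_topology M closure_of op_set_plus M U V"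
  shows "T \<in> bounded_ops M" "weakly_in_sum (frm T) (frm ` U) (frm ` V)"
proof -
  note Y = frm_op_set_plus_subspace[OF assms(1,2)]
  show TB: "T \<in> bounded_ops M" using T by (simp add: in_closure_of topspace_weak_star_topology)
  show "weakly_in_sum (frm T) (frm ` U) (frm ` V)" unfolding weakly_in_sum_def
  proof (intro conjI allI impI frm_bsf[OF TB])
    fix F G assume F: "ssq F" "ssq G" and k: "kills F G (frm ` U)" "kills F G (frm ` V)"
    have b: "u \<in> bsf" if "u \<in> frm ` U \<or> u \<in> frm ` V" for u
      using that form_bimodule_bsf[OF frm_bimodule[OF assms(1)]] form_bimodule_bsf[OF frm_bimodule[OF assms(2)]] by blast
    have "kills F G (frm ` op_set_plus M U V)"
      unfolding kills_def Y(3)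
    proof
      fix t assume "t \<in> {(\<lambda>f g. u f g + v f g) | u v. u \<in> frm ` U \<and> v \<in> frm ` V}"
      then obtain u v where t: "t = (\<lambda>f g. u f g + v f g)" and u: "u \<in> frm ` U" and v: "v \<in> frm ` V" by blast
      have "psum F G u = 0" "psum F G v = 0" using k u v unfolding kills_def by blast+
      then show "psum F G t = 0" unfolding t using psum_add[OF F b[OF disjI1[OF u]] b[OF disjI2[OF v]]] by simp
    qed
    then show "psum F G (frm T) = 0" using weak_star_closure_iff[OF Y(1,2) TB] T F by blast
  qed
qed

end

theorem theorem4p2:
  fixes M :: "'a measure" and U V :: "'a l2op set"
  assumes "standard_borel_space M"
    and "sigma_finite_measure M"
    and "weak_star_closed_masa_bimodule M U"
    and "weak_star_closed_masa_bimodule M V"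
    and "bimodule_of_uniqueness M (U \<inter> V)"
  shows "(weak_star_topology M closure_of op_set_plus M U V) \<inter> compact_ops M =
         op_norm_topology M closure_of
           (op_set_plus M (U \<inter> compact_ops M) (V \<inter> compact_ops M))"
proof -
  interpret l2_space M using assms(2) by (rule l2_space.intro)
  have U: "masa_bimodule M U" "closedin (weak_star_topology M) U" and V: "masa_bimodule M V" "closedin (weak_star_topology M) V"
    using assms(3,4) by (auto simp: weak_star_closed_masa_bimodule_def)
  have UB: "U \<subseteq> bounded_ops M" and VB: "V \<subseteq> bounded_ops M"
    using U(1) V(1) by (auto simp: masa_bimodule_def op_subspace_def)
  have uniq: "U \<inter> V \<inter> compact_ops M = {op_zero M}" using assms(5) by (simp add: bimodule_of_uniqueness_def)
  note P = frm_op_set_plus_subspace[OF U(1) V(1)]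
  let ?W = "op_set_plus M (U \<inter> compact_ops M) (V \<inter> compact_ops M)"
  have WP: "?W \<subseteq> op_set_plus M U V" unfolding op_set_plus_def by blast
  then have WB: "?W \<subseteq> bounded_ops M" using P(1) by blast
  \<comment> \<open>A form in both images comes from a single operator by injectivity of
    \<open>frm\<close>, so the uniqueness of \<open>U \<inter> V\<close> applies.\<close>
  have UV: "r = (\<lambda>f g. 0)" if r: "r \<in> frm ` U" "r \<in> frm ` V" "r \<in> APX" for r
  proof -
    obtain A B where A: "A \<in> U" "r = frm A" and B: "B \<in> V" "r = frm B" using r by blast
    have "A = B" using frm_inj[of A B] A B UB VB by blast
    moreover have "A \<in> compact_ops M" using APX_compact[of A] A UB r(3) by blast
    ultimately have "A = op_zero M" using uniq A(1) B(1) by blast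
    then show ?thesis by (simp add: A(2) frm_op_zero)
  qed
  show ?thesis
  proof (intro set_eqI iffI)
    fix T assume "T \<in> (weak_star_topology M closure_of op_set_plus M U V) \<inter> compact_ops M"
    then have cl: "T \<in> weak_star_topology M closure_of op_set_plus M U V" and K: "T \<in> compact_ops M" by auto
    note T = weak_star_closure_weakly_in_sum[OF U(1) V(1) cl]
    show "T \<in> op_norm_topology M closure_of ?W"
      unfolding norm_closure_iff[OF WB]
    proof (intro conjI allI impI T(1))
      fix r :: real assume r: "r > 0"
      obtain u v where u: "u \<in> frm ` U" "u \<in> APX" and v: "v \<in> frm ` V" "v \<in> APX"
        and b: "form_bound (\<lambda>f g. frm T f g - (u f g + v f g)) r"
        using compact_form_in_norm_closure[OF frm_bimodule[OF U(1)] frm_reflexive[OF U] frm_bimodule[OF V(1)]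
            frm_reflexive[OF V] UV T(2) compact_APX[OF K] r] by blast
      obtain A where A: "A \<in> U" "u = frm A" using u(1) by blast
      obtain B where B: "B \<in> V" "v = frm B" using v(1) by blast
      have AB: "A \<in> bounded_ops M" "B \<in> bounded_ops M" using A(1) B(1) UB VB by auto
      have "A \<in> compact_ops M" "B \<in> compact_ops M"
        using APX_compact[OF AB(1)] APX_compact[OF AB(2)] u(2) v(2) A(2) B(2) by auto
      then have "op_add M A B \<in> ?W" unfolding op_set_plus_def using A(1) B(1) by blast
      moreover have "form_bound (\<lambda>f g. frm T f g - frm (op_add M A B) f g) r"
        using b by (simp add: frm_op_add[OF AB] A(2) B(2))
      ultimately show "\<exists>S\<in>?W. form_bound (\<lambda>f g. frm T f g - frm S f g) r" by (intro bexI[of _ "op_add M A B"])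
    qed
  next
    fix T assume "T \<in> op_norm_topology M closure_of ?W"
    then have TB: "T \<in> bounded_ops M" and ap: "\<And>r. r > 0 \<Longrightarrow> \<exists>S\<in>?W. form_bound (\<lambda>f g. frm T f g - frm S f g) r"
      unfolding norm_closure_iff[OF WB] by blast+
    have WA: "frm S \<in> APX" if SW: "S \<in> ?W" for S
    proof -
      obtain A B where A: "A \<in> U" "A \<in> compact_ops M" and B: "B \<in> V" "B \<in> compact_ops M" and S: "S = op_add M A B"
        using SW unfolding op_set_plus_def by blast
      have "A \<in> bounded_ops M" "B \<in> bounded_ops M" using A(1) B(1) UB VB by auto
      from frm_op_add[OF this] show ?thesis unfolding S using APX_add[OF compact_APX[OF A(2)] compact_APX[OF B(2)]] by simp
    qed
    have "frm T \<in> APX"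
    proof (rule APX_limit[OF frm_bsf[OF TB]])
      fix r :: real assume "r > 0"
      then obtain S where "S \<in> ?W" "form_bound (\<lambda>f g. frm T f g - frm S f g) r" using ap by blast
      then show "\<exists>s\<in>APX. form_bound (\<lambda>f g. frm T f g - s f g) r" using WA by (intro bexI[of _ "frm S"])
    qed
    then have "T \<in> compact_ops M" by (rule APX_compact[OF TB])
    moreover have "T \<in> weak_star_topology M closure_of op_set_plus M U V"
      unfolding weak_star_closure_iff[OF P(1,2) TB]
    proof (intro allI impI)
      fix F G assume F: "ssq F" "ssq G" and k: "kills F G (frm ` op_set_plus M U V)"
      \<comment> \<open>Nuclear functionals are continuous in norm with constant \<open>C\<close>,
        so annihilation of the sums passes to their norm limit \<open>T\<close>.\<close>
      define C where "C = (\<Sum>n. (nrm (F n))\<^sup>2 + (nrm (G n))\<^sup>2)"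
      have C: "C \<ge> 0" unfolding C_def using F by (intro suminf_nonneg summable_add) (auto simp: ssq_def)
      have "cmod (psum F G (frm T)) \<le> 0 + e" if e: "e > 0" for e
      proof -
        have "e / (C + 1) > 0" using e C by simp
        then obtain S where S: "S \<in> ?W" and b: "form_bound (\<lambda>f g. frm T f g - frm S f g) (e / (C + 1))" using ap by blast
        have SB: "S \<in> bounded_ops M" using S WB by blast
        have "psum F G (frm S) = 0" using k S WP unfolding kills_def by blast
        then have "psum F G (frm T) = psum F G (\<lambda>f g. frm T f g - frm S f g)"
          using psum_diff[OF F frm_bsf[OF TB] frm_bsf[OF SB]] by simp
        then have "cmod (psum F G (frm T)) \<le> e / (C + 1) * C" unfolding C_def using psum_bound(3)[OF F b] by (simp add: C_def)
        also have "\<dots> \<le> e" using e C by (simp add: field_simps)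
        finally show ?thesis by simp
      qed
      then have "cmod (psum F G (frm T)) \<le> 0" by (rule field_le_epsilon)
      then show "psum F G (frm T) = 0" by simp
    qed
    ultimately show "T \<in> (weak_star_topology M closure_of op_set_plus M U V) \<inter> compact_ops M" by blast
  qed
qed

end
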